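(* Let $N\ge1$. The set $\mathcal{A}^N_{Slice}(\mathbb{B})$ is a right quaternionic reproducing kernel Hilbert space whose reproducing kernel is given by $$B_S^N(q,r)=\bigl(P_N(q,r)Q_N(q,r)\bigr)*\psi_N(q,r),\qquad (q,r)\in\mathbb{B}\times\mathbb{B},$$ where $$P_N(q,r)=\frac N\pi\sum_{k=0}^{2N}(-1)^k\binom{2N}{k}\overline q^{\,k}\,\overline r^{\,k},\qquad Q_N(q,r)=(1-2\mathrm{Re}(q)\overline r+|q|^2\overline r^2)^{-2N},$$ $$\psi_N(q,r)=\sum_{k=0}^{N-1}(-1)^k\binom{N}{k+1}\binom{N+k}{N}\left(1-\overline q r-q\overline r+\overline q q\,\overline r r\right)^{(N-1-k)*}*\left(\overline q q-q\overline r-\overline q r+\overline r r\right)^{k*},$$ and the $*$-products and $*$-powers are taken with respect to the first variable $q$. That is, for each $r\in\mathbb{B}$ the function $q\mapsto B_S^N(q,r)$ belongs to $\mathcal{A}^N_{Slice}(\mathbb{B})$ and $f(r)=\langle f,B_S^N(\cdot,r)\rangle$ for all $f\in\mathcal{A}^N_{Slice}(\mathbb{B})$.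
   Context: $\mathbb{H}$ denotes the quaternions, $\mathbb{B}=\{q\in\mathbb{H}:|q|<1\}$, $\mathbb{S}=\{q\in\mathbb{H}: q^2=-1\}$, and for $I\in\mathbb{S}$, $\mathbb{C}_I=\mathbb{R}+\mathbb{R}I$, $\mathbb{B}_I=\mathbb{B}\cap\mathbb{C}_I$; $f_I$ is the restriction of $f$ to $\mathbb{B}_I$. Slice polyanalytic functions: let $\mathcal{U}=\{(x,y)\in\mathbb{R}^2:x^2+y^2<1\}$. A function $f:\mathbb{B}\to\mathbb{H}$ is a (left) slice function if $f(x+Iy)=\alpha(x,y)+I\beta(x,y)$ for all $x+Iy\in\mathbb{B}$, $I\in\mathbb{S}$, where $\alpha,\beta:\mathcal{U}\to\mathbb{H}$ do not depend on $I$ and satisfy $\alpha(x,-y)=\alpha(x,y)$, $\beta(x,-y)=-\beta(x,y)$. If moreover $\alpha,\beta$ are of class $\mathcal{C}^N$ and $\frac{1}{2^N}(\partial_x+I\partial_y)^N(\alpha+I\beta)=0$ for all $I\in\mathbb{S}$, then $f$ is (left) slice polyanalytic of order $N$; the set of these is $\mathcal{SP}_N(\mathbb{B})$. The $*$-product of two slice functions $f=\alpha_1+I\beta_1$, $g=\alpha_2+I\beta_2$ is the slice function $f*g=(\alpha_1\alpha_2-\beta_1\beta_2)+I(\alpha_1\beta_2+\beta_1\alpha_2)$; $f^{k*}$ is the $k$-th $*$-power ($f^{0*}=1$). The product $P_NQ_N$ is the pointwise product. The slice polyanalytic Bergman space (of the second kind) $\mathcal{A}^N_{Slice}(\mathbb{B})$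 is the set of $f\in\mathcal{SP}_N(\mathbb{B})$ with $\int_{\mathbb{B}_I}|f_I(p)|^2d\lambda_I(p)<\infty$, where $I\in\mathbb{S}$ and $d\lambda_I(p)=dx\,dy$ for $p=x+Iy$; as a set it does not depend on the choice of $I\in\mathbb{S}$. Its inner product is $\langle f,g\rangle=\int_{\mathbb{B}_I}\overline{g_I(p)}f_I(p)\,d\lambda_I(p)$. *)

theory Defs
  imports "HOL-Analysis.Analysis" "HOL-Library.Function_Algebras"
begin

section \<open>Quaternions\<close>

codatatype quat = Quat (qRe: real) (qI: real) (qJ: real) (qK: real)

lemma quat_eqI [intro?]:
  "qRe x = qRe y \<Longrightarrow> qI x = qI y \<Longrightarrow> qJ x = qJ y \<Longrightarrow> qK x = qK y \<Longrightarrow> x = y"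
  by (rule quat.expand) simp

lemma quat_eq_iff:
  "x = y \<longleftrightarrow> qRe x = qRe y \<and> qI x = qI y \<and> qJ x = qJ y \<and> qK x = qK y"
  by (auto intro: quat.expand)

instantiation quat :: ring_1
begin

primcorec zero_quat where
  "qRe 0 = 0" | "qI 0 = 0" | "qJ 0 = 0" | "qK 0 = 0"

primcorec one_quat where
  "qRe 1 = 1" | "qI 1 = 0" | "qJ 1 = 0" | "qK 1 = 0"

primcorec plus_quat where
  "qRe (x + y) = qRe x + qRe y"
| "qI (x + y) = qI x + qI y"
| "qJ (x + y) = qJ x + qJ y"
| "qK (x + y) = qK x + qK y"

primcorec uminus_quat where
  "qRe (- x) = - qRe x"
| "qI (- x) = - qI x"
| "qJ (- x) = - qJ x"
| "qK (- x) = - qK x"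

primcorec minus_quat where
  "qRe (x - y) = qRe x - qRe y"
| "qI (x - y) = qI x - qI y"
| "qJ (x - y) = qJ x - qJ y"
| "qK (x - y) = qK x - qK y"

primcorec times_quat where
  "qRe (x * y) = qRe x * qRe y - qI x * qI y - qJ x * qJ y - qK x * qK y"
| "qI (x * y) = qRe x * qI y + qI x * qRe y + qJ x * qK y - qK x * qJ y"
| "qJ (x * y) = qRe x * qJ y - qI x * qK y + qJ x * qRe y + qK x * qI y"
| "qK (x * y) = qRe x * qK y + qI x * qJ y - qJ x * qI y + qK x * qRe y"

instance
  by standard (simp_all add: quat_eq_iff algebra_simps)

end

instantiation quat :: real_algebra_1
begin

primcorec scaleR_quat where
  "qRe (scaleR r x) = r * qRe x"
| "qI (scaleR r x) = r * qI x"
| "qJ (scaleR r x) = r * qJ x"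
| "qK (scaleR r x) = r * qK x"

instance
  by standard (simp_all add: quat_eq_iff algebra_simps)

end

primcorec qcnj :: "quat \<Rightarrow> quat" where
  "qRe (qcnj q) = qRe q"
| "qI (qcnj q) = - qI q"
| "qJ (qcnj q) = - qJ q"
| "qK (qcnj q) = - qK q"

lemma quat_square_sum_pos:
  assumes "q \<noteq> 0"
  shows "(qRe q)\<^sup>2 + (qI q)\<^sup>2 + (qJ q)\<^sup>2 + (qK q)\<^sup>2 > 0"
proof -
  have "qRe q \<noteq> 0 \<or> qI q \<noteq> 0 \<or> qJ q \<noteq> 0 \<or> qK q \<noteq> 0"
    using assms by (simp add: quat_eq_iff)
  then have "(qRe q)\<^sup>2 > 0 \<or> (qI q)\<^sup>2 > 0 \<or> (qJ q)\<^sup>2 > 0 \<or> (qK q)\<^sup>2 > 0"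
    by simp
  then show ?thesis
    using zero_le_power2[of "qRe q"] zero_le_power2[of "qI q"] zero_le_power2[of "qJ q"]
      zero_le_power2[of "qK q"]
    by linarith
qed

instantiation quat :: real_div_algebra
begin

definition inverse_quat where
  "inverse q = (1 / ((qRe q)\<^sup>2 + (qI q)\<^sup>2 + (qJ q)\<^sup>2 + (qK q)\<^sup>2)) *\<^sub>R qcnj q"

definition divide_quat where
  "x div y = x * inverse y" for x y :: quat

lemma quat_mult_qcnj:
  "q * qcnj q = ((qRe q)\<^sup>2 + (qI q)\<^sup>2 + (qJ q)\<^sup>2 + (qK q)\<^sup>2) *\<^sub>R 1"
  "qcnj q * q = ((qRe q)\<^sup>2 + (qI q)\<^sup>2 + (qJ q)\<^sup>2 + (qK q)\<^sup>2) *\<^sub>R 1"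
  by (simp_all add: quat_eq_iff power2_eq_square)

instance
proof
  fix q :: quat
  assume "q \<noteq> 0"
  from quat_square_sum_pos[OF this]
  show "inverse q * q = 1" "q * inverse q = 1"
    by (simp_all add: inverse_quat_def quat_mult_qcnj)
qed (auto simp: inverse_quat_def divide_quat_def quat_eq_iff)

end

instantiation quat :: real_inner
begin

definition inner_quat where
  "inner x y = qRe x * qRe y + qI x * qI y + qJ x * qJ y + qK x * qK y"

definition norm_quat where
  "norm x = sqrt ((qRe x)\<^sup>2 + (qI x)\<^sup>2 + (qJ x)\<^sup>2 + (qK x)\<^sup>2)"

definition dist_quat where
  "dist x y = norm (x - y)" for x y :: quat

definition sgn_quat where
  "sgn x = x /\<^sub>R norm x" for x :: quat

definition uniformity_quat :: "(quat \<times> quat) filter" where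
  "uniformity_quat = (INF e\<in>{0 <..}. principal {(x, y). dist x y < e})"

definition open_quat :: "quat set \<Rightarrow> bool" where
  "open_quat U \<longleftrightarrow> (\<forall>x\<in>U. eventually (\<lambda>(x', y). x' = x \<longrightarrow> y \<in> U) uniformity)"

instance
proof
  fix x y z :: quat and r :: real
  show "inner x y = inner y x"
    by (simp add: inner_quat_def)
  show "inner (x + y) z = inner x z + inner y z" "inner (r *\<^sub>R x) y = r * inner x y"
    by (simp_all add: inner_quat_def algebra_simps)
  show "0 \<le> inner x x"
    by (simp add: inner_quat_def)
  show "inner x x = 0 \<longleftrightarrow> x = 0"
  proof
    assume "inner x x = 0"
    then show "x = 0"
      using quat_square_sum_pos[of x] by (force simp: inner_quat_def power2_eq_square)
  qed (simp add: inner_quat_def)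
  show "norm x = sqrt (inner x x)"
    by (simp add: norm_quat_def inner_quat_def power2_eq_square)
qed (rule dist_quat_def sgn_quat_def open_quat_def uniformity_quat_def)+

end

instance quat :: real_normed_div_algebra
proof
  fix x y :: quat
  show "norm (x * y) = norm x * norm y"
    unfolding norm_quat_def real_sqrt_mult[symmetric]
    by (rule arg_cong[where f = sqrt]) (simp add: power2_eq_square algebra_simps)
qed

instantiation quat :: euclidean_space
begin

definition Basis_quat :: "quat set" where
  "Basis = {Quat 1 0 0 0, Quat 0 1 0 0, Quat 0 0 1 0, Quat 0 0 0 1}"

instance
proof
  show "(Basis :: quat set) \<noteq> {}" "finite (Basis :: quat set)"
    by (simp_all add: Basis_quat_def)
  fix u v :: quat
  show "u \<in> Basis \<Longrightarrow> v \<in> Basis \<Longrightarrow> inner u v = (if u = v then 1 else 0)"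
    unfolding Basis_quat_def by (elim insertE emptyE) (simp_all add: inner_quat_def)
  show "(\<forall>u\<in>Basis. inner v u = 0) \<longleftrightarrow> v = 0"
    by (simp add: Basis_quat_def inner_quat_def) (auto simp: quat_eq_iff)
qed

end


section \<open>Slice functions on the quaternionic unit ball\<close>

definition qball :: "quat set" where
  "qball = {q. norm q < 1}"

definition imag_units :: "quat set" where
  "imag_units = {q. q ^ 2 = - 1}"

definition slice_pt :: "quat \<Rightarrow> real \<times> real \<Rightarrow> quat" where
  "slice_pt I p = of_real (fst p) + I * of_real (snd p)"

definition unit_disc :: "(real \<times> real) set" where
  "unit_disc = {(x, y). x\<^sup>2 + y\<^sup>2 < 1}"

definition slice_induced ::
  "(quat \<Rightarrow> quat) \<Rightarrow> (real \<times> real \<Rightarrow> quat) \<Rightarrow> (real \<times> real \<Rightarrow> quat) \<Rightarrow> bool" where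
  "slice_induced f \<alpha> \<beta> \<longleftrightarrow>
     (\<forall>x y. (x, y) \<in> unit_disc \<longrightarrow> \<alpha> (x, - y) = \<alpha> (x, y) \<and> \<beta> (x, - y) = - \<beta> (x, y)) \<and>
     (\<forall>I\<in>imag_units. \<forall>p\<in>unit_disc. f (slice_pt I p) = \<alpha> p + I * \<beta> p)"

text \<open>
  A function on the ball is represented by the total function that vanishes outside the ball,
  so that equality of representatives is equality on the ball. The \<open>*\<close>-product only looks at its
  arguments inside the ball, and its value is such a representative. It is determined by its
  defining property whenever both arguments are slice functions, see \<open>slice_star_eqI\<close> below;
  for other arguments it is unspecified.
\<close>

definition is_slice_star :: "(quat \<Rightarrow> quat) \<Rightarrow> (quat \<Rightarrow> quat) \<Rightarrow> (quat \<Rightarrow> quat) \<Rightarrow> bool" where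
  "is_slice_star f g h \<longleftrightarrow> (\<forall>q. q \<notin> qball \<longrightarrow> h q = 0) \<and>
     (\<exists>\<alpha>\<^sub>1 \<beta>\<^sub>1 \<alpha>\<^sub>2 \<beta>\<^sub>2. slice_induced f \<alpha>\<^sub>1 \<beta>\<^sub>1 \<and> slice_induced g \<alpha>\<^sub>2 \<beta>\<^sub>2 \<and>
        slice_induced h (\<lambda>p. \<alpha>\<^sub>1 p * \<alpha>\<^sub>2 p - \<beta>\<^sub>1 p * \<beta>\<^sub>2 p) (\<lambda>p. \<alpha>\<^sub>1 p * \<beta>\<^sub>2 p + \<beta>\<^sub>1 p * \<alpha>\<^sub>2 p))"

definition slice_star :: "(quat \<Rightarrow> quat) \<Rightarrow> (quat \<Rightarrow> quat) \<Rightarrow> quat \<Rightarrow> quat" (infixl "\<star>" 70) where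
  "f \<star> g = (THE h. is_slice_star f g h)"

primrec slice_star_power :: "(quat \<Rightarrow> quat) \<Rightarrow> nat \<Rightarrow> quat \<Rightarrow> quat" where
  "slice_star_power f 0 = (\<lambda>q. if q \<in> qball then 1 else 0)"
| "slice_star_power f (Suc k) = f \<star> slice_star_power f k"

lemma imag_units_mult_self: "I \<in> imag_units \<Longrightarrow> I * I = - 1"
  by (simp add: imag_units_def power2_eq_square)

lemma imag_units_iff:
  "I \<in> imag_units \<longleftrightarrow> qRe I = 0 \<and> (qI I)\<^sup>2 + (qJ I)\<^sup>2 + (qK I)\<^sup>2 = 1"
proof
  assume "I \<in> imag_units"
  then have *: "qRe I * qRe I - qI I * qI I - qJ I * qJ I - qK I * qK I = - 1"
      "qRe I * qI I = 0" "qRe I * qJ I = 0" "qRe I * qK I = 0"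
    by (auto simp: imag_units_def power2_eq_square quat_eq_iff)
  have "qRe I = 0"
  proof (rule ccontr)
    assume "qRe I \<noteq> 0"
    with * have "qRe I * qRe I = - 1" by simp
    then show False using zero_le_square[of "qRe I"] by simp
  qed
  with * show "qRe I = 0 \<and> (qI I)\<^sup>2 + (qJ I)\<^sup>2 + (qK I)\<^sup>2 = 1"
    by (simp add: power2_eq_square)
next
  assume "qRe I = 0 \<and> (qI I)\<^sup>2 + (qJ I)\<^sup>2 + (qK I)\<^sup>2 = 1"
  then show "I \<in> imag_units"
    by (auto simp: imag_units_def power2_eq_square quat_eq_iff)
qed

lemma imag_units_uminus: "I \<in> imag_units \<Longrightarrow> - I \<in> imag_units"
  by (simp add: imag_units_def)

lemma imag_units_nonempty: "\<exists>I. I \<in> imag_units"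
  by (rule exI[of _ "Quat 0 1 0 0"]) (simp add: imag_units_iff)

lemma qRe_of_real [simp]: "qRe (of_real x) = x"
  and qI_of_real [simp]: "qI (of_real x) = 0"
  and qJ_of_real [simp]: "qJ (of_real x) = 0"
  and qK_of_real [simp]: "qK (of_real x) = 0"
  by (simp_all add: of_real_def)

lemma norm_slice_pt:
  assumes "I \<in> imag_units"
  shows "(norm (slice_pt I (x, y)))\<^sup>2 = x\<^sup>2 + y\<^sup>2"
proof -
  have *: "qRe I = 0" "(qI I)\<^sup>2 + (qJ I)\<^sup>2 + (qK I)\<^sup>2 = 1"
    using assms by (simp_all add: imag_units_iff)
  have "(norm (slice_pt I (x, y)))\<^sup>2 = x\<^sup>2 + (qI I * y)\<^sup>2 + (qJ I * y)\<^sup>2 + (qK I * y)\<^sup>2"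
    by (simp add: norm_quat_def slice_pt_def *(1))
  also have "\<dots> = x\<^sup>2 + ((qI I)\<^sup>2 + (qJ I)\<^sup>2 + (qK I)\<^sup>2) * y\<^sup>2"
    by (simp add: power_mult_distrib distrib_right)
  finally show ?thesis
    by (simp add: *(2))
qed

lemma slice_pt_in_qball:
  assumes "I \<in> imag_units"
  shows "slice_pt I p \<in> qball \<longleftrightarrow> p \<in> unit_disc"
proof -
  obtain x y where p: "p = (x, y)" by fastforce
  have "slice_pt I p \<in> qball \<longleftrightarrow> (norm (slice_pt I p))\<^sup>2 < 1"
    by (simp add: qball_def abs_square_less_1)
  then show ?thesis
    using norm_slice_pt[OF assms] by (simp add: p unit_disc_def)
qed

lemma ex_slice_pt: "\<exists>I\<in>imag_units. \<exists>p. q = slice_pt I p"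
proof -
  define y where "y = sqrt ((qI q)\<^sup>2 + (qJ q)\<^sup>2 + (qK q)\<^sup>2)"
  have y2: "y\<^sup>2 = (qI q)\<^sup>2 + (qJ q)\<^sup>2 + (qK q)\<^sup>2"
    by (simp add: y_def)
  show ?thesis
  proof (cases "y = 0")
    case True
    then have "(qI q)\<^sup>2 + (qJ q)\<^sup>2 + (qK q)\<^sup>2 = 0"
      using y2 by simp
    then have "(qI q)\<^sup>2 = 0" "(qJ q)\<^sup>2 = 0" "(qK q)\<^sup>2 = 0"
      using zero_le_power2[of "qI q"] zero_le_power2[of "qJ q"] zero_le_power2[of "qK q"]
      by linarith+
    then have "q = slice_pt (Quat 0 1 0 0) (qRe q, 0)"
      by (simp add: slice_pt_def quat_eq_iff)
    moreover have "Quat 0 1 0 0 \<in> imag_units"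
      by (simp add: imag_units_iff)
    ultimately show ?thesis by blast
  next
    case False
    have "(qI q / y)\<^sup>2 + (qJ q / y)\<^sup>2 + (qK q / y)\<^sup>2 = 1"
      using False by (simp add: power_divide add_divide_distrib[symmetric] y2[symmetric])
    then have "Quat 0 (qI q / y) (qJ q / y) (qK q / y) \<in> imag_units"
      by (simp add: imag_units_iff)
    moreover have "q = slice_pt (Quat 0 (qI q / y) (qJ q / y) (qK q / y)) (qRe q, y)"
      using False by (simp add: slice_pt_def quat_eq_iff)
    ultimately show ?thesis by blast
  qed
qed

lemma slice_inducedD:
  "slice_induced f \<alpha> \<beta> \<Longrightarrow> I \<in> imag_units \<Longrightarrow> p \<in> unit_disc \<Longrightarrow>
   f (slice_pt I p) = \<alpha> p + I * \<beta> p"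
  by (simp add: slice_induced_def)

lemma slice_induced_unique:
  assumes 1: "slice_induced f \<alpha> \<beta>" and 2: "slice_induced f \<alpha>' \<beta>'" and p: "p \<in> unit_disc"
  shows "\<alpha> p = \<alpha>' p" "\<beta> p = \<beta>' p"
proof -
  obtain I where I: "I \<in> imag_units" using imag_units_nonempty by blast
  have "\<alpha> p + I * \<beta> p = \<alpha>' p + I * \<beta>' p" "\<alpha> p + (- I) * \<beta> p = \<alpha>' p + (- I) * \<beta>' p"
    using 1 2 p I imag_units_uminus[OF I] unfolding slice_induced_def by metis+
  then have a: "\<alpha> p + \<alpha> p = \<alpha>' p + \<alpha>' p" and b: "I * \<beta> p + I * \<beta> p = I * \<beta>' p + I * \<beta>' p"
    by (simp_all add: quat_eq_iff)
  show "\<alpha> p = \<alpha>' p"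
    using a by (simp add: quat_eq_iff)
  have "I * \<beta> p = I * \<beta>' p"
    using b by (simp add: quat_eq_iff)
  moreover have "I \<noteq> 0"
    using I by (auto simp: imag_units_iff)
  ultimately show "\<beta> p = \<beta>' p" by simp
qed

lemma slice_star_eqI:
  assumes f: "slice_induced f \<alpha>\<^sub>1 \<beta>\<^sub>1" and g: "slice_induced g \<alpha>\<^sub>2 \<beta>\<^sub>2"
    and h: "slice_induced h (\<lambda>p. \<alpha>\<^sub>1 p * \<alpha>\<^sub>2 p - \<beta>\<^sub>1 p * \<beta>\<^sub>2 p) (\<lambda>p. \<alpha>\<^sub>1 p * \<beta>\<^sub>2 p + \<beta>\<^sub>1 p * \<alpha>\<^sub>2 p)"
    and h0: "\<And>q. q \<notin> qball \<Longrightarrow> h q = 0"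
  shows "f \<star> g = h"
  unfolding slice_star_def
proof (rule the_equality)
  show "is_slice_star f g h"
    unfolding is_slice_star_def
  proof (rule conjI)
    show "\<forall>q. q \<notin> qball \<longrightarrow> h q = 0"
      using h0 by simp
  qed (rule exI[of _ \<alpha>\<^sub>1], rule exI[of _ \<beta>\<^sub>1], rule exI[of _ \<alpha>\<^sub>2], rule exI[of _ \<beta>\<^sub>2],
       intro conjI f g h)
next
  fix k
  assume *: "is_slice_star f g k"
  then have k0: "k q = 0" if "q \<notin> qball" for q
    using that by (simp add: is_slice_star_def)
  from * obtain a1 b1 a2 b2 where
        f': "slice_induced f a1 b1" and g': "slice_induced g a2 b2"
    and k: "slice_induced k (\<lambda>p. a1 p * a2 p - b1 p * b2 p) (\<lambda>p. a1 p * b2 p + b1 p * a2 p)"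
    unfolding is_slice_star_def by (elim conjE exE) (rule that)
  show "k = h"
  proof
    fix q
    obtain I p where I: "I \<in> imag_units" and q: "q = slice_pt I p"
      using ex_slice_pt by blast
    show "k q = h q"
    proof (cases "q \<in> qball")
      case True
      then have p: "p \<in> unit_disc"
        using I q slice_pt_in_qball by blast
      show ?thesis
        using slice_inducedD[OF h I p] slice_inducedD[OF k I p]
        by (simp add: q slice_induced_unique[OF f f' p] slice_induced_unique[OF g g' p])
    qed (simp add: h0 k0)
  qed
qed


section \<open>Slice polyanalytic functions\<close>

text \<open>The following two operators are only meaningful where the partial derivatives exist.\<close>

definition partial_x :: "(real \<times> real \<Rightarrow> 'a) \<Rightarrow> real \<times> real \<Rightarrow> 'a::real_normed_vector" where
  "partial_x F p = vector_derivative (\<lambda>t. F (t, snd p)) (at (fst p))"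

definition partial_y :: "(real \<times> real \<Rightarrow> 'a) \<Rightarrow> real \<times> real \<Rightarrow> 'a::real_normed_vector" where
  "partial_y F p = vector_derivative (\<lambda>t. F (fst p, t)) (at (snd p))"

text \<open>Class \<open>C\<^sup>k\<close> on an open set: all iterated partial derivatives of order at most \<open>k\<close> exist
  and are continuous.\<close>

primrec Ck_on :: "nat \<Rightarrow> (real \<times> real) set \<Rightarrow> (real \<times> real \<Rightarrow> 'a::real_normed_vector) \<Rightarrow> bool" where
  "Ck_on 0 U F \<longleftrightarrow> continuous_on U F"
| "Ck_on (Suc k) U F \<longleftrightarrow> continuous_on U F \<and>
     (\<forall>(x, y)\<in>U. (\<lambda>t. F (t, y)) differentiable at x \<and> (\<lambda>t. F (x, t)) differentiable at y) \<and>
     Ck_on k U (partial_x F) \<and> Ck_on k U (partial_y F)"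

definition slice_CR :: "quat \<Rightarrow> (real \<times> real \<Rightarrow> quat) \<Rightarrow> real \<times> real \<Rightarrow> quat" where
  "slice_CR I F p = partial_x F p + I * partial_y F p"

definition slice_polyanalytic :: "nat \<Rightarrow> (quat \<Rightarrow> quat) set" where
  "slice_polyanalytic N = {f. (\<forall>q. q \<notin> qball \<longrightarrow> f q = 0) \<and>
     (\<exists>\<alpha> \<beta>. slice_induced f \<alpha> \<beta> \<and> Ck_on N unit_disc \<alpha> \<and> Ck_on N unit_disc \<beta> \<and>
        (\<forall>I\<in>imag_units. \<forall>p\<in>unit_disc.
           (1 / 2 ^ N) *\<^sub>R (slice_CR I ^^ N) (\<lambda>p. \<alpha> p + I * \<beta> p) p = 0))}"

text \<open>The measure on the slice \<open>{x + I * y}\<close> is \<open>dx dy\<close>, so integrals over the slice of the ball are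
  integrals over the unit disc in the coordinates \<open>(x, y)\<close>.\<close>

definition slice_bergman_space :: "nat \<Rightarrow> quat \<Rightarrow> (quat \<Rightarrow> quat) set" where
  "slice_bergman_space N I = {f \<in> slice_polyanalytic N.
     (\<integral>\<^sup>+ p \<in> unit_disc. ennreal ((norm (f (slice_pt I p)))\<^sup>2) \<partial>lborel) < \<infinity>}"

definition slice_bergman_inner :: "quat \<Rightarrow> (quat \<Rightarrow> quat) \<Rightarrow> (quat \<Rightarrow> quat) \<Rightarrow> quat" where
  "slice_bergman_inner I f g =
     (LINT p : unit_disc | lborel. qcnj (g (slice_pt I p)) * f (slice_pt I p))"


section \<open>Right quaternionic reproducing kernel Hilbert spaces\<close>

definition ip_norm :: "('v \<Rightarrow> 'v \<Rightarrow> quat) \<Rightarrow> 'v \<Rightarrow> real" where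
  "ip_norm ip v = sqrt (qRe (ip v v))"

locale right_quat_hilbert_space =
  fixes V :: "'v::ab_group_add set"
    and scale :: "'v \<Rightarrow> quat \<Rightarrow> 'v"
    and ip :: "'v \<Rightarrow> 'v \<Rightarrow> quat"
  assumes zero_mem: "0 \<in> V"
    and add_mem: "u \<in> V \<Longrightarrow> v \<in> V \<Longrightarrow> u + v \<in> V"
    and scale_mem: "u \<in> V \<Longrightarrow> scale u a \<in> V"
    and scale_add_left: "u \<in> V \<Longrightarrow> v \<in> V \<Longrightarrow> scale (u + v) a = scale u a + scale v a"
    and scale_add_right: "u \<in> V \<Longrightarrow> scale u (a + b) = scale u a + scale u b"
    and scale_scale: "u \<in> V \<Longrightarrow> scale (scale u a) b = scale u (a * b)"
    and scale_one: "u \<in> V \<Longrightarrow> scale u 1 = u"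
    and ip_add: "u \<in> V \<Longrightarrow> v \<in> V \<Longrightarrow> w \<in> V \<Longrightarrow> ip (u + v) w = ip u w + ip v w"
    and ip_scale: "u \<in> V \<Longrightarrow> w \<in> V \<Longrightarrow> ip (scale u a) w = ip u w * a"
    and ip_cnj: "u \<in> V \<Longrightarrow> w \<in> V \<Longrightarrow> ip w u = qcnj (ip u w)"
    and ip_nonneg: "u \<in> V \<Longrightarrow> 0 \<le> qRe (ip u u)"
    and ip_definite: "u \<in> V \<Longrightarrow> ip u u = 0 \<Longrightarrow> u = 0"
    and complete: "range X \<subseteq> V \<Longrightarrow>
      (\<And>e. e > 0 \<Longrightarrow> \<exists>M. \<forall>m\<ge>M. \<forall>n\<ge>M. ip_norm ip (X m - X n) < e) \<Longrightarrow>
      \<exists>L\<in>V. (\<lambda>n::nat. ip_norm ip (X n - L)) \<longlonglongrightarrow> 0"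

text \<open>Functions on \<open>D\<close> are again represented by total functions vanishing outside \<open>D\<close>; the vector
  space operations are pointwise, and point evaluations are required to be bounded.\<close>

definition right_quat_rkhs ::
  "'a set \<Rightarrow> ('a \<Rightarrow> quat) set \<Rightarrow> (('a \<Rightarrow> quat) \<Rightarrow> ('a \<Rightarrow> quat) \<Rightarrow> quat) \<Rightarrow> bool" where
  "right_quat_rkhs D V ip \<longleftrightarrow>
     (\<forall>f\<in>V. \<forall>x. x \<notin> D \<longrightarrow> f x = 0) \<and>
     right_quat_hilbert_space V (\<lambda>f a x. f x * a) ip \<and>
     (\<forall>x\<in>D. \<exists>C. \<forall>f\<in>V. norm (f x) \<le> C * ip_norm ip f)"

definition is_reproducing_kernel ::
  "'a set \<Rightarrow> ('a \<Rightarrow> quat) set \<Rightarrow> (('a \<Rightarrow> quat) \<Rightarrow> ('a \<Rightarrow> quat) \<Rightarrow> quat) \<Rightarrow>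
   ('a \<Rightarrow> 'a \<Rightarrow> quat) \<Rightarrow> bool" where
  "is_reproducing_kernel D V ip K \<longleftrightarrow>
     (\<forall>r\<in>D. (\<lambda>q. K q r) \<in> V \<and> (\<forall>f\<in>V. f r = ip f (\<lambda>q. K q r)))"


section \<open>The kernel\<close>

definition kernel_P :: "nat \<Rightarrow> quat \<Rightarrow> quat \<Rightarrow> quat" where
  "kernel_P N q r = of_real (real N / pi) *
     (\<Sum>k = 0..2 * N. (- 1) ^ k * of_nat ((2 * N) choose k) * qcnj q ^ k * qcnj r ^ k)"

definition kernel_Q :: "nat \<Rightarrow> quat \<Rightarrow> quat \<Rightarrow> quat" where
  "kernel_Q N q r =
     (1 - of_real (2 * qRe q) * qcnj r + of_real ((norm q)\<^sup>2) * (qcnj r)\<^sup>2) powi (- (2 * int N))"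

definition kernel_\<psi> :: "nat \<Rightarrow> quat \<Rightarrow> quat \<Rightarrow> quat" where
  "kernel_\<psi> N q r = (\<Sum>k = 0..N - 1.
     (- 1) ^ k * of_nat (N choose (k + 1)) * of_nat ((N + k) choose N) *
     (slice_star_power (\<lambda>q. 1 - qcnj q * r - q * qcnj r + qcnj q * q * qcnj r * r) (N - 1 - k) \<star>
      slice_star_power (\<lambda>q. qcnj q * q - q * qcnj r - qcnj q * r + qcnj r * r) k) q)"

definition slice_bergman_kernel :: "nat \<Rightarrow> quat \<Rightarrow> quat \<Rightarrow> quat" where
  "slice_bergman_kernel N q r = ((\<lambda>q. kernel_P N q r * kernel_Q N q r) \<star> (\<lambda>q. kernel_\<psi> N q r)) q"

end

theory Submission
  imports Defs "HOL-Complex_Analysis.Complex_Analysis"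
begin

text \<open>
  The theorem is reduced to one fact about complex functions on the unit disc \<open>D\<close>: a polyanalytic
  function \<open>g z = (\<Sum>k<N. cnj z ^ k * h k z)\<close> with holomorphic \<open>h k\<close>, integrable over \<open>D\<close>,
  satisfies \<open>g a = (\<integral> cnj (disc_kernel N z a) * g z)\<close>, where \<open>disc_kernel\<close> is the polyanalytic
  Bergman kernel found by Koshelev (\<open>disc_kernel_reproducing\<close>).

  At \<open>a = 0\<close> the kernel is a polynomial of degree \<open>N - 1\<close> in \<open>cnj z * z\<close>. Rotating the disc kills
  every monomial \<open>cnj z ^ k * z ^ j\<close> with \<open>j \<noteq> k\<close>, so the claim is that this polynomial represents
  evaluation at \<open>0\<close> on polynomials of degree less than \<open>N\<close> on \<open>[0, 1]\<close>; this is a binomial identity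
  (\<open>radial_coeff_moments\<close>), true because the \<open>N\<close>-th finite difference of a polynomial of degree less
  than \<open>N\<close> vanishes. Another point \<open>a\<close> is moved to \<open>0\<close> by the automorphism
  \<open>\<phi> z = (a - z) / (1 - cnj a * z)\<close>. Composition with \<open>\<phi>\<close> alone creates denominators in \<open>cnj z\<close>;
  the factor \<open>(1 - a * cnj z) ^ (N - 1) / (1 - cnj a * z) ^ (N + 1)\<close> clears them, and its modulus is
  that of \<open>\<phi>'\<close> up to a constant, so that the area integral transforms correctly. The kernel at \<open>a\<close>
  comes out of this substitution.

  A slice function is determined by its restriction to one slice, through the representation formula
  \<open>f (x + J y) = P * f (x + I y) + P' * f (x - I y)\<close> with \<open>P = (1 - J I) / 2\<close>, \<open>P' = (1 + J I) / 2\<close>.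
  Composing the restriction with the left \<open>C_I\<close>-linear maps \<open>slice_coord I c\<close> gives complex
  functions, and the function is slice polyanalytic exactly when all of these are polyanalytic on the
  disc (\<open>slice_polyanalytic_iff\<close>). For a fixed second variable in \<open>C_J\<close> every factor of the kernel has
  its stem in the commutative field \<open>C_J\<close>, so \<open>*\<close>-products become products of complex functions and
  the kernel is the slice extension of \<open>disc_kernel\<close> (\<open>slice_extends_kernel\<close>). Expressed on the slice
  \<open>C_I\<close> it is the combination of \<open>disc_kernel N z w\<close> and \<open>disc_kernel N z (cnj w)\<close> with right
  coefficients \<open>qcnj P\<close> and \<open>qcnj P'\<close>, and the representation formula for \<open>f\<close> turns the two complex
  reproducing identities into \<open>bergman_reproducing\<close>.

  The kernel is bounded while its second variable stays in a smaller ball, so evaluations are bounded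
  there uniformly. Hence a Cauchy sequence of the space converges locally uniformly; such limits of
  polyanalytic functions are polyanalytic (\<open>polyanalytic_disc_uniform_limit\<close>), and Fatou's lemma shows
  that the convergence is also in norm (\<open>bergman_complete\<close>).
\<close>

section \<open>The radial profile of the kernel\<close>

lemma sum_binomial_Suc:
  fixes f :: "nat \<Rightarrow> real"
  shows "(\<Sum>k\<le>Suc n. of_nat (Suc n choose k) * f k) = (\<Sum>k\<le>n. of_nat (n choose k) * (f k + f (Suc k)))"
proof -
  have "(\<Sum>k\<le>Suc n. of_nat (Suc n choose k) * f k)
      = f 0 + (\<Sum>k\<le>n. of_nat (n choose Suc k) * f (Suc k)) + (\<Sum>k\<le>n. of_nat (n choose k) * f (Suc k))"
    by (simp add: sum.atMost_Suc_shift algebra_simps sum.distrib del: sum.atMost_Suc)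
  also have "f 0 + (\<Sum>k\<le>n. of_nat (n choose Suc k) * f (Suc k)) = (\<Sum>k\<le>Suc n. of_nat (n choose k) * f k)"
    by (simp add: sum.atMost_Suc_shift del: sum.atMost_Suc)
  also have "\<dots> = (\<Sum>k\<le>n. of_nat (n choose k) * f k)"
    by simp
  finally show ?thesis
    by (simp add: sum.distrib distrib_left)
qed

text \<open>
  The sum is, up to sign, an \<open>n\<close>-th finite difference: Pascal's rule turns it into the same sum of
  length \<open>n - 1\<close> for \<open>p x - p (x + 1)\<close>, whose degree is smaller than that of \<open>p\<close>.
\<close>

lemma alternating_binomial_sum_poly:
  fixes p :: "real poly"
  assumes "degree p < n"
  shows "(\<Sum>k\<le>n. of_nat (n choose k) * ((-1) ^ k * poly p (of_nat k))) = 0"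
  using assms
proof (induction n arbitrary: p)
  case (Suc n)
  define d where "d = p - pcompose p [:1, 1:]"
  have *: "(\<Sum>k\<le>Suc n. of_nat (Suc n choose k) * ((-1) ^ k * poly p (of_nat k)))
      = (\<Sum>k\<le>n. of_nat (n choose k) * ((-1) ^ k * poly d (of_nat k)))"
    unfolding sum_binomial_Suc by (simp add: d_def poly_pcompose algebra_simps)
  show ?case
  proof (cases "degree p = 0")
    case True
    then obtain a where "p = [:a:]" by (metis degree_0_id)
    then have "d = 0" by (simp add: d_def pcompose_const)
    then show ?thesis unfolding * by simp
  next
    case False
    have dg: "degree (pcompose p [:1, 1:]) = degree p"
      by (simp add: degree_pcompose)
    have "coeff d (degree p) = 0"
      using lead_coeff_comp[of "[:1, 1:]" p] unfolding dg by (simp add: d_def)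
    moreover have "degree d \<le> degree p"
      using degree_diff_le_max[of p "pcompose p [:1, 1:]"] unfolding dg by (simp add: d_def)
    ultimately have "degree d < degree p"
      using False by (metis le_neq_implies_less leading_coeff_0_iff degree_0)
    then show ?thesis
      using Suc unfolding * by auto
  qed
qed simp

text \<open>
  These are the coefficients of \<open>\<psi>_N\<close>. Times \<open>N\<close>, they are the coefficients of the polynomial of
  degree less than \<open>N\<close> that represents evaluation at \<open>0\<close> for the inner product of \<open>L\<^sup>2 [0, 1]\<close>.
\<close>

definition radial_coeff :: "nat \<Rightarrow> nat \<Rightarrow> real" where
  "radial_coeff N k = (-1) ^ k * of_nat (N choose (k + 1)) * of_nat ((N + k) choose N)"

text \<open>
  The product \<open>(k + 1) \<cdots> (k + N)\<close> in the second binomial coefficient contains the factor \<open>j + k + 1\<close>,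
  so the quotient is a polynomial \<open>q\<close> of degree \<open>N - 1\<close> evaluated at \<open>k + 1\<close>. The sum is therefore an
  alternating binomial sum of \<open>q\<close> from which only the term at \<open>0\<close> is missing, that is, it equals
  \<open>q 0\<close> up to the factor \<open>N / N!\<close>; and \<open>q 0 = 0\<close> unless \<open>j = 0\<close>.
\<close>

lemma radial_coeff_moments:
  assumes "j < N"
  shows "(\<Sum>k<N. real N * radial_coeff N k / real (j + k + 1)) = (if j = 0 then 1 else 0)"
proof -
  define q :: "real poly" where "q = (\<Prod>i\<in>{..<N} - {j}. [:real i, 1:])"
  have pq: "poly q x = (\<Prod>i\<in>{..<N} - {j}. x + real i)" for x
    by (simp add: q_def poly_prod add.commute)
  have deg: "degree q < N"
  proof -
    have "degree q \<le> (\<Sum>i\<in>{..<N} - {j}. degree [:real i, 1:])"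
      unfolding q_def using degree_prod_sum_le[of "{..<N} - {j}" "\<lambda>i. [:real i, 1:]"]
      by (simp add: o_def)
    also have "\<dots> = N - 1" using assms by simp
    finally show ?thesis using assms by simp
  qed
  have binom: "of_nat ((N + k) choose N) / real (j + k + 1) = poly q (real (Suc k)) / fact N" for k
  proof -
    have "of_nat ((N + k) choose N) * fact N = pochhammer (real (Suc k)) N"
    proof -
      have "(fact (k + N) :: real) = fact k * pochhammer (1 + real k) N"
        unfolding pochhammer_fact by (rule pochhammer_product')
      then show ?thesis
        by (simp add: binomial_fact[of N "N + k"] add.commute)
    qed
    also have "\<dots> = (\<Prod>i<N. real (Suc k) + real i)"
      by (simp add: pochhammer_prod lessThan_atLeast0)
    also have "\<dots> = (real (Suc k) + real j) * poly q (real (Suc k))"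
      unfolding pq using assms by (subst prod.remove[of _ j]) auto
    finally show ?thesis
      by (simp add: field_simps)
  qed
  have "0 = (\<Sum>k\<le>N. of_nat (N choose k) * ((-1) ^ k * poly q (of_nat k)))"
    using alternating_binomial_sum_poly[OF deg] by simp
  also have "\<dots> = poly q 0 - (\<Sum>k<N. of_nat (N choose Suc k) * ((-1) ^ k * poly q (of_nat (Suc k))))"
  proof -
    obtain M where M: "N = Suc M" using assms by (cases N) auto
    show ?thesis
      unfolding M
      by (subst sum.atMost_Suc_shift) (simp add: lessThan_Suc_atMost sum_negf del: of_nat_Suc binomial_Suc_Suc)
  qed
  finally have s: "(\<Sum>k<N. of_nat (N choose Suc k) * ((-1) ^ k * poly q (of_nat (Suc k)))) = poly q 0"
    by simp
  have "(\<Sum>k<N. real N * radial_coeff N k / real (j + k + 1))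
     = (\<Sum>k<N. of_nat (N choose Suc k) * ((-1) ^ k * poly q (of_nat (Suc k))) * (real N / fact N))"
  proof (rule sum.cong[OF refl])
    fix k
    have "real N * radial_coeff N k / real (j + k + 1)
        = real N * ((-1) ^ k * of_nat (N choose (k + 1))) * (of_nat ((N + k) choose N) / real (j + k + 1))"
      by (simp add: radial_coeff_def)
    then show "real N * radial_coeff N k / real (j + k + 1)
        = of_nat (N choose Suc k) * ((-1) ^ k * poly q (of_nat (Suc k))) * (real N / fact N)"
      unfolding binom by simp
  qed
  also have "\<dots> = poly q 0 * (real N / fact N)"
    unfolding sum_distrib_right[symmetric] s ..
  also have "\<dots> = (if j = 0 then 1 else 0)"
  proof (cases "j = 0")
    case True
    obtain M where M: "N = Suc M" using assms by (cases N) auto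
    have "poly q 0 = (\<Prod>i\<in>{1..M}. real i)"
      unfolding pq by (rule prod.cong) (auto simp: True M)
    also have "\<dots> = fact M" by (simp add: fact_prod)
    finally show ?thesis using True M by simp
  next
    case False
    then have "poly q 0 = 0"
      unfolding pq using assms by (intro prod_zero) auto
    with False show ?thesis by simp
  qed
  finally show ?thesis .
qed

section \<open>Polyanalytic functions on the unit disc\<close>

definition polyanalytic_disc :: "nat \<Rightarrow> (complex \<Rightarrow> complex) \<Rightarrow> bool" where
  "polyanalytic_disc N g \<longleftrightarrow> (\<exists>h. (\<forall>k<N. h k holomorphic_on ball 0 1) \<and>
     (\<forall>z\<in>ball 0 1. g z = (\<Sum>k<N. cnj z ^ k * h k z)))"

lemma polyanalytic_disc_cong:
  assumes "polyanalytic_disc N f" "\<And>z. z \<in> ball 0 1 \<Longrightarrow> f z = g z"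
  shows "polyanalytic_disc N g"
  using assms unfolding polyanalytic_disc_def by auto

lemma polyanalytic_disc_holomorphic:
  assumes "h holomorphic_on ball 0 1"
  shows "polyanalytic_disc (Suc 0) h"
  unfolding polyanalytic_disc_def using assms by (intro exI[of _ "\<lambda>_. h"]) auto

lemma polyanalytic_disc_add:
  assumes "polyanalytic_disc N f" "polyanalytic_disc N g"
  shows "polyanalytic_disc N (\<lambda>z. f z + g z)"
proof -
  obtain h k where "\<forall>i<N. h i holomorphic_on ball 0 1" "\<forall>z\<in>ball 0 1. f z = (\<Sum>i<N. cnj z ^ i * h i z)"
     "\<forall>i<N. k i holomorphic_on ball 0 1" "\<forall>z\<in>ball 0 1. g z = (\<Sum>i<N. cnj z ^ i * k i z)"
    using assms unfolding polyanalytic_disc_def by auto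
  then show ?thesis
    unfolding polyanalytic_disc_def
    by (intro exI[of _ "\<lambda>i z. h i z + k i z"])
       (auto simp: algebra_simps sum.distrib intro!: holomorphic_intros)
qed

lemma polyanalytic_disc_mult_holomorphic:
  assumes "polyanalytic_disc N f" "u holomorphic_on ball 0 1"
  shows "polyanalytic_disc N (\<lambda>z. u z * f z)"
proof -
  obtain h where "\<forall>i<N. h i holomorphic_on ball 0 1" "\<forall>z\<in>ball 0 1. f z = (\<Sum>i<N. cnj z ^ i * h i z)"
    using assms unfolding polyanalytic_disc_def by auto
  with assms(2) show ?thesis
    unfolding polyanalytic_disc_def
    by (intro exI[of _ "\<lambda>i z. u z * h i z"])
       (auto simp: mult_ac sum_distrib_left intro!: holomorphic_intros sum.cong)
qed

lemma polyanalytic_disc_cmult: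
  "polyanalytic_disc N f \<Longrightarrow> polyanalytic_disc N (\<lambda>z. c * f z)"
  using polyanalytic_disc_mult_holomorphic[of N f "\<lambda>_. c"] by simp

lemma polyanalytic_disc_zero: "polyanalytic_disc N (\<lambda>_. 0)"
  unfolding polyanalytic_disc_def by (intro exI[of _ "\<lambda>_ _. 0"]) auto

lemma polyanalytic_disc_sum:
  "(\<And>i. i \<in> A \<Longrightarrow> polyanalytic_disc N (f i)) \<Longrightarrow> polyanalytic_disc N (\<lambda>z. \<Sum>i\<in>A. f i z)"
  by (induction A rule: infinite_finite_induct)
     (auto simp: polyanalytic_disc_zero intro: polyanalytic_disc_add)

lemma polyanalytic_disc_diff:
  assumes "polyanalytic_disc N f" "polyanalytic_disc N g"
  shows "polyanalytic_disc N (\<lambda>z. f z - g z)"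
  using polyanalytic_disc_add[OF assms(1) polyanalytic_disc_cmult[OF assms(2), of "-1"]] by simp

lemma polyanalytic_disc_mono:
  assumes "polyanalytic_disc M f" "M \<le> N"
  shows "polyanalytic_disc N f"
proof -
  obtain h where h: "\<forall>i<M. h i holomorphic_on ball 0 1" "\<forall>z\<in>ball 0 1. f z = (\<Sum>i<M. cnj z ^ i * h i z)"
    using assms unfolding polyanalytic_disc_def by auto
  have "(\<Sum>i<N. cnj z ^ i * (if i < M then h i z else 0)) = (\<Sum>i<M. cnj z ^ i * h i z)" for z
    using assms(2) by (intro sum.mono_neutral_cong_right) auto
  with h show ?thesis
    unfolding polyanalytic_disc_def
    by (intro exI[of _ "\<lambda>i. if i < M then h i else (\<lambda>_. 0)"]) (auto simp: if_distribR)
qed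

lemma polyanalytic_disc_mult_cnj:
  assumes "polyanalytic_disc N f"
  shows "polyanalytic_disc (Suc N) (\<lambda>z. cnj z * f z)"
proof -
  obtain h where h: "\<forall>i<N. h i holomorphic_on ball 0 1" "\<forall>z\<in>ball 0 1. f z = (\<Sum>i<N. cnj z ^ i * h i z)"
    using assms unfolding polyanalytic_disc_def by auto
  define k where "k = (\<lambda>i z. if i = 0 then 0 else h (i - 1) z)"
  have "k i holomorphic_on ball 0 1" if "i < Suc N" for i
    using that h(1) by (cases i) (auto simp: k_def)
  moreover have "cnj z * f z = (\<Sum>i<Suc N. cnj z ^ i * k i z)" if "z \<in> ball 0 1" for z
    unfolding sum.lessThan_Suc_shift using that h(2) by (simp add: k_def sum_distrib_left mult.assoc)
  ultimately show ?thesis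
    unfolding polyanalytic_disc_def by (intro exI[of _ k]) auto
qed

lemma polyanalytic_disc_mult_cnj_affine:
  assumes "polyanalytic_disc N f"
  shows "polyanalytic_disc (Suc N) (\<lambda>z. (u + v * cnj z) * f z)"
proof -
  have "polyanalytic_disc (Suc N) (\<lambda>z. u * f z + v * (cnj z * f z))"
    by (intro polyanalytic_disc_add polyanalytic_disc_cmult polyanalytic_disc_mult_cnj
          polyanalytic_disc_mono[of N f "Suc N"] assms) auto
  then show ?thesis by (simp add: algebra_simps)
qed

lemma polyanalytic_disc_mult_cnj_affine_power:
  assumes "polyanalytic_disc N f"
  shows "polyanalytic_disc (N + m) (\<lambda>z. (u + v * cnj z) ^ m * f z)"
proof (induction m)
  case (Suc m)
  from polyanalytic_disc_mult_cnj_affine[OF this, of u v] show ?case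
    by (simp add: mult_ac)
qed (use assms in simp)

text \<open>
  The shape in which the kernel and the Moebius transforms appear: each summand is a product of
  \<open>N - 1\<close> factors that are affine in \<open>cnj z\<close>, hence has degree at most \<open>N - 1\<close> in \<open>cnj z\<close>.
\<close>

lemma polyanalytic_disc_homogeneous_sum:
  assumes "\<And>k. k < N \<Longrightarrow> h k holomorphic_on ball 0 1"
  shows "polyanalytic_disc N (\<lambda>z. \<Sum>k<N. (a + b * cnj z) ^ (N - 1 - k) * ((c + d * cnj z) ^ k * h k z))"
proof (intro polyanalytic_disc_sum)
  fix k assume "k \<in> {..<N}"
  then have *: "Suc 0 + k + (N - 1 - k) = N" and h: "h k holomorphic_on ball 0 1"
    using assms by auto
  from polyanalytic_disc_mult_cnj_affine_power[OF polyanalytic_disc_mult_cnj_affine_power[OF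
        polyanalytic_disc_holomorphic[OF h], of k c d], of "N - 1 - k" a b]
  show "polyanalytic_disc N (\<lambda>z. (a + b * cnj z) ^ (N - 1 - k) * ((c + d * cnj z) ^ k * h k z))"
    unfolding * .
qed

lemma polyanalytic_disc_reflect:
  assumes "polyanalytic_disc N f"
  shows "polyanalytic_disc N (\<lambda>z. cnj (f (cnj z)))"
proof -
  obtain h where h: "\<forall>i<N. h i holomorphic_on ball 0 1" "\<forall>z\<in>ball 0 1. f z = (\<Sum>i<N. cnj z ^ i * h i z)"
    using assms unfolding polyanalytic_disc_def by auto
  have cb: "cnj ` ball 0 1 = ball 0 1"
  proof
    show "ball 0 1 \<subseteq> cnj ` ball 0 1"
    proof
      fix z :: complex assume "z \<in> ball 0 1"
      then show "z \<in> cnj ` ball 0 1"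
        by (intro image_eqI[of _ _ "cnj z"]) auto
    qed
  qed auto
  have "(cnj \<circ> h i \<circ> cnj) holomorphic_on ball 0 1" if "i < N" for i
    using that h(1) by (intro holomorphic_on_compose_cnj_cnj) (auto simp: cb)
  then show ?thesis
    unfolding polyanalytic_disc_def using h(2)
    by (intro exI[of _ "\<lambda>i. cnj \<circ> h i \<circ> cnj"]) auto
qed

lemma polyanalytic_disc_continuous:
  assumes "polyanalytic_disc N f"
  shows "continuous_on (ball 0 1) f"
proof -
  obtain h where h: "\<forall>i<N. h i holomorphic_on ball 0 1" "\<forall>z\<in>ball 0 1. f z = (\<Sum>i<N. cnj z ^ i * h i z)"
    using assms unfolding polyanalytic_disc_def by auto
  have "continuous_on (ball 0 1) (\<lambda>z. \<Sum>i<N. cnj z ^ i * h i z)"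
    using h(1) by (intro continuous_intros holomorphic_on_imp_continuous_on) auto
  then show ?thesis
    by (rule continuous_on_eq) (use h(2) in auto)
qed

lemma has_derivative_cnj_power_sum:
  assumes h: "\<And>i. i < N \<Longrightarrow> h i holomorphic_on ball 0 1" and z: "z \<in> ball 0 1"
  shows "((\<lambda>z. \<Sum>i<N. cnj z ^ i * h i z) has_derivative
     (\<lambda>v. (\<Sum>i<N. cnj z ^ i * deriv (h i) z) * v
        + (\<Sum>i<N - 1. cnj z ^ i * (of_nat (Suc i) * h (Suc i) z)) * cnj v)) (at z)"
proof -
  define A where "A z = (\<Sum>i<N. cnj z ^ i * deriv (h i) z)" for z
  define B where "B z = (\<Sum>i<N-1. cnj z ^ i * (of_nat (Suc i) * h (Suc i) z))" for z
    have "((\<lambda>z. \<Sum>i<N. cnj z ^ i * h i z) has_derivative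
        (\<lambda>v. \<Sum>i<N. cnj z ^ i * (deriv (h i) z * v) + of_nat i * cnj v * cnj z ^ (i - 1) * h i z)) (at z)"
    proof (intro has_derivative_sum)
      fix i assume i: "i \<in> {..<N}"
      then have "(h i has_field_derivative deriv (h i) z) (at z)"
        using holomorphic_derivI[OF h[of i] open_ball z] i by auto
      then have 1: "(h i has_derivative (\<lambda>v. deriv (h i) z * v)) (at z)"
        by (simp add: has_field_derivative_def)
      have 2: "(cnj has_derivative cnj) (at z)"
        by (rule bounded_linear_imp_has_derivative[OF bounded_linear_cnj])
      show "((\<lambda>z. cnj z ^ i * h i z) has_derivative
        (\<lambda>v. cnj z ^ i * (deriv (h i) z * v) + of_nat i * cnj v * cnj z ^ (i - 1) * h i z)) (at z)"
        by (rule has_derivative_mult[OF has_derivative_power[OF 2] 1])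
    qed
    moreover have "(\<Sum>i<N. cnj z ^ i * (deriv (h i) z * v) + of_nat i * cnj v * cnj z ^ (i - 1) * h i z)
        = A z * v + B z * cnj v" for v
    proof -
      have "(\<Sum>i<N. of_nat i * cnj v * cnj z ^ (i - 1) * h i z) = B z * cnj v"
      proof (cases N)
        case (Suc M)
        show ?thesis unfolding Suc sum.lessThan_Suc_shift
          by (simp add: B_def Suc sum_distrib_left sum_distrib_right mult_ac)
      qed (simp add: B_def)
      then show ?thesis
        by (simp add: sum.distrib A_def sum_distrib_left sum_distrib_right mult_ac)
    qed
    ultimately show ?thesis
      by (simp add: A_def B_def)
qed

text \<open>
  The functions \<open>A\<close> and \<open>B\<close> are the two Wirtinger derivatives. They are polyanalytic again, and the
  conjugate one is of lower order; this gives both smoothness and the vanishing of the iterated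
  Cauchy--Riemann operator by induction.
\<close>

lemma polyanalytic_disc_has_derivative:
  assumes "polyanalytic_disc N f"
  obtains A B where "polyanalytic_disc N A" "polyanalytic_disc (N - 1) B"
    "\<forall>z\<in>ball 0 1. (f has_derivative (\<lambda>v. A z * v + B z * cnj v)) (at z)"
proof -
  obtain h where h: "\<forall>i<N. h i holomorphic_on ball 0 1" "\<forall>z\<in>ball 0 1. f z = (\<Sum>i<N. cnj z ^ i * h i z)"
    using assms unfolding polyanalytic_disc_def by auto
  define A where "A z = (\<Sum>i<N. cnj z ^ i * deriv (h i) z)" for z
  define B where "B z = (\<Sum>i<N-1. cnj z ^ i * (of_nat (Suc i) * h (Suc i) z))" for z
  have "polyanalytic_disc N A"
    unfolding polyanalytic_disc_def A_def using h(1)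
    by (intro exI[of _ "\<lambda>i. deriv (h i)"]) (auto intro: holomorphic_deriv)
  moreover have "polyanalytic_disc (N - 1) B"
    unfolding polyanalytic_disc_def B_def using h(1)
    by (intro exI[of _ "\<lambda>i z. of_nat (Suc i) * h (Suc i) z"]) (auto intro!: holomorphic_intros)
  moreover have "(f has_derivative (\<lambda>v. A z * v + B z * cnj v)) (at z)" if z: "z \<in> ball 0 1" for z
    unfolding A_def B_def
    by (rule has_derivative_transform_within_open[OF has_derivative_cnj_power_sum[of N h] open_ball z])
       (use h z in auto)
  ultimately show ?thesis using that by blast
qed

section \<open>Holomorphic substitution in area integrals\<close>

text \<open>
  Identifies the space of real vectors, where the Jacobian determinant of a substitution lives, with the
  complex plane; Lebesgue measure is preserved.
\<close>

definition vec_to_complex :: "real ^ 2 \<Rightarrow> complex" where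
  "vec_to_complex x = Complex (x $ 1) (x $ 2)"

definition complex_to_vec :: "complex \<Rightarrow> real ^ 2" where
  "complex_to_vec z = (\<chi> i. if i = 1 then Re z else Im z)"

lemma vec_to_complex_inverse [simp]:
  "vec_to_complex (complex_to_vec z) = z" "complex_to_vec (vec_to_complex x) = x"
proof -
  have "(2::2) \<noteq> 1" by simp
  show "vec_to_complex (complex_to_vec z) = z"
    by (simp add: vec_to_complex_def complex_to_vec_def)
  show "complex_to_vec (vec_to_complex x) = x"
    using exhaust_2 by (auto simp: vec_to_complex_def complex_to_vec_def vec_eq_iff)
qed

lemma bounded_linear_vec_to_complex: "bounded_linear vec_to_complex"
  by (rule linear_conv_bounded_linear[THEN iffD1], rule linearI)
     (simp_all add: vec_to_complex_def complex_eq_iff)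

lemma bounded_linear_complex_to_vec: "bounded_linear complex_to_vec"
  by (rule linear_conv_bounded_linear[THEN iffD1], rule linearI)
     (simp_all add: complex_to_vec_def vec_eq_iff)

lemma borel_measurable_vec_to_complex [measurable]: "vec_to_complex \<in> borel \<rightarrow>\<^sub>M borel"
  by (intro borel_measurable_continuous_onI linear_continuous_on bounded_linear_vec_to_complex)

lemma borel_measurable_complex_to_vec [measurable]: "complex_to_vec \<in> borel \<rightarrow>\<^sub>M borel"
  by (intro borel_measurable_continuous_onI linear_continuous_on bounded_linear_complex_to_vec)

lemma lborel_complex_eq_distr: "lborel = distr lborel borel vec_to_complex"
proof (rule lborel_eqI)
  fix l u :: complex
  assume le: "\<And>b. b \<in> Basis \<Longrightarrow> l \<bullet> b \<le> u \<bullet> b"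
  have vim: "vec_to_complex -` box l u = box (complex_to_vec l) (complex_to_vec u)"
    by (auto simp: in_box_complex_iff mem_box_cart forall_2 complex_to_vec_def vec_to_complex_def)
  have "emeasure (distr lborel borel vec_to_complex) (box l u)
     = emeasure lborel (box (complex_to_vec l) (complex_to_vec u))"
    by (subst emeasure_distr) (auto simp: vim)
  also have "\<dots> = (\<Prod>b\<in>Basis. (complex_to_vec u - complex_to_vec l) \<bullet> b)"
  proof (rule emeasure_lborel_box)
    fix b :: "real ^ 2" assume "b \<in> Basis"
    then have "b = axis 1 1 \<or> b = axis 2 1"
      by (auto simp: Basis_vec_def UNIV_2)
    then show "complex_to_vec l \<bullet> b \<le> complex_to_vec u \<bullet> b"
      using le[of 1] le[of \<i>] by (auto simp: inner_axis complex_to_vec_def Basis_complex_def)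
  qed
  also have "(\<Prod>b\<in>Basis. (complex_to_vec u - complex_to_vec l) \<bullet> b) = (\<Prod>b\<in>Basis. (u - l) \<bullet> b)"
  proof -
    have B: "(Basis :: (real^2) set) = {axis 1 1, axis 2 1}"
      by (simp add: Basis_vec_def UNIV_2 insert_commute)
    have "axis 1 1 \<noteq> (axis 2 1 :: real^2)"
      by (simp add: axis_eq_axis)
    then show ?thesis
      by (simp add: B Basis_complex_def inner_axis complex_to_vec_def)
  qed
  finally show "emeasure (distr lborel borel vec_to_complex) (box l u) = (\<Prod>b\<in>Basis. (u - l) \<bullet> b)" .
qed simp

lemma set_integral_complex_via_vec:
  fixes f :: "complex \<Rightarrow> complex"
  assumes [measurable]: "S \<in> sets borel" and cont: "continuous_on S f"
  defines "g \<equiv> \<lambda>x. complex_to_vec (f (vec_to_complex x))"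
  shows "set_integrable lborel S f \<longleftrightarrow> g absolutely_integrable_on (vec_to_complex -` S)"
    and "set_integrable lborel S f \<Longrightarrow>
      integral (vec_to_complex -` S) g = complex_to_vec (LINT z:S|lborel. f z)"
proof -
  interpret u: bounded_linear complex_to_vec by (rule bounded_linear_complex_to_vec)
  interpret v: bounded_linear vec_to_complex by (rule bounded_linear_vec_to_complex)
  define F where "F = (\<lambda>z. indicat_real S z *\<^sub>R f z)"
  define G where "G = (\<lambda>x. indicat_real (vec_to_complex -` S) x *\<^sub>R g x)"
  have F [measurable]: "F \<in> borel_measurable borel"
    unfolding F_def by (rule borel_measurable_continuous_on_indicator[OF _ cont]) auto
  have G_eq: "G = (\<lambda>x. complex_to_vec (F (vec_to_complex x)))"
    by (auto simp: G_def F_def g_def u.scaleR indicator_def fun_eq_iff u.zero)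
  have Gm [measurable]: "G \<in> borel_measurable borel"
    unfolding G_eq by measurable
  have "integrable lborel F \<longleftrightarrow> integrable (distr lborel borel vec_to_complex) F"
    by (simp flip: lborel_complex_eq_distr)
  also have "\<dots> \<longleftrightarrow> integrable lborel (\<lambda>x. F (vec_to_complex x))"
    by (rule integrable_distr_eq) auto
  also have "\<dots> \<longleftrightarrow> integrable lborel G"
  proof
    assume "integrable lborel (\<lambda>x. F (vec_to_complex x))"
    then show "integrable lborel G"
      unfolding G_eq by (rule integrable_bounded_linear[OF bounded_linear_complex_to_vec])
  next
    assume "integrable lborel G"
    from integrable_bounded_linear[OF bounded_linear_vec_to_complex this]
    show "integrable lborel (\<lambda>x. F (vec_to_complex x))"
      by (simp add: G_eq)
  qed
  also have "\<dots> \<longleftrightarrow> integrable lebesgue G"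
    by (rule integrable_completion[symmetric]) simp
  finally have iff: "integrable lborel F \<longleftrightarrow> integrable lebesgue G" .
  then show iff': "set_integrable lborel S f \<longleftrightarrow> g absolutely_integrable_on (vec_to_complex -` S)"
    by (simp add: set_integrable_def F_def G_def)
  assume int: "set_integrable lborel S f"
  then have intF: "integrable lborel F" by (simp add: set_integrable_def F_def)
  have "integral (vec_to_complex -` S) g = (LINT x:vec_to_complex -` S|lebesgue. g x)"
    using int iff' set_lebesgue_integral_eq_integral(2) by metis
  also have "\<dots> = integral\<^sup>L lebesgue G"
    by (simp add: set_lebesgue_integral_def G_def)
  also have "\<dots> = integral\<^sup>L lborel G"
    by (rule integral_completion) simp
  also have "\<dots> = complex_to_vec (integral\<^sup>L lborel (\<lambda>x. F (vec_to_complex x)))"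
    unfolding G_eq
  proof (rule integral_bounded_linear[OF bounded_linear_complex_to_vec])
    show "integrable lborel (\<lambda>x. F (vec_to_complex x))"
      using intF by (subst (asm) lborel_complex_eq_distr, subst (asm) integrable_distr_eq) auto
  qed
  also have "integral\<^sup>L lborel (\<lambda>x. F (vec_to_complex x)) = integral\<^sup>L (distr lborel borel vec_to_complex) F"
    by (rule integral_distr[symmetric]) auto
  also have "\<dots> = integral\<^sup>L lborel F"
    by (simp flip: lborel_complex_eq_distr)
  finally show "integral (vec_to_complex -` S) g = complex_to_vec (LINT z:S|lborel. f z)"
    by (simp add: set_lebesgue_integral_def F_def)
qed

text \<open>
  The real Jacobian determinant of a holomorphic map is the squared modulus of its derivative.
\<close>

theorem holomorphic_change_of_variables:
  fixes f \<phi> \<phi>' :: "complex \<Rightarrow> complex"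
  assumes S: "open S" and T: "\<phi> ` S = T" "open T"
    and der: "\<And>z. z \<in> S \<Longrightarrow> (\<phi> has_field_derivative \<phi>' z) (at z)"
    and cont': "continuous_on S \<phi>'" and inj: "inj_on \<phi> S" and cont: "continuous_on T f"
  shows "set_integrable lborel S (\<lambda>z. of_real ((norm (\<phi>' z))\<^sup>2) * f (\<phi> z)) \<longleftrightarrow> set_integrable lborel T f"
    and "set_integrable lborel T f \<Longrightarrow>
      (LINT z:S|lborel. of_real ((norm (\<phi>' z))\<^sup>2) * f (\<phi> z)) = (LINT z:T|lborel. f z)"
proof -
  define g where "g x = complex_to_vec (\<phi> (vec_to_complex x))" for x
  define g' where "g' x h = complex_to_vec (\<phi>' (vec_to_complex x) * vec_to_complex h)" for x h
  define F where "F x = complex_to_vec (f (vec_to_complex x))" for x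
  let ?S = "vec_to_complex -` S" and ?T = "vec_to_complex -` T"
  interpret u: bounded_linear complex_to_vec by (rule bounded_linear_complex_to_vec)
  have S_borel: "S \<in> sets borel" "T \<in> sets borel" using S T by auto
  have "open ?S"
    by (intro open_vimage S linear_continuous_on bounded_linear_vec_to_complex)
  then have leb: "?S \<in> sets lebesgue" by auto
  have img: "g ` ?S = ?T"
  proof
    show "?T \<subseteq> g ` ?S"
    proof
      fix y assume "y \<in> ?T"
      then obtain z where "z \<in> S" "\<phi> z = vec_to_complex y" using T by auto
      then show "y \<in> g ` ?S"
        by (intro image_eqI[of _ _ "complex_to_vec z"]) (auto simp: g_def)
    qed
  qed (use T in \<open>auto simp: g_def\<close>)
  have inj': "inj_on g ?S"
  proof (rule inj_onI)
    fix x y assume "x \<in> ?S" "y \<in> ?S" "g x = g y"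
    then have "\<phi> (vec_to_complex x) = \<phi> (vec_to_complex y)"
      unfolding g_def by (metis vec_to_complex_inverse(1))
    with inj \<open>x \<in> ?S\<close> \<open>y \<in> ?S\<close> have "vec_to_complex x = vec_to_complex y"
      by (auto dest: inj_onD)
    then show "x = y" by (metis vec_to_complex_inverse(2))
  qed
  have der': "(g has_derivative g' x) (at x within ?S)" if "x \<in> ?S" for x
  proof -
    have 1: "(vec_to_complex has_derivative vec_to_complex) (at x within ?S)"
      by (rule bounded_linear_imp_has_derivative[OF bounded_linear_vec_to_complex])
    have 2: "(\<phi> has_derivative (*) (\<phi>' (vec_to_complex x))) (at (vec_to_complex x))"
      using der[of "vec_to_complex x"] that by (simp add: has_field_derivative_def)
    have "((\<lambda>x. \<phi> (vec_to_complex x)) has_derivative (\<lambda>h. \<phi>' (vec_to_complex x) * vec_to_complex h)) (at x within ?S)"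
      by (rule has_derivative_compose[OF 1 2])
    from bounded_linear.has_derivative[OF bounded_linear_complex_to_vec this]
    show ?thesis by (simp add: g_def[abs_def] g'_def[abs_def])
  qed
  have det: "\<bar>det (matrix (g' x))\<bar> = (norm (\<phi>' (vec_to_complex x)))\<^sup>2" for x
  proof -
    have "det (matrix (g' x)) = (Re (\<phi>' (vec_to_complex x)))\<^sup>2 + (Im (\<phi>' (vec_to_complex x)))\<^sup>2"
      by (simp add: det_2 matrix_def g'_def complex_to_vec_def vec_to_complex_def axis_def power2_eq_square)
    then show ?thesis by (simp add: cmod_power2)
  qed
  have eq: "(\<lambda>x. \<bar>det (matrix (g' x))\<bar> *\<^sub>R F (g x))
     = (\<lambda>x. complex_to_vec (of_real ((norm (\<phi>' (vec_to_complex x)))\<^sup>2) * f (\<phi> (vec_to_complex x))))"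
    by (simp add: det F_def g_def fun_eq_iff scaleR_conv_of_real[symmetric] u.scaleR
        del: of_real_power)
  have "continuous_on S \<phi>"
    using der by (meson DERIV_isCont continuous_at_imp_continuous_on)
  then have c1: "continuous_on S (\<lambda>z. of_real ((norm (\<phi>' z))\<^sup>2) * f (\<phi> z))"
    using T(1) by (intro continuous_intros cont' continuous_on_compose2[OF cont]) auto
  note cov = has_absolute_integral_change_of_variables[OF leb der' inj', of F, unfolded img eq]
  note L = set_integral_complex_via_vec[OF S_borel(1) c1]
  note R = set_integral_complex_via_vec[OF S_borel(2) cont, folded F_def]
  show iff: "set_integrable lborel S (\<lambda>z. of_real ((norm (\<phi>' z))\<^sup>2) * f (\<phi> z)) \<longleftrightarrow> set_integrable lborel T f"
    unfolding L(1) R(1) using cov by blast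
  assume int: "set_integrable lborel T f"
  have "F absolutely_integrable_on ?T"
    using int R(1) by simp
  then have "integral ?S (\<lambda>x. complex_to_vec (of_real ((norm (\<phi>' (vec_to_complex x)))\<^sup>2) *
      f (\<phi> (vec_to_complex x)))) = integral ?T F"
    using cov[of "integral ?T F"] by blast
  then have "complex_to_vec (LINT z:S|lborel. of_real ((norm (\<phi>' z))\<^sup>2) * f (\<phi> z))
     = complex_to_vec (LINT z:T|lborel. f z)"
    using L(2) R(2) iff int by metis
  then show "(LINT z:S|lborel. of_real ((norm (\<phi>' z))\<^sup>2) * f (\<phi> z)) = (LINT z:T|lborel. f z)"
    by (metis vec_to_complex_inverse(1))
qed

section \<open>Rotation averages over the disc\<close>

lemma set_integrable_mult_bounded:
  fixes f u :: "complex \<Rightarrow> complex"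
  assumes f: "set_integrable lborel S f" "continuous_on S f"
    and u: "continuous_on S u" "\<And>z. z \<in> S \<Longrightarrow> norm (u z) \<le> B" and S: "S \<in> sets borel"
  shows "set_integrable lborel S (\<lambda>z. u z * f z)"
proof (rule set_integrable_bound[where f = "\<lambda>z. of_real B * f z"])
  show "set_integrable lborel S (\<lambda>z. of_real B * f z)"
    using f by simp
  show "set_borel_measurable lborel S (\<lambda>z. u z * f z)"
    unfolding set_borel_measurable_def
    using borel_measurable_continuous_on_indicator[OF S continuous_on_mult[OF u(1) f(2)]] by simp
  show "AE x in lborel. x \<in> S \<longrightarrow> norm (u x * f x) \<le> norm (of_real B * f x)"
  proof (intro AE_I2 impI)
    fix x assume "x \<in> S"
    then have "norm (u x) \<le> \<bar>B\<bar>" using u(2)[of x] by simp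
    then show "norm (u x * f x) \<le> norm (of_real B * f x)"
      by (simp add: norm_mult mult_right_mono)
  qed
qed

lemma set_integrable_ball_continuous:
  fixes f :: "complex \<Rightarrow> complex"
  assumes "continuous_on (cball 0 r) f"
  shows "set_integrable lborel (ball 0 r) f"
proof (rule set_integrable_subset)
  show "set_integrable lborel (cball 0 r) f"
    unfolding set_integrable_def by (rule borel_integrable_compact[OF _ assms]) simp
qed auto

lemma integral_ball_linear_substitution:
  fixes f :: "complex \<Rightarrow> complex"
  assumes c: "c \<noteq> 0" and f: "continuous_on UNIV f"
  shows "(LINT z:ball 0 r|lborel. of_real ((norm c)\<^sup>2) * f (c * z)) = (LINT z:ball 0 (norm c * r)|lborel. f z)"
proof -
  have img: "(\<lambda>z. c * z) ` ball 0 r = ball 0 (norm c * r)"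
  proof
    show "ball 0 (norm c * r) \<subseteq> (\<lambda>z. c * z) ` ball 0 r"
    proof
      fix z :: complex assume "z \<in> ball 0 (norm c * r)"
      then show "z \<in> (\<lambda>z. c * z) ` ball 0 r"
        using c by (intro image_eqI[of _ _ "z / c"]) (auto simp: norm_divide divide_less_eq mult.commute)
    qed
  qed (use c in \<open>auto simp: norm_mult\<close>)
  show ?thesis
  proof (rule holomorphic_change_of_variables(2)[OF _ img])
    show "set_integrable lborel (ball 0 (norm c * r)) f"
      by (rule set_integrable_ball_continuous[OF continuous_on_subset[OF f]]) simp
    show "continuous_on (ball 0 (norm c * r)) f"
      by (rule continuous_on_subset[OF f]) simp
  qed (use c in \<open>auto simp: inj_on_def intro!: derivative_eq_intros\<close>)
qed

text \<open>
  The rotation by \<open>cis (pi / (j - k))\<close> preserves area and the radial factor, and changes the sign of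
  \<open>cnj z ^ k * z ^ j\<close>.
\<close>

lemma rotation_invariant_integral_zero:
  fixes u :: "complex \<Rightarrow> complex"
  assumes "j \<noteq> k" and u: "continuous_on UNIV u"
  shows "(LINT z:ball 0 r|lborel. u (z * cnj z) * (cnj z ^ k * z ^ j)) = 0"
proof -
  \<comment> \<open>With this angle \<open>cnj c ^ k * c ^ j = cis ((j - k) * t) = - 1\<close>.\<close>
  define t where "t = pi / (real j - real k)"
  define c where "c = cis t"
  define f where "f z = u (z * cnj z) * (cnj z ^ k * z ^ j)" for z
  have n: "norm c = 1" by (simp add: c_def)
  have ccnj: "c * cnj c = 1"
    using n by (simp add: complex_norm_square[symmetric])
  have "cnj c ^ k * c ^ j = cis (- (real k * t)) * cis (real j * t)"
    unfolding c_def cis_cnj Complex.DeMoivre by simp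
  also have "\<dots> = cis ((real j - real k) * t)"
    by (simp add: cis_mult algebra_simps)
  also have "\<dots> = -1" using assms(1) by (simp add: t_def)
  finally have c: "cnj c ^ k * c ^ j = -1" .
  have fc: "f (c * z) = - f z" for z
  proof -
    have "f (c * z) = u ((c * cnj c) * (z * cnj z)) * ((cnj c ^ k * c ^ j) * (cnj z ^ k * z ^ j))"
      by (simp add: f_def power_mult_distrib mult_ac)
    then show ?thesis by (simp add: ccnj c f_def)
  qed
  have cont: "continuous_on A f" for A
    unfolding f_def by (intro continuous_intros continuous_on_compose2[OF u]) auto
  have "c \<noteq> 0" using n by auto
  from integral_ball_linear_substitution[OF this cont, of r]
have "(LINT z:ball 0 r|lborel. - f z) = (LINT z:ball 0 r|lborel. f z)"
    by (simp add: n fc)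
  then have "- (LINT z:ball 0 r|lborel. f z) = (LINT z:ball 0 r|lborel. f z)"
    by (simp add: set_lebesgue_integral_def)
  then show ?thesis by (simp add: f_def)
qed

text \<open>
  Only the term of degree \<open>k\<close> of the Taylor series of \<open>h\<close> survives the rotation average. The radius is
  less than \<open>1\<close>, where the series converges absolutely and uniformly, so it can be integrated termwise.
\<close>

lemma radial_integral_holomorphic:
  fixes u :: "complex \<Rightarrow> complex"
  assumes h: "h holomorphic_on ball 0 1" and u: "continuous_on UNIV u" and r: "0 < r" "r < 1"
  shows "(LINT z:ball 0 r|lborel. u (z * cnj z) * (cnj z ^ k * h z))
    = (deriv ^^ k) h 0 / fact k * (LINT z:ball 0 r|lborel. u (z * cnj z) * (z * cnj z) ^ k)"
proof -
  define a where "a j = (deriv ^^ j) h 0 / fact j" for j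
  have ps: "(\<lambda>j. a j * z ^ j) sums h z" if "norm z < 1" for z
    using holomorphic_power_series[OF h, of z] that by (simp add: a_def)
  define f where "f j z = indicator (ball 0 r) z *\<^sub>R (a j * (u (z * cnj z) * (cnj z ^ k * z ^ j)))" for j z
  have cont: "continuous_on A (\<lambda>z. u (z * cnj z) * (cnj z ^ k * z ^ j))" for A j
    by (intro continuous_intros continuous_on_compose2[OF u]) auto
  have contk: "continuous_on A (\<lambda>z. u (z * cnj z) * cnj z ^ k)" for A
    by (intro continuous_intros continuous_on_compose2[OF u]) auto
  have int: "integrable lborel (f j)" for j
    using set_integrable_ball_continuous[OF continuous_on_mult_left[OF cont[of _ j]], of r "a j"]
    by (simp add: f_def[abs_def] set_integrable_def)
  have "bounded ((\<lambda>z. u (z * cnj z) * cnj z ^ k) ` cball 0 r)"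
    by (intro compact_imp_bounded compact_continuous_image contk) simp
  then obtain B where B: "\<And>z. z \<in> cball 0 r \<Longrightarrow> norm (u (z * cnj z) * cnj z ^ k) \<le> B"
    by (meson imageI bounded_iff)
  have B0: "B \<ge> 0" using B[of 0] r norm_ge_zero order_trans by (metis centre_in_cball less_imp_le)
  have sm: "summable (\<lambda>j. norm (a j * of_real r ^ j))"
  proof (rule powser_insidea)
    show "summable (\<lambda>j. a j * of_real ((r + 1) / 2) ^ j)"
      by (rule sums_summable[OF ps]) (use r in simp)
  qed (use r in simp)
  have bnd: "norm (f j z) \<le> indicator (ball 0 r) z * (B * norm (a j * of_real r ^ j))" for j z
  proof (cases "z \<in> ball 0 r")
    case True
    have "norm (f j z) = norm (u (z * cnj z) * cnj z ^ k) * (norm (a j) * norm z ^ j)"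
      using True by (simp add: f_def norm_mult norm_power)
    also have "\<dots> \<le> B * (norm (a j) * r ^ j)"
      using True B0 B[of z] by (intro mult_mono power_mono) auto
    finally show ?thesis using True r by (simp add: norm_mult norm_power)
  qed (simp add: f_def)
  have "(\<lambda>j. integral\<^sup>L lborel (f j)) sums (\<integral>z. (\<Sum>j. f j z) \<partial>lborel)"
  proof (rule sums_integral[OF int])
    show "AE z in lborel. summable (\<lambda>j. norm (f j z))"
    proof (rule AE_I2)
      fix z show "summable (\<lambda>j. norm (f j z))"
        by (rule summable_comparison_test'[where N = 0,
              OF summable_mult[OF sm, of "indicator (ball 0 r) z * B"]])
           (use bnd[of _ z] in \<open>simp add: mult.assoc\<close>)
    qed
    have ind: "integrable lborel (\<lambda>z::complex. indicat_real (ball 0 r) z)"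
      using emeasure_lborel_ball_finite[of "0::complex" r] by (simp add: integrable_indicator_iff)
    have "norm (integral\<^sup>L lborel (\<lambda>z. norm (f j z)))
        \<le> measure lborel (ball (0::complex) r) * B * norm (a j * of_real r ^ j)" for j
    proof -
      have "integral\<^sup>L lborel (\<lambda>z. norm (f j z))
         \<le> integral\<^sup>L lborel (\<lambda>z::complex. indicat_real (ball 0 r) z * (B * norm (a j * of_real r ^ j)))"
        by (rule integral_mono) (use int ind bnd in auto)
      then show ?thesis by simp
    qed
    then show "summable (\<lambda>j. integral\<^sup>L lborel (\<lambda>z. norm (f j z)))"
      by (intro summable_comparison_test'[where N = 0, OF summable_mult[OF sm]]) blast
  qed
  moreover have "(\<Sum>j. f j z) = indicator (ball 0 r) z *\<^sub>R (u (z * cnj z) * (cnj z ^ k * h z))" for z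
  proof (cases "z \<in> ball 0 r")
    case True
    then have "(\<lambda>j. u (z * cnj z) * cnj z ^ k * (a j * z ^ j)) sums (u (z * cnj z) * cnj z ^ k * h z)"
      using r by (intro sums_mult ps) auto
    with True show ?thesis
      by (simp add: f_def sums_iff mult_ac)
  qed (simp add: f_def)
  ultimately have "(\<lambda>j. integral\<^sup>L lborel (f j)) sums
      (LINT z:ball 0 r|lborel. u (z * cnj z) * (cnj z ^ k * h z))"
    by (simp add: set_lebesgue_integral_def)
  moreover have "integral\<^sup>L lborel (f j)
     = (if j = k then a k * (LINT z:ball 0 r|lborel. u (z * cnj z) * (z * cnj z) ^ k) else 0)" for j
  proof -
    have "integral\<^sup>L lborel (f j) = a j * (LINT z:ball 0 r|lborel. u (z * cnj z) * (cnj z ^ k * z ^ j))"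
    proof -
      have "integral\<^sup>L lborel (f j) = (LINT z:ball 0 r|lborel. a j * (u (z * cnj z) * (cnj z ^ k * z ^ j)))"
        by (simp only: f_def[abs_def] set_lebesgue_integral_def)
      then show ?thesis by (simp only: set_integral_mult_right)
    qed
    then show ?thesis
      using rotation_invariant_integral_zero[OF _ u, of j k r]
      by (auto simp: power_mult_distrib mult_ac)
  qed
  ultimately have "(\<lambda>j. if j = k then a k * (LINT z:ball 0 r|lborel. u (z * cnj z) * (z * cnj z) ^ k) else 0)
     sums (LINT z:ball 0 r|lborel. u (z * cnj z) * (cnj z ^ k * h z))"
    by simp
  from sums_unique2[OF this sums_single] show ?thesis
    by (simp add: a_def)
qed

text \<open>
  Let \<open>I r\<close> be the integral of \<open>\<bar>z\<bar> ^ (2 * m)\<close> over the disc of radius \<open>r\<close>. By scaling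
  \<open>I r = r ^ (2 * m + 2) * I 1\<close>, and on the annulus between \<open>r\<close> and \<open>1\<close> the integrand lies between
  \<open>r ^ (2 * m)\<close> and \<open>1\<close>. Division by the area of the annulus leaves
  \<open>pi * r ^ (2 * m) \<le> I 1 * (\<Sum>i\<le>m. r ^ (2 * i)) \<le> pi\<close>; let \<open>r\<close> tend to \<open>1\<close>.
\<close>

lemma disc_moment:
  "(LINT z:ball 0 1|lborel. (z * cnj z) ^ m) = of_real (pi / real (m + 1))"
proof -
  define f where "f z = (norm z) ^ (2 * m)" for z :: complex
  define I where "I A = (LINT z:A|lborel. f z)" for A :: "complex set"
  have f_eq: "(z * cnj z) ^ m = of_real (f z)" for z
    by (simp add: f_def complex_norm_square[symmetric] power_mult)
  have contf: "continuous_on A f" for A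
    unfolding f_def by (intro continuous_intros)
  have intf: "set_integrable lborel A f" if "A \<in> sets borel" "A \<subseteq> ball 0 1" for A
  proof (rule set_integrable_subset)
    show "set_integrable lborel (cball 0 1) f"
      unfolding set_integrable_def by (rule borel_integrable_compact[OF _ contf]) simp
  qed (use that in auto)
  have scale: "I (ball 0 r) = r ^ (2 * m + 2) * I (ball 0 1)" if r: "0 < r" "r < 1" for r
  proof -
    have "(LINT z:ball 0 1|lborel. of_real ((norm (of_real r :: complex))\<^sup>2) * complex_of_real (f (of_real r * z)))
        = (LINT z:ball 0 r|lborel. complex_of_real (f z))"
      using integral_ball_linear_substitution[of "of_real r" "\<lambda>z. complex_of_real (f z)" 1] r
      by (simp add: continuous_intros contf)
    also have "(\<lambda>z. of_real ((norm (of_real r :: complex))\<^sup>2) * complex_of_real (f (of_real r * z)))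
       = (\<lambda>z. complex_of_real (r ^ (2 * m + 2) * f z))"
      using r by (simp add: f_def norm_mult power_mult_distrib power_add power2_eq_square fun_eq_iff)
    finally have "r ^ (2 * m + 2) * I (ball 0 1) = I (ball 0 r)"
      unfolding set_integral_complex_of_real of_real_eq_iff by (simp only: set_integral_mult_right I_def)
    then show ?thesis ..
  qed
  have area: "measure lborel (ball (0::complex) r) = pi * r\<^sup>2" if "0 < r" for r
    using that content_ball[of r "0::complex"] by (simp add: unit_ball_vol_2)
  have split: "I (ball 0 1) = I (ball 0 r) + I (ball 0 1 - ball 0 r)"
      and areas: "measure lborel (ball (0::complex) 1 - ball 0 r) = pi * (1 - r\<^sup>2)"
    if r: "0 < r" "r < 1" for r
  proof -
    have "ball 0 1 = ball (0::complex) r \<union> (ball 0 1 - ball 0 r)" using r by auto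
    then show "I (ball 0 1) = I (ball 0 r) + I (ball 0 1 - ball 0 r)"
      unfolding I_def using r by (metis (no_types, lifting) set_integral_Un intf Diff_disjoint Diff_subset
          borel_open open_ball sets.Diff sup_ge1)
    have "measure lborel (ball (0::complex) 1 - ball 0 r)
        = measure lborel (ball (0::complex) 1) - measure lborel (ball (0::complex) r)"
      by (rule measure_Diff) (use r emeasure_lborel_ball_finite[of "0::complex"] in \<open>auto simp: less_top[symmetric]\<close>)
    then show "measure lborel (ball (0::complex) 1 - ball 0 r) = pi * (1 - r\<^sup>2)"
      using area[of 1] area[of r] r by (simp add: algebra_simps)
  qed
  have const: "(LINT z:ball (0::complex) 1 - ball 0 r|lborel. c) = c * (pi * (1 - r\<^sup>2))"
      and const_int: "set_integrable lborel (ball (0::complex) 1 - ball 0 r) (\<lambda>_. c)"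
    if r: "0 < r" "r < 1" for r c :: real
  proof -
    have fin: "emeasure lborel (ball (0::complex) 1 - ball 0 r) < \<infinity>"
      by (rule le_less_trans[OF emeasure_mono emeasure_lborel_ball_finite[of "0::complex" 1]]) auto
    show "set_integrable lborel (ball (0::complex) 1 - ball 0 r) (\<lambda>_. c)"
      unfolding set_integrable_def using fin by (intro integrable_scaleR_left) (auto simp: integrable_indicator_iff)
    show "(LINT z:ball (0::complex) 1 - ball 0 r|lborel. c) = c * (pi * (1 - r\<^sup>2))"
      using areas[OF r] by (simp add: set_lebesgue_integral_def)
  qed
  have sandwich: "pi * r ^ (2 * m) * (1 - r\<^sup>2) \<le> I (ball 0 1) * (1 - r ^ (2 * m + 2))"
       "I (ball 0 1) * (1 - r ^ (2 * m + 2)) \<le> pi * (1 - r\<^sup>2)"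
    if r: "0 < r" "r < 1" for r
  proof -
    have eq: "I (ball 0 1 - ball 0 r) = I (ball 0 1) * (1 - r ^ (2 * m + 2))"
      using split[OF r] scale[OF r] by (simp add: algebra_simps)
    have "(LINT z:ball (0::complex) 1 - ball 0 r|lborel. r ^ (2 * m)) \<le> I (ball 0 1 - ball 0 r)"
      unfolding I_def
      by (rule set_integral_mono[OF const_int[OF r] intf]) (use r in \<open>auto simp: f_def intro!: power_mono\<close>)
    then show "pi * r ^ (2 * m) * (1 - r\<^sup>2) \<le> I (ball 0 1) * (1 - r ^ (2 * m + 2))"
      unfolding const[OF r] eq by (simp add: mult_ac)
    have "I (ball 0 1 - ball 0 r) \<le> (LINT z:ball (0::complex) 1 - ball 0 r|lborel. 1)"
      unfolding I_def
      by (rule set_integral_mono[OF intf const_int[OF r]]) (use r in \<open>auto simp: f_def intro!: power_le_one\<close>)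
    then show "I (ball 0 1) * (1 - r ^ (2 * m + 2)) \<le> pi * (1 - r\<^sup>2)"
      unfolding const[OF r] eq by (simp add: mult_ac)
  qed
  have geo: "1 - r ^ (2 * m + 2) = (1 - r\<^sup>2) * (\<Sum>i\<le>m. r ^ (2 * i))" for r :: real
  proof -
    have "r ^ (2 * m + 2) = (r\<^sup>2) ^ Suc m"
      unfolding power_mult[symmetric] by simp
    then show ?thesis
      using one_diff_power_eq[of "r\<^sup>2" "Suc m"] by (simp only: power_mult lessThan_Suc_atMost)
  qed
  have ineq: "pi * r ^ (2 * m) \<le> I (ball 0 1) * (\<Sum>i\<le>m. r ^ (2 * i))"
       "I (ball 0 1) * (\<Sum>i\<le>m. r ^ (2 * i)) \<le> pi"
    if r: "0 < r" "r < 1" for r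
  proof -
    have pos: "1 - r\<^sup>2 > 0" using r by (simp add: power_less_one_iff abs_square_less_1)
    show "pi * r ^ (2 * m) \<le> I (ball 0 1) * (\<Sum>i\<le>m. r ^ (2 * i))"
      using sandwich(1)[OF r] pos unfolding geo by (simp add: mult.left_commute[of _ "1 - r\<^sup>2"] mult.commute[of _ "1 - r\<^sup>2"])
    show "I (ball 0 1) * (\<Sum>i\<le>m. r ^ (2 * i)) \<le> pi"
      using sandwich(2)[OF r] pos unfolding geo by (simp add: mult.left_commute[of _ "1 - r\<^sup>2"] mult.commute[of _ "1 - r\<^sup>2"])
  qed
  have ev: "\<forall>\<^sub>F r in at_left 1. 0 < r \<and> r < (1::real)"
    using eventually_at_left[of 0 "1::real"] by (auto intro!: exI[of _ 0])
  have lim: "((\<lambda>r. I (ball 0 1) * (\<Sum>i\<le>m. r ^ (2 * i))) \<longlongrightarrow> I (ball 0 1) * (\<Sum>i\<le>m. 1 ^ (2 * i))) (at_left 1)"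
    by (intro tendsto_intros)
  have lim2: "((\<lambda>r. pi * r ^ (2 * m)) \<longlongrightarrow> pi * 1 ^ (2 * m)) (at_left (1::real))"
    by (intro tendsto_intros)
  have "I (ball 0 1) * (\<Sum>i\<le>m. 1 ^ (2 * i)) \<le> pi"
    by (rule tendsto_upperbound[OF lim]) (use ev ineq(2) in \<open>auto elim: eventually_mono\<close>)
  moreover have "pi * 1 ^ (2 * m) \<le> I (ball 0 1) * (\<Sum>i\<le>m. 1 ^ (2 * i))"
    by (rule tendsto_le[OF _ lim lim2]) (use ev ineq(1) in \<open>auto elim: eventually_mono\<close>)
  ultimately have "I (ball 0 1) = pi / real (m + 1)"
    by (simp add: field_simps)
  then show ?thesis
    unfolding f_eq set_integral_complex_of_real by (simp add: I_def)
qed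

section \<open>The reproducing property on the disc\<close>

definition radial_kernel :: "nat \<Rightarrow> complex \<Rightarrow> complex" where
  "radial_kernel N t = of_real (real N / pi) * (\<Sum>k<N. of_real (radial_coeff N k) * t ^ k)"

lemma continuous_on_radial_kernel [continuous_intros]:
  "continuous_on A f \<Longrightarrow> continuous_on A (\<lambda>z. radial_kernel N (f z))"
  unfolding radial_kernel_def by (intro continuous_intros)

lemma radial_kernel_moment:
  assumes "j < N"
  shows "(LINT z:ball 0 1|lborel. radial_kernel N (z * cnj z) * (z * cnj z) ^ j) = (if j = 0 then 1 else 0)"
proof -
  have int: "set_integrable lborel (ball 0 1) (\<lambda>z. c * (z * cnj z) ^ (j + k))" for k and c :: complex
    by (intro set_integrable_ball_continuous continuous_intros)
  have "(LINT z:ball 0 1|lborel. radial_kernel N (z * cnj z) * (z * cnj z) ^ j)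
      = (LINT z:ball 0 1|lborel. \<Sum>k<N. of_real (real N / pi * radial_coeff N k) * (z * cnj z) ^ (j + k))"
    by (simp add: radial_kernel_def sum_distrib_left sum_distrib_right power_add mult_ac)
  also have "\<dots> = (\<Sum>k<N. LINT z:ball 0 1|lborel. of_real (real N / pi * radial_coeff N k) * (z * cnj z) ^ (j + k))"
    unfolding set_lebesgue_integral_def scaleR_sum_right
    using int unfolding set_integrable_def by (intro Bochner_Integration.integral_sum)
  also have "\<dots> = (\<Sum>k<N. of_real (real N * radial_coeff N k / real (j + k + 1)))"
    by (intro sum.cong refl, subst set_integral_mult_right, subst disc_moment) simp
  also have "\<dots> = of_real (if j = 0 then 1 else 0)"
    unfolding of_real_sum[symmetric] radial_coeff_moments[OF assms] ..
  finally show ?thesis by simp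
qed

text \<open>
  Over a smaller disc the integral picks the diagonal Taylor coefficients of the components of \<open>g\<close>.
  Integrability of \<open>g\<close> allows the radius to tend to \<open>1\<close>, and then the moments of the radial kernel
  leave the coefficient \<open>h 0 0 = g 0\<close>.
\<close>

lemma reproducing_at_zero:
  assumes g: "polyanalytic_disc N g" and int: "set_integrable lborel (ball 0 1) g" and N: "N \<ge> 1"
  shows "(LINT z:ball 0 1|lborel. radial_kernel N (z * cnj z) * g z) = g 0"
proof -
  obtain h where h: "\<forall>k<N. h k holomorphic_on ball 0 1" "\<forall>z\<in>ball 0 1. g z = (\<Sum>k<N. cnj z ^ k * h k z)"
    using g unfolding polyanalytic_disc_def by auto
  define a where "a k = (deriv ^^ k) (h k) 0 / fact k" for k
  define u where "u = radial_kernel N"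
  have contu: "continuous_on UNIV u"
    unfolding u_def by (intro continuous_intros)
  have contuu: "continuous_on A (\<lambda>z. u (z * cnj z))" for A
    unfolding u_def by (intro continuous_intros)
  define R where "R n = 1 - 1 / (real n + 2)" for n
  have R: "0 < R n" "R n < 1" for n by (auto simp: R_def field_simps)
  have incR: "incseq (\<lambda>n. ball (0::complex) (R n))"
  proof (rule incseq_SucI)
    fix n have "R n \<le> R (Suc n)" by (simp add: R_def field_simps)
    then show "ball 0 (R n) \<subseteq> ball (0::complex) (R (Suc n))" by (rule subset_ball)
  qed
  have Rlim: "R \<longlonglongrightarrow> 1"
    using LIMSEQ_Suc[OF LIMSEQ_inverse_real_of_nat_add_minus[of 1]]
    by (simp add: R_def[abs_def] inverse_eq_divide add.commute)
  have UR: "(\<Union>n. ball (0::complex) (R n)) = ball 0 1"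
  proof
    show "ball 0 1 \<subseteq> (\<Union>n. ball (0::complex) (R n))"
    proof
      fix z :: complex assume "z \<in> ball 0 1"
      then have "norm z < 1" by simp
      then obtain n where "norm z < R n"
        using order_tendstoD(1)[OF Rlim] by (meson eventually_sequentially order_refl)
      then show "z \<in> (\<Union>n. ball (0::complex) (R n))" by auto
    qed
  qed (use R(2) in \<open>force intro: less_trans\<close>)
  have lim: "(\<lambda>n. LINT z:ball 0 (R n)|lborel. f z) \<longlonglongrightarrow> (LINT z:ball 0 1|lborel. f z)"
    if "set_integrable lborel (ball 0 1) f" for f :: "complex \<Rightarrow> complex"
    using set_integral_cont_up[OF _ incR, of lborel f] that by (simp add: UR)
  have contg: "continuous_on (ball 0 1) g"
    by (rule polyanalytic_disc_continuous[OF g])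
  have "bounded ((\<lambda>z. u (z * cnj z)) ` cball 0 1)"
    by (intro compact_imp_bounded compact_continuous_image contuu) simp
  then obtain B where B: "\<And>z. z \<in> cball 0 1 \<Longrightarrow> norm (u (z * cnj z)) \<le> B"
    by (meson imageI bounded_iff)
  have intug: "set_integrable lborel (ball 0 1) (\<lambda>z. u (z * cnj z) * g z)"
    by (rule set_integrable_mult_bounded[OF int contg contuu, of B]) (use B in auto)
  have "(LINT z:ball 0 (R n)|lborel. u (z * cnj z) * g z)
      = (\<Sum>k<N. a k * (LINT z:ball 0 (R n)|lborel. u (z * cnj z) * (z * cnj z) ^ k))" for n
  proof -
    have sub: "z \<in> ball 0 1" if "z \<in> ball 0 (R n)" for z :: complex
      using that R(2)[of n] by auto
    have intk: "set_integrable lborel (ball 0 (R n)) (\<lambda>z. u (z * cnj z) * (cnj z ^ k * h k z))" if "k < N" for k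
    proof (rule set_integrable_ball_continuous)
      have "continuous_on (cball 0 (R n)) (h k)"
        using h(1) that R(2)[of n] by (intro holomorphic_on_imp_continuous_on) (auto elim!: holomorphic_on_subset)
      then show "continuous_on (cball 0 (R n)) (\<lambda>z. u (z * cnj z) * (cnj z ^ k * h k z))"
        by (intro continuous_intros contuu)
    qed
    have "(LINT z:ball 0 (R n)|lborel. u (z * cnj z) * g z)
       = (LINT z:ball 0 (R n)|lborel. \<Sum>k<N. u (z * cnj z) * (cnj z ^ k * h k z))"
      by (rule set_lebesgue_integral_cong) (use sub h(2) in \<open>auto simp: sum_distrib_left\<close>)
    also have "\<dots> = (\<Sum>k<N. LINT z:ball 0 (R n)|lborel. u (z * cnj z) * (cnj z ^ k * h k z))"
      unfolding set_lebesgue_integral_def scaleR_sum_right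
      using intk unfolding set_integrable_def by (intro Bochner_Integration.integral_sum) auto
    also have "\<dots> = (\<Sum>k<N. a k * (LINT z:ball 0 (R n)|lborel. u (z * cnj z) * (z * cnj z) ^ k))"
      using h(1) by (intro sum.cong refl) (simp add: radial_integral_holomorphic[OF _ contu R] a_def)
    finally show ?thesis .
  qed
  moreover have "(\<lambda>n. \<Sum>k<N. a k * (LINT z:ball 0 (R n)|lborel. u (z * cnj z) * (z * cnj z) ^ k))
      \<longlonglongrightarrow> (\<Sum>k<N. a k * (LINT z:ball 0 1|lborel. u (z * cnj z) * (z * cnj z) ^ k))"
    by (intro tendsto_intros lim set_integrable_ball_continuous continuous_intros contuu)
  ultimately have "(LINT z:ball 0 1|lborel. u (z * cnj z) * g z)
      = (\<Sum>k<N. a k * (LINT z:ball 0 1|lborel. u (z * cnj z) * (z * cnj z) ^ k))"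
    using LIMSEQ_unique[OF lim[OF intug]] by simp
  also have "\<dots> = (\<Sum>k<N. if k = 0 then a 0 else 0)"
    by (intro sum.cong refl) (auto simp: u_def radial_kernel_moment)
  also have "\<dots> = h 0 0"
    using N by (simp add: a_def)
  also have "\<dots> = (\<Sum>k<N. cnj 0 ^ k * h k 0)"
  proof -
    have "(\<Sum>k<N. cnj 0 ^ k * h k 0) = (\<Sum>k<N. if k = 0 then h 0 0 else 0)"
      by (intro sum.cong) (auto simp: power_0_left)
    then show ?thesis using N by simp
  qed
  also have "\<dots> = g 0"
    using h(2) by simp
  finally show ?thesis by (simp add: u_def)
qed

text \<open>
  The restriction to a slice of the kernel \<open>B_S^N\<close>: when both variables lie in the same slice,
  \<open>P_N * Q_N\<close> collapses to \<open>(N / pi) * (1 - z * cnj w) powi (- 2 N)\<close>.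
\<close>

definition disc_kernel :: "nat \<Rightarrow> complex \<Rightarrow> complex \<Rightarrow> complex" where
  "disc_kernel N z w = of_real (real N / pi) * inverse ((1 - z * cnj w) ^ (2 * N)) *
     (\<Sum>k<N. of_real (radial_coeff N k) * ((1 - cnj z * w) * (1 - z * cnj w)) ^ (N - 1 - k) *
        ((z - w) * cnj (z - w)) ^ k)"

lemma disc_kernel_cnj: "disc_kernel N (cnj z) (cnj w) = cnj (disc_kernel N z w)"
  by (simp add: disc_kernel_def mult_ac)

lemma one_minus_mult_cnj_nonzero:
  assumes "norm z < 1" "norm w < 1"
  shows "1 - z * cnj w \<noteq> 0" "1 - cnj w * z \<noteq> 0"
proof -
  have "norm z * norm w < 1"
    using assms mult_strict_mono[of "norm z" 1 "norm w" 1] by simp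
  then have "norm (z * cnj w) < 1" by (simp add: norm_mult)
  then show "1 - z * cnj w \<noteq> 0" by auto
  then show "1 - cnj w * z \<noteq> 0" by (simp add: mult.commute)
qed

lemma disc_kernel_bound:
  assumes "norm z < 1" "norm w \<le> r" "r < 1"
  shows "norm (disc_kernel N z w) \<le>
    real N / pi * (inverse ((1 - r) ^ (2 * N)) * (\<Sum>k<N. \<bar>radial_coeff N k\<bar> * 4 ^ (N - 1 - k) * 4 ^ k))"
proof -
  have w1: "norm w < 1" using assms by simp
  have "norm z * norm w \<le> 1 * r"
    using assms by (intro mult_mono) auto
  then have zw: "norm (z * cnj w) \<le> r" by (simp add: norm_mult)
  have "1 - r \<le> norm (1 - z * cnj w)"
    using norm_triangle_ineq2[of 1 "z * cnj w"] zw by simp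
  then have 1: "norm (inverse ((1 - z * cnj w) ^ (2 * N))) \<le> inverse ((1 - r) ^ (2 * N))"
    using assms by (simp add: norm_inverse norm_power) (intro le_imp_inverse_le power_mono, auto)
  have a: "norm (1 - z * cnj w) \<le> 2" "norm (1 - cnj z * w) \<le> 2"
    using norm_triangle_ineq4[of 1 "z * cnj w"] norm_triangle_ineq4[of 1 "cnj z * w"] zw assms
    by (simp_all add: norm_mult)
  have b: "norm (z - w) \<le> 2" using norm_triangle_ineq4[of z w] assms by simp
  have 2: "norm ((1 - cnj z * w) * (1 - z * cnj w)) \<le> 4"
    using mult_mono[OF a(2) a(1)] by (simp add: norm_mult)
  have 3: "norm ((z - w) * cnj (z - w)) \<le> 4"
    using mult_mono[OF b b] by (simp add: norm_mult del: complex_cnj_diff)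
  have "norm (\<Sum>k<N. of_real (radial_coeff N k) * ((1 - cnj z * w) * (1 - z * cnj w)) ^ (N - 1 - k) *
        ((z - w) * cnj (z - w)) ^ k) \<le> (\<Sum>k<N. \<bar>radial_coeff N k\<bar> * 4 ^ (N - 1 - k) * 4 ^ k)"
  proof (rule order_trans[OF norm_sum sum_mono])
    fix k
    have "norm (of_real (radial_coeff N k) * ((1 - cnj z * w) * (1 - z * cnj w)) ^ (N - 1 - k) *
        ((z - w) * cnj (z - w)) ^ k)
      = \<bar>radial_coeff N k\<bar> * norm ((1 - cnj z * w) * (1 - z * cnj w)) ^ (N - 1 - k) *
        norm ((z - w) * cnj (z - w)) ^ k"
      by (simp only: norm_mult norm_power norm_of_real)
    also have "\<dots> \<le> \<bar>radial_coeff N k\<bar> * 4 ^ (N - 1 - k) * 4 ^ k"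
      by (intro mult_mono power_mono 2 3) auto
    finally show "norm (of_real (radial_coeff N k) * ((1 - cnj z * w) * (1 - z * cnj w)) ^ (N - 1 - k) *
        ((z - w) * cnj (z - w)) ^ k) \<le> \<bar>radial_coeff N k\<bar> * 4 ^ (N - 1 - k) * 4 ^ k" .
  qed
  then have "norm (disc_kernel N z w) \<le> norm (of_real (real N / pi) :: complex) * (inverse ((1 - r) ^ (2 * N)) *
      (\<Sum>k<N. \<bar>radial_coeff N k\<bar> * 4 ^ (N - 1 - k) * 4 ^ k))"
    unfolding disc_kernel_def norm_mult mult.assoc
    using 1 assms by (intro mult_mono order_refl) (auto simp: norm_mult)
  then show ?thesis by (simp add: norm_divide)
qed

lemma polyanalytic_disc_kernel:
  assumes "norm w < 1"
  shows "polyanalytic_disc N (\<lambda>z. disc_kernel N z w)"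
proof -
  define H where "H k z = of_real (real N / pi) * inverse ((1 - z * cnj w) ^ (2 * N)) *
      of_real (radial_coeff N k) * (1 - z * cnj w) ^ (N - 1 - k) * (z - w) ^ k" for k z
  have "H k holomorphic_on ball 0 1" for k
    unfolding H_def using one_minus_mult_cnj_nonzero(1)[OF _ assms] by (intro holomorphic_intros) auto
  from polyanalytic_disc_homogeneous_sum[of N H 1 "- w" "- cnj w" 1, OF this] show ?thesis
    by (rule polyanalytic_disc_cong)
       (simp add: H_def disc_kernel_def sum_distrib_left power_mult_distrib mult_ac)
qed

text \<open>
  Let \<open>\<phi>\<close> be the involution of the disc that exchanges \<open>a\<close> and \<open>0\<close>, and \<open>G\<close> the product of \<open>g \<circ> \<phi>\<close>
  with the weight \<open>(1 - a * cnj z) ^ (N - 1) / (1 - cnj a * z) ^ (N + 1)\<close>. Then \<open>G\<close> is polyanalytic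
  of the same order and \<open>G 0 = g a\<close>. The reproducing identity of \<open>G\<close> at \<open>0\<close>, transported by \<open>\<phi>\<close>, is
  the one of \<open>g\<close> at \<open>a\<close>; the cofactor of \<open>g\<close> in the transported integrand is the conjugate kernel.
\<close>

theorem disc_kernel_reproducing:
  assumes g: "polyanalytic_disc N g" and int: "set_integrable lborel (ball 0 1) g"
    and N: "N \<ge> 1" and a: "norm a < 1"
  shows "(LINT z:ball 0 1|lborel. cnj (disc_kernel N z a) * g z) = g a"
proof -
  define \<phi> where "\<phi> z = (a - z) / (1 - cnj a * z)" for z
  define s where "s = 1 - cnj a * a"
  define \<phi>' where "\<phi>' z = - s / (1 - cnj a * z)\<^sup>2" for z
  define G where "G z = g (\<phi> z) * ((1 - a * cnj z) ^ (N - 1) / (1 - cnj a * z) ^ (N + 1))" for z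
  have nz: "1 - cnj a * z \<noteq> 0" "1 - a * cnj z \<noteq> 0" if "norm z < 1" for z
    using one_minus_mult_cnj_nonzero[OF that a] one_minus_mult_cnj_nonzero[OF a that] by auto
  have s: "s \<noteq> 0" "cnj s = s" using nz[OF a] by (auto simp: s_def mult.commute)
  have one_minus_\<phi>: "1 - cnj a * \<phi> z = s / (1 - cnj a * z)" if "norm z < 1" for z
    using nz[OF that] by (simp add: \<phi>_def s_def field_simps)
  have \<phi>_norm: "norm (\<phi> z) < 1" if z: "norm z < 1" for z
  proof -
    have "(norm (1 - cnj a * z))\<^sup>2 - (norm (a - z))\<^sup>2 = (1 - (norm a)\<^sup>2) * (1 - (norm z)\<^sup>2)"
      unfolding cmod_power2 by (simp add: algebra_simps power2_eq_square)
    moreover have "(1 - (norm a)\<^sup>2) * (1 - (norm z)\<^sup>2) > 0"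
      using a z by (intro mult_pos_pos) (auto simp: abs_square_less_1)
    ultimately have "(norm (a - z))\<^sup>2 < (norm (1 - cnj a * z))\<^sup>2" by linarith
    then have "norm (a - z) < norm (1 - cnj a * z)"
      by (rule power_less_imp_less_base) simp
    then show ?thesis
      using nz(1)[OF z] by (simp add: \<phi>_def norm_divide)
  qed
  have \<phi>_invol: "\<phi> (\<phi> z) = z" if "norm z < 1" for z
  proof -
    have "\<phi> (\<phi> z) = (a - \<phi> z) / (s / (1 - cnj a * z))"
      by (subst \<phi>_def) (simp add: one_minus_\<phi>[OF that])
    also have "a - \<phi> z = s * z / (1 - cnj a * z)"
      using nz[OF that] by (simp add: \<phi>_def s_def field_simps)
    finally show ?thesis using s nz[OF that] by simp
  qed
  have img: "\<phi> ` ball 0 1 = ball 0 1"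
  proof
    show "ball 0 1 \<subseteq> \<phi> ` ball 0 1"
    proof
      fix z :: complex assume "z \<in> ball 0 1"
      then show "z \<in> \<phi> ` ball 0 1"
        using \<phi>_invol[of z] \<phi>_norm[of z] by (intro image_eqI[of _ _ "\<phi> z"]) auto
    qed
  qed (use \<phi>_norm in auto)
  have inj: "inj_on \<phi> (ball 0 1)"
    by (rule inj_on_inverseI[of _ \<phi>]) (use \<phi>_invol in auto)
  have der: "(\<phi> has_field_derivative \<phi>' z) (at z)" if "z \<in> ball 0 1" for z
    unfolding \<phi>_def[abs_def] \<phi>'_def using nz[of z] that
    by (auto intro!: derivative_eq_intros simp: s_def field_simps power2_eq_square)
  have cont': "continuous_on (ball 0 1) \<phi>'"
    unfolding \<phi>'_def[abs_def] using nz by (intro continuous_intros) auto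
  have holo: "\<phi> holomorphic_on ball 0 1"
    unfolding \<phi>_def[abs_def] using nz by (intro holomorphic_intros) auto
  \<comment> \<open>\<open>cnj (\<phi> z) ^ k\<close> has the denominator \<open>(1 - a * cnj z) ^ k\<close> with \<open>k \<le> N - 1\<close>, which the weight clears.\<close>
  obtain h where h: "\<forall>k<N. h k holomorphic_on ball 0 1" "\<forall>z\<in>ball 0 1. g z = (\<Sum>k<N. cnj z ^ k * h k z)"
    using g unfolding polyanalytic_disc_def by auto
  define H where "H k z = h k (\<phi> z) / (1 - cnj a * z) ^ (N + 1)" for k z
  have H: "H k holomorphic_on ball 0 1" if "k < N" for k
  proof -
    have "(h k \<circ> \<phi>) holomorphic_on ball 0 1"
      by (rule holomorphic_on_compose_gen[OF holo, of _ "ball 0 1"]) (use h(1) that img in auto)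
    then show ?thesis
      unfolding H_def using nz by (intro holomorphic_intros) (auto simp: o_def)
  qed
  from polyanalytic_disc_homogeneous_sum[of N H 1 "- a" "cnj a" "- 1", OF H]
  have Gpa: "polyanalytic_disc N G"
  proof (rule polyanalytic_disc_cong)
    fix z :: complex assume z: "z \<in> ball 0 1"
    then have z1: "norm z < 1" by simp
    have gz: "g (\<phi> z) = (\<Sum>k<N. cnj (\<phi> z) ^ k * h k (\<phi> z))"
      using h(2) \<phi>_norm[OF z1] by simp
    have "(1 + (- a) * cnj z) ^ (N - 1 - k) * ((cnj a + (- 1) * cnj z) ^ k * H k z)
        = cnj (\<phi> z) ^ k * h k (\<phi> z) * ((1 - a * cnj z) ^ (N - 1) / (1 - cnj a * z) ^ (N + 1))" if "k < N" for k
    proof -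
      have e: "(1 - a * cnj z) ^ (N - 1) = (1 - a * cnj z) ^ (N - 1 - k) * (1 - a * cnj z) ^ k"
        using that by (simp flip: power_add)
      have "cnj (\<phi> z) * (1 - a * cnj z) = cnj a - cnj z"
        using nz[OF z1] by (simp add: \<phi>_def)
      then have "(cnj a - cnj z) ^ k = cnj (\<phi> z) ^ k * (1 - a * cnj z) ^ k"
        by (metis power_mult_distrib)
      then show ?thesis unfolding e H_def by (simp add: mult_ac)
    qed
    then show "(\<Sum>k<N. (1 + (- a) * cnj z) ^ (N - 1 - k) * ((cnj a + (- 1) * cnj z) ^ k *
      H k z)) = G z"
      unfolding G_def gz sum_distrib_right by (intro sum.cong) auto
  qed
  have contG: "continuous_on (ball 0 1) G"
    by (rule polyanalytic_disc_continuous[OF Gpa])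
  have contg: "continuous_on (ball 0 1) g"
    by (rule polyanalytic_disc_continuous[OF g])
  have jac: "of_real ((norm (\<phi>' z))\<^sup>2) * G (\<phi> z)
      = (1 - cnj a * z) ^ (N - 1) / (1 - a * cnj z) ^ (N + 1) * g z" if z: "norm z < 1" for z
  proof -
    obtain M where M: "N = Suc M" using N by (cases N) auto
    define p where "p = 1 - cnj a * z"
    define q where "q = 1 - a * cnj z"
    have pq: "p \<noteq> 0" "q \<noteq> 0" "cnj p = q" using nz[OF z] by (auto simp: p_def q_def)
    have n: "complex_of_real ((norm (\<phi>' z))\<^sup>2) = s * s / (p\<^sup>2 * q\<^sup>2)"
    proof -
      have "complex_of_real ((norm (\<phi>' z))\<^sup>2) = \<phi>' z * cnj (\<phi>' z)"
        by (rule complex_norm_square)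
      also have "\<dots> = s * s / (p\<^sup>2 * q\<^sup>2)"
        using s(2) pq(3) by (simp add: \<phi>'_def p_def[symmetric])
      finally show ?thesis .
    qed
    have "1 - a * cnj (\<phi> z) = cnj (1 - cnj a * \<phi> z)" by simp
    also have "\<dots> = s / q" unfolding one_minus_\<phi>[OF z] using s by (simp add: q_def)
    finally have 2: "1 - a * cnj (\<phi> z) = s / q" .
    have "G (\<phi> z) = g z * ((s / q) ^ M / (s / p) ^ (M + 2))"
      by (simp add: G_def \<phi>_invol[OF z] 2 one_minus_\<phi>[OF z] M p_def)
    then have "of_real ((norm (\<phi>' z))\<^sup>2) * G (\<phi> z) = s * s / (p\<^sup>2 * q\<^sup>2) * (g z * ((s / q) ^ M / (s / p) ^ (M + 2)))"
      by (simp only: n)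
    also have "\<dots> = p ^ M / q ^ (M + 2) * g z"
      using pq s(1) by (simp add: field_simps power2_eq_square)
    finally show ?thesis by (simp add: M p_def q_def)
  qed
  have quot_bound: "norm ((1 - cnj a * z) ^ (N - 1) / (1 - a * cnj z) ^ (N + 1)) \<le> 2 ^ (N - 1) / (1 - norm a) ^ (N + 1)"
    if z: "norm z < 1" for z
  proof -
    have az: "norm (cnj a * z) \<le> norm a" "norm (a * cnj z) \<le> norm a"
      using z by (simp_all add: norm_mult mult_left_le)
    have "norm (1 - cnj a * z) \<le> 2" "1 - norm a \<le> norm (1 - a * cnj z)"
      using norm_triangle_ineq4[of 1 "cnj a * z"] norm_triangle_ineq2[of 1 "a * cnj z"] az a by auto
    then show ?thesis
      unfolding norm_divide norm_power using a by (intro frac_le power_mono) auto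
  qed
  have contq: "continuous_on (ball 0 1) (\<lambda>z. (1 - cnj a * z) ^ (N - 1) / (1 - a * cnj z) ^ (N + 1))"
    using nz by (intro continuous_intros) auto
  have "set_integrable lborel (ball 0 1) (\<lambda>z. (1 - cnj a * z) ^ (N - 1) / (1 - a * cnj z) ^ (N + 1) * g z)"
    by (rule set_integrable_mult_bounded[OF int contg contq]) (use quot_bound in auto)
  also have "?this \<longleftrightarrow> set_integrable lborel (ball 0 1) (\<lambda>z. of_real ((norm (\<phi>' z))\<^sup>2) * G (\<phi> z))"
    by (rule set_integrable_cong) (use jac in auto)
  also have "\<dots> \<longleftrightarrow> set_integrable lborel (ball 0 1) G"
    by (rule holomorphic_change_of_variables(1)[OF open_ball img open_ball der cont' inj contG])
  finally have Gint: "set_integrable lborel (ball 0 1) G" .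
  define F where "F z = radial_kernel N (z * cnj z) * G z" for z
  have contF: "continuous_on (ball 0 1) F"
    unfolding F_def by (intro continuous_intros contG)
  have Fint: "set_integrable lborel (ball 0 1) F"
  proof -
    have "bounded ((\<lambda>z. radial_kernel N (z * cnj z)) ` cball 0 1)"
      by (intro compact_imp_bounded compact_continuous_image continuous_intros) simp
    then obtain B where B: "\<And>z. z \<in> cball 0 1 \<Longrightarrow> norm (radial_kernel N (z * cnj z)) \<le> B"
      by (meson imageI bounded_iff)
    show ?thesis unfolding F_def
      by (rule set_integrable_mult_bounded[OF Gint contG, of _ B])
         (use B in \<open>auto intro!: continuous_intros\<close>)
  qed
  have pt: "of_real ((norm (\<phi>' z))\<^sup>2) * F (\<phi> z) = cnj (disc_kernel N z a) * g z" if z: "norm z < 1" for z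
  proof -
    define p where "p = 1 - cnj a * z"
    define q where "q = 1 - a * cnj z"
    define d where "d = (z - a) * cnj (z - a)"
    have pq: "p \<noteq> 0" "q \<noteq> 0" using nz[OF z] by (auto simp: p_def q_def)
    have \<phi>2: "\<phi> z * cnj (\<phi> z) = d / (p * q)"
      by (simp add: \<phi>_def d_def p_def q_def algebra_simps)
    have "of_real ((norm (\<phi>' z))\<^sup>2) * F (\<phi> z) = radial_kernel N (d / (p * q)) * (p ^ (N - 1) / q ^ (N + 1) * g z)"
    proof -
      have "of_real ((norm (\<phi>' z))\<^sup>2) * F (\<phi> z)
          = radial_kernel N (\<phi> z * cnj (\<phi> z)) * (of_real ((norm (\<phi>' z))\<^sup>2) * G (\<phi> z))"
        by (simp only: F_def mult.left_commute)
      then show ?thesis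
        unfolding jac[OF z] \<phi>2 p_def q_def .
    qed
    also have "\<dots> = (\<Sum>k<N. of_real (real N / pi) * of_real (radial_coeff N k) * ((d / (p * q)) ^ k * (p ^ (N - 1) / q ^ (N + 1))) * g z)"
      by (simp add: radial_kernel_def sum_distrib_left sum_distrib_right mult_ac)
    also have "\<dots> = (\<Sum>k<N. of_real (real N / pi) * of_real (radial_coeff N k) * (inverse (q ^ (2 * N)) * (p * q) ^ (N - 1 - k) * d ^ k) * g z)"
    proof (rule sum.cong[OF refl])
      fix k assume "k \<in> {..<N}"
      then obtain m where m: "N = Suc (k + m)" by (auto simp: less_iff_Suc_add)
      have "(d / (p * q)) ^ k * (p ^ (N - 1) / q ^ (N + 1)) = inverse (q ^ (2 * N)) * (p * q) ^ (N - 1 - k) * d ^ k"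
        using pq by (simp add: m field_simps power_mult_distrib power_add power2_eq_square mult_2 mult_2_right)
      then show "of_real (real N / pi) * of_real (radial_coeff N k) * ((d / (p * q)) ^ k * (p ^ (N - 1) / q ^ (N + 1))) * g z
        = of_real (real N / pi) * of_real (radial_coeff N k) * (inverse (q ^ (2 * N)) * (p * q) ^ (N - 1 - k) * d ^ k) * g z"
        by simp
    qed
    also have "\<dots> = cnj (disc_kernel N z a) * g z"
      by (simp add: disc_kernel_def sum_distrib_left sum_distrib_right p_def q_def d_def mult_ac)
    finally show ?thesis .
  qed
  have "(LINT z:ball 0 1|lborel. cnj (disc_kernel N z a) * g z)
     = (LINT z:ball 0 1|lborel. of_real ((norm (\<phi>' z))\<^sup>2) * F (\<phi> z))"
    by (rule set_lebesgue_integral_cong) (use pt in auto)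
  also have "\<dots> = (LINT z:ball 0 1|lborel. F z)"
    by (rule holomorphic_change_of_variables(2)[OF open_ball img open_ball der cont' inj contF Fint])
  also have "\<dots> = G 0"
    unfolding F_def by (rule reproducing_at_zero[OF Gpa Gint N])
  also have "\<dots> = g a"
    by (simp add: G_def \<phi>_def)
  finally show ?thesis .
qed

section \<open>Locally uniform limits of polyanalytic functions\<close>

text \<open>
  A polynomial with \<open>N\<close> coefficients is recovered from its values at \<open>N\<close> nodes by
  Lagrange interpolation; only the existence of a fixed linear recovery matters here.
\<close>

lemma interpolation_coefficients:
  fixes t :: "nat \<Rightarrow> 'a::field"
  assumes inj: "inj_on t {..<N}"
  shows "\<exists>L :: nat \<Rightarrow> nat \<Rightarrow> 'a. \<forall>a. \<forall>k<N. a k = (\<Sum>j<N. L k j * (\<Sum>m<N. a m * t j ^ m))"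
proof (cases "N = 0")
  case False
  define l where "l j = (\<Prod>i\<in>{..<N} - {j}. smult (inverse (t j - t i)) [:- t i, 1:])" for j
  have degl: "degree (l j) < N" if "j < N" for j
  proof -
    have "degree (l j) \<le> (\<Sum>i\<in>{..<N} - {j}. degree (smult (inverse (t j - t i)) [:- t i, 1:]))"
      unfolding l_def using degree_prod_sum_le[of "{..<N} - {j}" "\<lambda>i. smult (inverse (t j - t i)) [:- t i, 1:]"]
      by (simp add: o_def)
    also have "\<dots> \<le> (\<Sum>i\<in>{..<N} - {j}. 1)"
      by (intro sum_mono) auto
    also have "\<dots> = N - 1" using that by simp
    finally show ?thesis using that by simp
  qed
  have polyl: "poly (l j) (t i) = (if i = j then 1 else 0)" if "i < N" "j < N" for i j
  proof (cases "i = j")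
    case True
    have "poly (l j) (t j) = (\<Prod>i\<in>{..<N} - {j}. 1)"
      unfolding l_def poly_prod
    proof (intro prod.cong refl)
      fix i assume "i \<in> {..<N} - {j}"
      then have "t j - t i \<noteq> 0" using inj that by (auto dest: inj_onD)
      moreover have "poly (smult (inverse (t j - t i)) [:- t i, 1:]) (t j) = inverse (t j - t i) * (t j - t i)"
        by (simp add: algebra_simps)
      ultimately show "poly (smult (inverse (t j - t i)) [:- t i, 1:]) (t j) = 1" by simp
    qed
    then show ?thesis using True by simp
  next
    case False
    have "poly (l j) (t i) = 0"
      unfolding l_def poly_prod using that False by (intro prod_zero bexI[of _ i]) auto
    then show ?thesis using False by simp
  qed
  show ?thesis
  proof (rule exI[of _ "\<lambda>k j. coeff (l j) k"], intro allI impI)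
    fix a :: "nat \<Rightarrow> 'a" and k assume k: "k < N"
    define p where "p = (\<Sum>m<N. monom (a m) m)"
    define q where "q = (\<Sum>j<N. smult (\<Sum>m<N. a m * t j ^ m) (l j))"
    have pp: "poly p x = (\<Sum>m<N. a m * x ^ m)" for x
      by (simp add: p_def poly_sum poly_monom)
    have "p = q"
    proof (rule poly_eqI_degree[of "t ` {..<N}"])
      fix x assume "x \<in> t ` {..<N}"
      then obtain i where i: "i < N" "x = t i" by auto
      have "poly q x = (\<Sum>j<N. if j = i then (\<Sum>m<N. a m * t i ^ m) else 0)"
        unfolding q_def poly_sum by (intro sum.cong refl) (use i polyl in auto)
      then show "poly p x = poly q x" using i by (simp add: pp)
    next
      have "degree p \<le> N - 1"
        unfolding p_def by (intro degree_sum_le) (auto intro: order_trans[OF degree_monom_le])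
      then show "degree p < card (t ` {..<N})"
        using False inj by (simp add: card_image)
    next
      have "degree q \<le> N - 1"
        unfolding q_def
      proof (rule degree_sum_le)
        fix j assume "j \<in> {..<N}"
        then show "degree (smult (\<Sum>m<N. a m * t j ^ m) (l j)) \<le> N - 1"
          using degl[of j] by (intro order_trans[OF degree_smult_le]) auto
      qed simp
      then show "degree q < card (t ` {..<N})"
        using False inj by (simp add: card_image)
    qed
    have "a k = coeff p k"
      using k by (simp add: p_def coeff_sum sum.delta)
    also have "\<dots> = (\<Sum>j<N. coeff (l j) k * (\<Sum>m<N. a m * t j ^ m))"
      unfolding \<open>p = q\<close> q_def by (simp add: coeff_sum mult.commute)
    finally show "a k = (\<Sum>j<N. coeff (l j) k * (\<Sum>m<N. a m * t j ^ m))" .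
  qed
qed simp

text \<open>
  On the circle of radius \<open>\<rho> j\<close> the function \<open>z ^ (N - 1) * (\<Sum>k<N. cnj z ^ k * h k z)\<close> coincides with
  the holomorphic function \<open>T j z = (\<Sum>k<N. z ^ (N - 1 - k) * h k z * (\<rho> j) ^ (2 * k))\<close>. The maximum
  principle extends the bound from the circle to the disc. Interpolation between \<open>N\<close> different radii
  isolates \<open>z ^ (N - 1 - k) * h k z\<close>, and the maximum principle on \<open>\<bar>z\<bar> = r\<close> removes the power of \<open>z\<close>.
\<close>

lemma polyanalytic_component_bound:
  assumes r: "0 < r" "r < 1"
  shows "\<exists>C \<rho>. 0 < \<rho> \<and> \<rho> < 1 \<and> (\<forall>h B.
       (\<forall>k<N. h k holomorphic_on ball 0 1) \<longrightarrow>
       (\<forall>z. norm z \<le> \<rho> \<longrightarrow> norm (\<Sum>k<N. cnj z ^ k * h k z) \<le> B) \<longrightarrow>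
       (\<forall>k<N. \<forall>z. norm z \<le> r \<longrightarrow> norm (h k z) \<le> C * B))"
proof -
  \<comment> \<open>\<open>N\<close> distinct radii strictly between \<open>r\<close> and \<open>1\<close>.\<close>
  define \<rho> where "\<rho> j = r + (1 - r) * (real (Suc j) / real (Suc N))" for j
  have \<rho>: "r < \<rho> j" "\<rho> j < 1" "\<rho> j \<le> \<rho> N' " if "j < N" "N' = N - 1" for j N'
  proof -
    have q: "real (Suc j) / real (Suc N) < 1" "0 < real (Suc j) / real (Suc N)"
        "real (Suc j) / real (Suc N) \<le> real (Suc N') / real (Suc N)"
      using that by (auto intro!: divide_right_mono)
    define a where "a = (1 - r) * (real (Suc j) / real (Suc N))"
    define b where "b = (1 - r) * (real (Suc N') / real (Suc N))"
    have "a < 1 - r"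
      unfolding a_def using mult_strict_left_mono[OF q(1), of "1 - r"] r by simp
    moreover have "0 < a"
      unfolding a_def using r by (intro mult_pos_pos q) simp
    moreover have "a \<le> b"
      unfolding a_def b_def using r by (intro mult_left_mono q) simp
    ultimately show "r < \<rho> j" "\<rho> j < 1" "\<rho> j \<le> \<rho> N'"
      unfolding \<rho>_def a_def[symmetric] b_def[symmetric] by linarith+
  qed
  define t where "t j = complex_of_real ((\<rho> j)\<^sup>2)" for j
  have "inj_on t {..<N}"
  proof (rule inj_onI)
    fix i j assume ij: "i \<in> {..<N}" "j \<in> {..<N}" "t i = t j"
    then have "(\<rho> i)\<^sup>2 = (\<rho> j)\<^sup>2"
      unfolding t_def of_real_eq_iff by simp
    then have "\<rho> i = \<rho> j"
      using \<rho>(1)[of i "N - 1"] \<rho>(1)[of j "N - 1"] ij r by (simp add: power2_eq_iff_nonneg)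
    then show "i = j" using r by (simp add: \<rho>_def)
  qed
  from interpolation_coefficients[OF this]
  obtain L where L': "\<forall>a. \<forall>k<N. a k = (\<Sum>j<N. L k j * (\<Sum>m<N. a m * t j ^ m))" ..
  have L: "a k = (\<Sum>j<N. L k j * (\<Sum>m<N. a m * t j ^ m))" if "k < N" for a k
    using L' that by blast
  define C where "C = (\<Sum>k<N. (\<Sum>j<N. norm (L k j)) / r ^ (N - 1 - k))"
  define \<rho>0 where "\<rho>0 = (if N = 0 then r else \<rho> (N - 1))"
  have \<rho>0: "0 < \<rho>0" "\<rho>0 < 1"
    using r \<rho>(1,2)[of "N - 1" "N - 1"] by (auto simp: \<rho>0_def)
  show ?thesis
  proof (rule exI[of _ C], rule exI[of _ \<rho>0], intro conjI \<rho>0 allI impI)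
    fix h :: "nat \<Rightarrow> complex \<Rightarrow> complex" and B k and z :: complex
    assume h': "\<forall>k<N. h k holomorphic_on ball 0 1"
      and B': "\<forall>z. norm z \<le> \<rho>0 \<longrightarrow> norm (\<Sum>k<N. cnj z ^ k * h k z) \<le> B"
      and k: "k < N" and z: "norm z \<le> r"
    have h: "h k holomorphic_on ball 0 1" if "k < N" for k using h' that by simp
    have B: "norm (\<Sum>k<N. cnj z ^ k * h k z) \<le> B" if "norm z \<le> \<rho>0" for z using B' that by simp
    define T where "T j w = (\<Sum>m<N. (w ^ (N - 1 - m) * h m w) * t j ^ m)" for j w
    have holT: "T j holomorphic_on ball 0 1" for j
      unfolding T_def by (intro holomorphic_intros h) auto
    have B0: "0 \<le> B"
      using order_trans[OF norm_ge_zero B[of 0]] \<rho>0(1) by simp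
    have boundT: "norm (T j w) \<le> B" if j: "j < N" and w: "norm w \<le> r" for j w
    proof (rule maximum_modulus_frontier[of "T j" "cball 0 (\<rho> j)"])
      show "T j holomorphic_on interior (cball 0 (\<rho> j))"
        by (rule holomorphic_on_subset[OF holT]) (use \<rho>[OF j refl] in \<open>auto simp: interior_cball\<close>)
      show "continuous_on (closure (cball 0 (\<rho> j))) (T j)"
        by (rule continuous_on_subset[OF holomorphic_on_imp_continuous_on[OF holT]]) (use \<rho>[OF j refl] in auto)
      show "w \<in> cball 0 (\<rho> j)" using w \<rho>[OF j refl] by auto
    next
      fix v :: complex assume "v \<in> frontier (cball 0 (\<rho> j))"
      then have v: "norm v = \<rho> j" using r \<rho>[OF j refl] by (auto simp: frontier_cball)
      then have tv: "t j = v * cnj v"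
        using complex_norm_square[of v] by (simp add: t_def)
      have "T j v = v ^ (N - 1) * (\<Sum>m<N. cnj v ^ m * h m v)"
        unfolding T_def sum_distrib_left
      proof (intro sum.cong refl)
        fix m assume "m \<in> {..<N}"
        then have "v ^ (N - 1) = v ^ (N - 1 - m) * v ^ m"
          by (simp flip: power_add)
        then show "v ^ (N - 1 - m) * h m v * t j ^ m = v ^ (N - 1) * (cnj v ^ m * h m v)"
          by (simp add: tv power_mult_distrib mult_ac)
      qed
      then have "norm (T j v) = norm v ^ (N - 1) * norm (\<Sum>m<N. cnj v ^ m * h m v)"
        by (simp add: norm_mult norm_power)
      also have "\<dots> \<le> 1 * B"
        using v \<rho>[OF j refl] k r by (intro mult_mono power_le_one B) (auto simp: \<rho>0_def)
      finally show "norm (T j v) \<le> B" by simp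
    qed simp
    have bound: "norm (w ^ (N - 1 - k) * h k w) \<le> (\<Sum>j<N. norm (L k j)) * B" if w: "norm w \<le> r" for w
    proof -
      have "w ^ (N - 1 - k) * h k w = (\<Sum>j<N. L k j * T j w)"
        using L[OF k, of "\<lambda>m. w ^ (N - 1 - m) * h m w"] by (simp add: T_def)
      also have "norm \<dots> \<le> (\<Sum>j<N. norm (L k j) * B)"
        by (rule order_trans[OF norm_sum sum_mono]) (auto simp: norm_mult intro!: mult_left_mono boundT w)
      finally show ?thesis by (simp add: sum_distrib_right)
    qed
    have CB: "(\<Sum>j<N. norm (L k j)) / r ^ (N - 1 - k) * B \<le> C * B"
    proof (rule mult_right_mono[OF _ B0])
      show "(\<Sum>j<N. norm (L k j)) / r ^ (N - 1 - k) \<le> C"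
        unfolding C_def using k r
        by (intro member_le_sum[of k "{..<N}" "\<lambda>k. (\<Sum>j<N. norm (L k j)) / r ^ (N - 1 - k)"])
           (auto intro!: divide_nonneg_nonneg sum_nonneg)
    qed
    show "norm (h k z) \<le> C * B"
    proof (rule maximum_modulus_frontier[of "h k" "cball 0 r"])
      show "h k holomorphic_on interior (cball 0 r)"
        by (rule holomorphic_on_subset[OF h[OF k]]) (use r in \<open>auto simp: interior_cball\<close>)
      show "continuous_on (closure (cball 0 r)) (h k)"
        by (rule continuous_on_subset[OF holomorphic_on_imp_continuous_on[OF h[OF k]]]) (use r in auto)
      show "z \<in> cball 0 r" using z by simp
    next
      fix v :: complex assume "v \<in> frontier (cball 0 r)"
      then have v: "norm v = r" using r by (auto simp: frontier_cball)
      then have "r ^ (N - 1 - k) * norm (h k v) \<le> (\<Sum>j<N. norm (L k j)) * B"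
        using bound[of v] by (simp add: norm_mult norm_power)
      then have "norm (h k v) \<le> (\<Sum>j<N. norm (L k j)) / r ^ (N - 1 - k) * B"
        using r by (simp add: field_simps)
      with CB show "norm (h k v) \<le> C * B" by linarith
    qed simp
  qed
qed

text \<open>
  By the component bound, applied to differences, the holomorphic components of the sequence are
  themselves locally uniformly Cauchy.
\<close>

theorem polyanalytic_disc_uniform_limit:
  assumes pa: "\<And>n. polyanalytic_disc N (g n)"
    and Cauchy: "\<And>r. 0 < r \<Longrightarrow> r < 1 \<Longrightarrow> uniformly_Cauchy_on (cball 0 r) g"
    and lim: "\<And>z. z \<in> ball 0 1 \<Longrightarrow> (\<lambda>n. g n z) \<longlonglongrightarrow> G z"
  shows "polyanalytic_disc N G"
proof -
  have "\<forall>n. \<exists>h. (\<forall>k<N. h k holomorphic_on ball 0 1) \<and> (\<forall>z\<in>ball 0 1. g n z = (\<Sum>k<N. cnj z ^ k * h k z))"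
    using pa unfolding polyanalytic_disc_def by blast
  then obtain h where h: "\<And>n k. k < N \<Longrightarrow> h n k holomorphic_on ball 0 1"
      and gh: "\<And>n z. z \<in> ball 0 1 \<Longrightarrow> g n z = (\<Sum>k<N. cnj z ^ k * h n k z)"
    by metis
  define H where "H k z = lim (\<lambda>n. h n k z)" for k z
  have unif: "uniform_limit (cball 0 r) (\<lambda>n. h n k) (H k) sequentially" if k: "k < N" and r: "0 < r" "r < 1" for k r
  proof -
    obtain C \<rho> where \<rho>: "0 < \<rho>" "\<rho> < 1" and C': "\<forall>h B.
       (\<forall>k<N. h k holomorphic_on ball 0 1) \<longrightarrow>
       (\<forall>z. norm z \<le> \<rho> \<longrightarrow> norm (\<Sum>k<N. cnj z ^ k * h k z) \<le> B) \<longrightarrow>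
       (\<forall>k<N. \<forall>z. norm z \<le> r \<longrightarrow> norm (h k z) \<le> C * B)"
      using polyanalytic_component_bound[OF r, of N] by (elim exE conjE)
    have C: "norm (h k z) \<le> C * B"
      if "\<And>k. k < N \<Longrightarrow> h k holomorphic_on ball 0 1"
        "\<And>z. norm z \<le> \<rho> \<Longrightarrow> norm (\<Sum>k<N. cnj z ^ k * h k z) \<le> B" "k < N" "norm z \<le> r" for h B k z
      using C'[rule_format, of h B k z] that by simp
    have "uniformly_Cauchy_on (cball 0 r) (\<lambda>n. h n k)"
    proof (rule uniformly_Cauchy_onI)
      fix e :: real assume e: "e > 0"
      define d where "d = e / (\<bar>C\<bar> + 1)"
      have d: "d > 0" using e by (simp add: d_def)
      then have "\<exists>M. \<forall>x\<in>cball 0 \<rho>. \<forall>m\<ge>M. \<forall>n\<ge>M. dist (g m x) (g n x) < d"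
        using Cauchy[OF \<rho>] unfolding uniformly_Cauchy_on_def by simp
      then obtain M where M: "\<And>z m n. z \<in> cball 0 \<rho> \<Longrightarrow> m \<ge> M \<Longrightarrow> n \<ge> M \<Longrightarrow> dist (g m z) (g n z) < d"
        by blast
      show "\<exists>M. \<forall>x\<in>cball 0 r. \<forall>m\<ge>M. \<forall>n\<ge>M. dist (h m k x) (h n k x) < e"
      proof (intro exI[of _ M] ballI allI impI)
        fix x m n assume x: "x \<in> cball (0::complex) r" and mn: "M \<le> m" "M \<le> n"
        have "norm (h m k x - h n k x) \<le> C * d"
        proof (rule C[where h = "\<lambda>k x. h m k x - h n k x"])
          fix z :: complex assume z: "norm z \<le> \<rho>"
          then have "z \<in> ball 0 1" using \<rho> by simp
          then have "(\<Sum>k<N. cnj z ^ k * (h m k z - h n k z)) = g m z - g n z"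
            by (simp add: gh right_diff_distrib sum_subtractf)
          then show "norm (\<Sum>k<N. cnj z ^ k * (h m k z - h n k z)) \<le> d"
            using M[of z m n] z mn by (simp add: dist_norm)
        qed (use h k x in \<open>auto intro!: holomorphic_intros\<close>)
        also have "\<dots> \<le> \<bar>C\<bar> * d" using d by (intro mult_right_mono) auto
        also have "\<dots> < e"
          using e by (simp add: d_def field_simps)
        finally show "dist (h m k x) (h n k x) < e" by (simp add: dist_norm)
      qed
    qed
    then have "uniformly_convergent_on (cball 0 r) (\<lambda>n. h n k)"
      by (rule Cauchy_uniformly_convergent)
    then show ?thesis
      unfolding uniformly_convergent_uniform_limit_iff H_def[abs_def] .
  qed
  have sub: "\<exists>r. 0 < r \<and> r < 1 \<and> norm z < r" if "z \<in> ball 0 1" for z :: complex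
    using that by (intro exI[of _ "(1 + norm z) / 2"]) (auto simp: add_pos_nonneg)
  have "H k holomorphic_on ball 0 1" if k: "k < N" for k
  proof (rule holomorphic_uniform_sequence[OF open_ball h[OF k]])
    fix x :: complex assume "x \<in> ball 0 1"
    then obtain r where r: "0 < r" "r < 1" "norm x < r" using sub by blast
    have s: "cball x (r - norm x) \<subseteq> cball 0 r"
    proof
      fix y assume "y \<in> cball x (r - norm x)"
      then show "y \<in> cball 0 r"
        using norm_triangle_ineq2[of y x] by (auto simp: dist_norm norm_minus_commute)
    qed
    show "\<exists>d>0. cball x d \<subseteq> ball 0 1 \<and> uniform_limit (cball x d) (\<lambda>n. h n k) (H k) sequentially"
    proof (intro exI[of _ "r - norm x"] conjI)
      show "cball x (r - norm x) \<subseteq> ball 0 1" using s r by force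
      show "uniform_limit (cball x (r - norm x)) (\<lambda>n. h n k) (H k) sequentially"
        by (rule uniform_limit_on_subset[OF unif[OF k r(1,2)] s])
    qed (use r in auto)
  qed
  moreover have "G z = (\<Sum>k<N. cnj z ^ k * H k z)" if z: "z \<in> ball 0 1" for z
  proof -
    obtain r where r: "0 < r" "r < 1" "norm z < r" using sub[OF z] by blast
    have "(\<lambda>n. h n k z) \<longlonglongrightarrow> H k z" if "k < N" for k
      by (rule tendsto_uniform_limitI[OF unif[OF that r(1,2)]]) (use r in auto)
    then have "(\<lambda>n. \<Sum>k<N. cnj z ^ k * h n k z) \<longlonglongrightarrow> (\<Sum>k<N. cnj z ^ k * H k z)"
      by (intro tendsto_intros) auto
    then show ?thesis
      using LIMSEQ_unique[OF lim[OF z]] gh[OF z] by simp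
  qed
  ultimately show ?thesis
    unfolding polyanalytic_disc_def by blast
qed

section \<open>Iterated Cauchy--Riemann operators\<close>

text \<open>
  One operator for both the quaternionic setting, where it is \<open>slice_CR I\<close>, and the complex one, where
  \<open>j\<close> is the imaginary unit.
\<close>

definition cr_op :: "'a \<Rightarrow> (real \<times> real \<Rightarrow> 'a) \<Rightarrow> real \<times> real \<Rightarrow> 'a::real_normed_algebra" where
  "cr_op j F p = partial_x F p + j * partial_y F p"

lemma slice_CR_eq_cr_op: "slice_CR I = cr_op I"
  by (simp add: fun_eq_iff slice_CR_def cr_op_def)

lemma open_lines:
  assumes "open U" "p \<in> U"
  shows "open {t. (t, snd p) \<in> U}" "fst p \<in> {t. (t, snd p) \<in> U}"
        "open {t. (fst p, t) \<in> U}" "snd p \<in> {t. (fst p, t) \<in> U}"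
proof -
  have "open ((\<lambda>t. (t, snd p)) -` U)" "open ((\<lambda>t. (fst p, t)) -` U)"
    by (intro open_vimage assms continuous_intros)+
  then show "open {t. (t, snd p) \<in> U}" "open {t. (fst p, t) \<in> U}"
    by (simp_all add: vimage_def)
qed (use assms in auto)

lemma has_vector_derivative_cong_open:
  assumes "open S" "t \<in> S" "\<And>s. s \<in> S \<Longrightarrow> f s = g s"
  shows "(f has_vector_derivative d) (at t) \<longleftrightarrow> (g has_vector_derivative d) (at t)"
  using has_vector_derivative_transform_within_open[OF _ assms(1,2), of f d g]
    has_vector_derivative_transform_within_open[OF _ assms(1,2), of g d f] assms(3)
  by auto

lemma partial_cong:
  assumes U: "open U" "p \<in> U" and eq: "\<And>p. p \<in> U \<Longrightarrow> F p = G p"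
  shows "partial_x F p = partial_x G p" "partial_y F p = partial_y G p"
proof -
  have "((\<lambda>t. F (t, snd p)) has_vector_derivative d) (at (fst p)) \<longleftrightarrow>
        ((\<lambda>t. G (t, snd p)) has_vector_derivative d) (at (fst p))" for d
    by (rule has_vector_derivative_cong_open[OF open_lines(1,2)[OF U]]) (use eq in auto)
  then show "partial_x F p = partial_x G p"
    by (simp add: partial_x_def vector_derivative_def)
  have "((\<lambda>t. F (fst p, t)) has_vector_derivative d) (at (snd p)) \<longleftrightarrow>
        ((\<lambda>t. G (fst p, t)) has_vector_derivative d) (at (snd p))" for d
    by (rule has_vector_derivative_cong_open[OF open_lines(3,4)[OF U]]) (use eq in auto)
  then show "partial_y F p = partial_y G p"
    by (simp add: partial_y_def vector_derivative_def)
qed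

definition partials_exist :: "(real \<times> real) set \<Rightarrow> (real \<times> real \<Rightarrow> 'a::real_normed_vector) \<Rightarrow> bool" where
  "partials_exist U F \<longleftrightarrow> (\<forall>p\<in>U.
     ((\<lambda>t. F (t, snd p)) has_vector_derivative partial_x F p) (at (fst p)) \<and>
     ((\<lambda>t. F (fst p, t)) has_vector_derivative partial_y F p) (at (snd p)))"

lemma Ck_on_Suc_iff:
  "Ck_on (Suc k) U F \<longleftrightarrow>
     continuous_on U F \<and> partials_exist U F \<and> Ck_on k U (partial_x F) \<and> Ck_on k U (partial_y F)"
proof -
  have "(\<forall>(x, y)\<in>U. (\<lambda>t. F (t, y)) differentiable at x \<and> (\<lambda>t. F (x, t)) differentiable at y) \<longleftrightarrow> partials_exist U F"
    unfolding partials_exist_def partial_x_def partial_y_def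
    by (simp add: vector_derivative_works split_def)
  then show ?thesis by simp
qed

declare Ck_on.simps(2) [simp del]

lemma partials_existI:
  assumes "\<And>p. p \<in> U \<Longrightarrow> ((\<lambda>t. F (t, snd p)) has_vector_derivative a p) (at (fst p))"
    and "\<And>p. p \<in> U \<Longrightarrow> ((\<lambda>t. F (fst p, t)) has_vector_derivative b p) (at (snd p))"
  shows "partials_exist U F" and "\<And>p. p \<in> U \<Longrightarrow> partial_x F p = a p" "\<And>p. p \<in> U \<Longrightarrow> partial_y F p = b p"
proof -
  show *: "partial_x F p = a p" "partial_y F p = b p" if "p \<in> U" for p
    unfolding partial_x_def partial_y_def using assms[OF that] by (simp_all add: vector_derivative_at)
  show "partials_exist U F"
    unfolding partials_exist_def using assms * by simp
qed

lemma partials_combination: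
  assumes LM: "bounded_linear L" "bounded_linear M" and FG: "partials_exist U F" "partials_exist U G"
  defines "H \<equiv> \<lambda>p. L (F p) + M (G p)"
  shows "partials_exist U H"
    and "\<And>p. p \<in> U \<Longrightarrow> partial_x H p = L (partial_x F p) + M (partial_x G p)"
    and "\<And>p. p \<in> U \<Longrightarrow> partial_y H p = L (partial_y F p) + M (partial_y G p)"
proof -
  note bl = LM[THEN bounded_linear.has_vector_derivative]
  have 1: "((\<lambda>t. H (t, snd p)) has_vector_derivative L (partial_x F p) + M (partial_x G p)) (at (fst p))"
    if "p \<in> U" for p
    unfolding H_def by (intro has_vector_derivative_add bl) (use FG that in \<open>simp_all add: partials_exist_def\<close>)
  have 2: "((\<lambda>t. H (fst p, t)) has_vector_derivative L (partial_y F p) + M (partial_y G p)) (at (snd p))"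
    if "p \<in> U" for p
    unfolding H_def by (intro has_vector_derivative_add bl) (use FG that in \<open>simp_all add: partials_exist_def\<close>)
  show "partials_exist U H"
    and "\<And>p. p \<in> U \<Longrightarrow> partial_x H p = L (partial_x F p) + M (partial_x G p)"
    and "\<And>p. p \<in> U \<Longrightarrow> partial_y H p = L (partial_y F p) + M (partial_y G p)"
    using partials_existI[of U H, OF 1 2] by blast+
qed

lemma Ck_on_cong:
  assumes "open U" "Ck_on k U F" "\<And>p. p \<in> U \<Longrightarrow> F p = G p"
  shows "Ck_on k U G"
  using assms(2,3)
proof (induction k arbitrary: F G)
  case 0
  then show ?case using continuous_on_eq[of U F G] by simp
next
  case (Suc k)
  note pc = partial_cong[OF assms(1) _ Suc.prems(2)]
  have "partials_exist U G"
  proof (rule partials_existI[where a = "partial_x F" and b = "partial_y F"])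
    fix p assume p: "p \<in> U"
    have F: "((\<lambda>t. F (t, snd p)) has_vector_derivative partial_x F p) (at (fst p))"
       "((\<lambda>t. F (fst p, t)) has_vector_derivative partial_y F p) (at (snd p))"
      using Suc.prems(1) p unfolding Ck_on_Suc_iff partials_exist_def by auto
    show "((\<lambda>t. G (t, snd p)) has_vector_derivative partial_x F p) (at (fst p))"
      by (rule has_vector_derivative_transform_within_open[OF F(1) open_lines(1,2)[OF assms(1) p]])
         (use Suc.prems(2) in simp)
    show "((\<lambda>t. G (fst p, t)) has_vector_derivative partial_y F p) (at (snd p))"
      by (rule has_vector_derivative_transform_within_open[OF F(2) open_lines(3,4)[OF assms(1) p]])
         (use Suc.prems(2) in simp)
  qed
  moreover have "continuous_on U G"
    by (rule continuous_on_eq[of U F]) (use Suc.prems in \<open>simp_all add: Ck_on_Suc_iff\<close>)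
  moreover have "Ck_on k U (partial_x G)" "Ck_on k U (partial_y G)"
    by (rule Suc.IH[of "partial_x F"] Suc.IH[of "partial_y F"];
        use Suc.prems(1) pc in \<open>simp add: Ck_on_Suc_iff\<close>)+
  ultimately show ?case by (simp add: Ck_on_Suc_iff)
qed

lemma Ck_on_combination:
  assumes U: "open U" and LM: "bounded_linear L" "bounded_linear M" and FG: "Ck_on k U F" "Ck_on k U G"
  shows "Ck_on k U (\<lambda>p. L (F p) + M (G p))"
  using FG
proof (induction k arbitrary: F G)
  case 0
  then show ?case
    by (auto intro!: continuous_on_add LM[THEN bounded_linear.continuous_on])
next
  case (Suc k)
  then have F: "partials_exist U F" and G: "partials_exist U G" by (simp_all add: Ck_on_Suc_iff)
  note P = partials_combination[OF LM F G]
  show ?case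
    unfolding Ck_on_Suc_iff
  proof (intro conjI)
    show "Ck_on k U (partial_x (\<lambda>p. L (F p) + M (G p)))"
      by (rule Ck_on_cong[OF U Suc.IH[of "partial_x F" "partial_x G"]])
         (use Suc.prems P(2) in \<open>auto simp: Ck_on_Suc_iff\<close>)
    show "Ck_on k U (partial_y (\<lambda>p. L (F p) + M (G p)))"
      by (rule Ck_on_cong[OF U Suc.IH[of "partial_y F" "partial_y G"]])
         (use Suc.prems P(3) in \<open>auto simp: Ck_on_Suc_iff\<close>)
  qed (use Suc.prems P(1) in \<open>auto simp: Ck_on_Suc_iff
       intro!: continuous_on_add LM[THEN bounded_linear.continuous_on]\<close>)
qed

lemma Ck_on_linear: "open U \<Longrightarrow> bounded_linear L \<Longrightarrow> Ck_on k U F \<Longrightarrow> Ck_on k U (\<lambda>p. L (F p))"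
  using Ck_on_combination[OF _ _ bounded_linear_zero, of U L k F F] by simp

lemma Ck_on_add: "open U \<Longrightarrow> Ck_on k U F \<Longrightarrow> Ck_on k U G \<Longrightarrow> Ck_on k U (\<lambda>p. F p + G p)"
  using Ck_on_combination[OF _ bounded_linear_ident bounded_linear_ident] by blast

lemma Ck_on_imp_continuous_on: "Ck_on k U F \<Longrightarrow> continuous_on U F"
  by (cases k) (auto simp: Ck_on_Suc_iff)

lemma Ck_on_cr_op:
  assumes "open U" "Ck_on (Suc k) U F"
  shows "Ck_on k U (cr_op j F)"
  unfolding cr_op_def[abs_def]
  by (rule Ck_on_add[OF assms(1) _ Ck_on_linear[OF assms(1) bounded_linear_mult_right]])
     (use assms(2) in \<open>simp_all add: Ck_on_Suc_iff\<close>)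

lemma cr_op_funpow_cong:
  assumes "open U" "\<And>p. p \<in> U \<Longrightarrow> F p = G p" "p \<in> U"
  shows "(cr_op j ^^ n) F p = (cr_op j ^^ n) G p"
  using assms(2,3)
proof (induction n arbitrary: F G p)
  case (Suc n)
  have "cr_op j F q = cr_op j G q" if "q \<in> U" for q
    unfolding cr_op_def using partial_cong[OF assms(1) that Suc.prems(1)] by simp
  from Suc.IH[OF this Suc.prems(2)] show ?case
    by (simp add: funpow_Suc_right del: funpow.simps)
qed simp

text \<open>
  A linear map that intertwines \<open>j\<close> with \<open>j'\<close> intertwines the operators. This transports the
  quaternionic equation to complex coordinates.
\<close>

lemma cr_op_funpow_linear:
  assumes U: "open U" and L: "bounded_linear L" "\<And>x. L (j * x) = j' * L x"
    and F: "Ck_on n U F" and p: "p \<in> U"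
  shows "(cr_op j' ^^ n) (\<lambda>p. L (F p)) p = L ((cr_op j ^^ n) F p)"
  using F p
proof (induction n arbitrary: F p)
  case (Suc n)
  then have ex: "partials_exist U F" by (simp add: Ck_on_Suc_iff)
  interpret L: bounded_linear L by (rule L(1))
  have "cr_op j' (\<lambda>p. L (F p)) q = L (cr_op j F q)" if "q \<in> U" for q
    using partials_combination(2,3)[OF L(1) bounded_linear_zero ex ex that]
    by (simp add: cr_op_def L.add L(2))
  then have "(cr_op j' ^^ n) (cr_op j' (\<lambda>p. L (F p))) p = (cr_op j' ^^ n) (\<lambda>p. L (cr_op j F p)) p"
    by (rule cr_op_funpow_cong[OF U _ Suc.prems(2)])
  also have "\<dots> = L ((cr_op j ^^ n) (cr_op j F) p)"
    by (rule Suc.IH[OF Ck_on_cr_op[OF U Suc.prems(1)] Suc.prems(2)])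
  finally show ?case
    by (simp add: funpow_Suc_right del: funpow.simps)
qed simp

lemma unit_disc_iff: "p \<in> unit_disc \<longleftrightarrow> Complex (fst p) (snd p) \<in> ball 0 1"
proof -
  have "norm (Complex (fst p) (snd p)) < 1 \<longleftrightarrow> (norm (Complex (fst p) (snd p)))\<^sup>2 < 1"
    by (simp add: abs_square_less_1)
  then show ?thesis
    by (cases p) (simp add: unit_disc_def cmod_power2)
qed

lemma Re_Im_unit_disc: "z \<in> ball 0 1 \<Longrightarrow> (Re z, Im z) \<in> unit_disc"
  by (simp add: unit_disc_iff)

lemma open_unit_disc: "open unit_disc"
proof -
  have "unit_disc = {p. (fst p)\<^sup>2 + (snd p)\<^sup>2 < (1::real)}"
    by (auto simp: unit_disc_def)
  moreover have "open {p. (fst p)\<^sup>2 + (snd p)\<^sup>2 < (1::real)}"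
    by (intro open_Collect_less continuous_intros)
  ultimately show ?thesis by simp
qed

lemma has_derivative_imp_partials:
  fixes g :: "complex \<Rightarrow> complex"
  assumes der': "\<forall>z\<in>ball 0 1. (g has_derivative (\<lambda>v. A z * v + B z * cnj v)) (at z)"
  defines "F \<equiv> \<lambda>p. g (Complex (fst p) (snd p))"
  shows "partials_exist unit_disc F"
    and "\<And>p. p \<in> unit_disc \<Longrightarrow> partial_x F p = A (Complex (fst p) (snd p)) + B (Complex (fst p) (snd p))"
    and "\<And>p. p \<in> unit_disc \<Longrightarrow> partial_y F p = \<i> * (A (Complex (fst p) (snd p)) - B (Complex (fst p) (snd p)))"
proof -
  note der = bspec[OF der']
  have Complex_eq': "Complex x y = of_real x + \<i> * of_real y" for x y
    by (simp add: Complex_eq)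
  have 1: "((\<lambda>t. Complex t y) has_derivative of_real) (at x)" for x y
    unfolding Complex_eq' by (auto intro!: derivative_eq_intros)
  have 2: "((\<lambda>t. Complex x t) has_derivative (\<lambda>h. \<i> * of_real h)) (at y)" for x y
    unfolding Complex_eq' by (auto intro!: derivative_eq_intros)
  have x: "((\<lambda>t. F (t, snd p)) has_vector_derivative A (Complex (fst p) (snd p)) + B (Complex (fst p) (snd p))) (at (fst p))"
    if "p \<in> unit_disc" for p
    unfolding has_vector_derivative_def F_def
    using has_derivative_compose[OF 1 der[of "Complex (fst p) (snd p)"]] that
    by (simp add: unit_disc_iff scaleR_conv_of_real algebra_simps)
  have y: "((\<lambda>t. F (fst p, t)) has_vector_derivative \<i> * (A (Complex (fst p) (snd p)) - B (Complex (fst p) (snd p)))) (at (snd p))"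
    if "p \<in> unit_disc" for p
    unfolding has_vector_derivative_def F_def
    using has_derivative_compose[OF 2 der[of "Complex (fst p) (snd p)"]] that
    by (simp add: unit_disc_iff scaleR_conv_of_real algebra_simps)
  show "partials_exist unit_disc F"
    and "\<And>p. p \<in> unit_disc \<Longrightarrow> partial_x F p = A (Complex (fst p) (snd p)) + B (Complex (fst p) (snd p))"
    and "\<And>p. p \<in> unit_disc \<Longrightarrow> partial_y F p = \<i> * (A (Complex (fst p) (snd p)) - B (Complex (fst p) (snd p)))"
    using partials_existI[of unit_disc F, OF x y] by blast+
qed

lemma polyanalytic_disc_imp_Ck_on:
  "polyanalytic_disc N g \<Longrightarrow> Ck_on k unit_disc (\<lambda>p. g (Complex (fst p) (snd p)))"
proof (induction k arbitrary: g)
  case (0 g)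
  have "continuous_on unit_disc (\<lambda>p. g (Complex (fst p) (snd p)))"
    unfolding Complex_eq
    by (intro continuous_on_compose2[OF polyanalytic_disc_continuous[OF 0]] continuous_intros)
       (auto simp: unit_disc_iff Complex_eq)
  then show ?case by simp
next
  case (Suc k g)
  obtain A B where AB: "polyanalytic_disc N A" "polyanalytic_disc (N - 1) B"
     and der: "\<forall>z\<in>ball 0 1. (g has_derivative (\<lambda>v. A z * v + B z * cnj v)) (at z)"
    by (rule polyanalytic_disc_has_derivative[OF Suc.prems])
  have B: "polyanalytic_disc N B"
    by (rule polyanalytic_disc_mono[OF AB(2)]) simp
  note P = has_derivative_imp_partials[OF der]
  have "continuous_on unit_disc (\<lambda>p. g (Complex (fst p) (snd p)))"
    unfolding Complex_eq
    by (intro continuous_on_compose2[OF polyanalytic_disc_continuous[OF Suc.prems]] continuous_intros)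
       (auto simp: unit_disc_iff Complex_eq)
  moreover have "Ck_on k unit_disc (partial_x (\<lambda>p. g (Complex (fst p) (snd p))))"
    by (rule Ck_on_cong[OF open_unit_disc Suc.IH[OF polyanalytic_disc_add[OF AB(1) B]]]) (rule P(2)[symmetric])
  moreover have "Ck_on k unit_disc (partial_y (\<lambda>p. g (Complex (fst p) (snd p))))"
    by (rule Ck_on_cong[OF open_unit_disc Suc.IH[OF polyanalytic_disc_cmult[OF polyanalytic_disc_diff[OF AB(1) B], of \<i>]]])
       (rule P(3)[symmetric])
  ultimately show ?case
    unfolding Ck_on_Suc_iff using P(1) by simp
qed

lemma polyanalytic_disc_imp_cr_op_zero:
  "polyanalytic_disc N g \<Longrightarrow> p \<in> unit_disc \<Longrightarrow> (cr_op \<i> ^^ N) (\<lambda>p. g (Complex (fst p) (snd p))) p = 0"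
proof (induction N arbitrary: g p)
  case 0
  then show ?case by (simp add: polyanalytic_disc_def unit_disc_iff)
next
  case (Suc N)
  obtain A B where AB: "polyanalytic_disc (Suc N) A" "polyanalytic_disc N B"
     and der: "\<forall>z\<in>ball 0 1. (g has_derivative (\<lambda>v. A z * v + B z * cnj v)) (at z)"
    by (rule polyanalytic_disc_has_derivative[OF Suc.prems(1), unfolded diff_Suc_1])
  note P = has_derivative_imp_partials[OF der]
  have cr: "cr_op \<i> (\<lambda>p. g (Complex (fst p) (snd p))) q = 2 * B (Complex (fst q) (snd q))"
    if q: "q \<in> unit_disc" for q
    unfolding cr_op_def P(2)[OF q] P(3)[OF q] by (simp flip: mult.assoc)
  have "(cr_op \<i> ^^ N) (cr_op \<i> (\<lambda>p. g (Complex (fst p) (snd p)))) p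
      = (cr_op \<i> ^^ N) (\<lambda>p. 2 * B (Complex (fst p) (snd p))) p"
    by (rule cr_op_funpow_cong[OF open_unit_disc cr Suc.prems(2)])
  also have "\<dots> = 0"
    by (rule Suc.IH[OF polyanalytic_disc_cmult[OF AB(2)] Suc.prems(2)])
  finally show ?case
    by (simp add: funpow_Suc_right del: funpow.simps)
qed

text \<open>
  Continuous partial derivatives give a Frechet derivative, which is what holomorphy is read off from.
\<close>

lemma has_derivative_from_partials:
  fixes F :: "real \<times> real \<Rightarrow> complex"
  assumes U: "open U" and F: "partials_exist U F" and cont: "continuous_on U (partial_y F)"
    and z: "(Re z, Im z) \<in> U"
  shows "((\<lambda>z. F (Re z, Im z)) has_derivative
    (\<lambda>v. Re v *\<^sub>R partial_x F (Re z, Im z) + Im v *\<^sub>R partial_y F (Re z, Im z))) (at z)"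
proof -
  define x where "x = Re z"
  define y where "y = Im z"
  obtain X Y where XY: "open X" "open Y" "(x, y) \<in> X \<times> Y" "X \<times> Y \<subseteq> U"
    using U z unfolding x_def y_def by (elim open_prod_elim)
  have "y \<in> Y" using XY(3) by simp
  then obtain e where e: "e > 0" "ball y e \<subseteq> Y"
    using XY(2) open_contains_ball by blast
  define Y' where "Y' = ball y e"
  have XY': "(x, y) \<in> X \<times> Y'" "open (X \<times> Y')" "X \<times> Y' \<subseteq> U" "convex Y'"
  proof -
    show "(x, y) \<in> X \<times> Y'" using XY(3) e(1) by (simp add: Y'_def)
    show "open (X \<times> Y')" unfolding Y'_def by (intro open_Times XY(1) open_ball)
    show "X \<times> Y' \<subseteq> U" using XY(4) e(2) unfolding Y'_def by blast
    show "convex Y'" by (simp add: Y'_def)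
  qed
  have "((\<lambda>(x, y). F (x, y)) has_derivative
     (\<lambda>(tx, ty). tx *\<^sub>R partial_x F (x, y) + blinfun_apply (blinfun_scaleR_left (partial_y F (x, y))) ty)) (at (x, y) within X \<times> Y')"
  proof (rule has_derivative_partialsI[where f = "\<lambda>x y. F (x, y)" and fy = "\<lambda>x y. blinfun_scaleR_left (partial_y F (x, y))"])
    show "((\<lambda>x. F (x, y)) has_derivative (\<lambda>tx. tx *\<^sub>R partial_x F (x, y))) (at x within X)"
    proof (rule has_derivative_at_withinI)
      have m: "(x, y) \<in> U" using XY'(1,3) by blast
      show "((\<lambda>x. F (x, y)) has_derivative (\<lambda>tx. tx *\<^sub>R partial_x F (x, y))) (at x)"
        using bspec[OF F[unfolded partials_exist_def has_vector_derivative_def] m] by simp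
    qed
  next
    fix x' y' assume "x' \<in> X" "y' \<in> Y'"
    then have m: "(x', y') \<in> U" using XY'(3) by blast
    have "((\<lambda>y. F (x', y)) has_derivative (\<lambda>t. t *\<^sub>R partial_y F (x', y'))) (at y')"
      using bspec[OF F[unfolded partials_exist_def has_vector_derivative_def] m] by simp
    then show "((\<lambda>y. F (x', y)) has_derivative blinfun_apply (blinfun_scaleR_left (partial_y F (x', y')))) (at y' within Y')"
      unfolding blinfun_scaleR_left.rep_eq by (rule has_derivative_at_withinI)
  next
    have "continuous_on (X \<times> Y') (partial_y F)"
      by (rule continuous_on_subset[OF cont XY'(3)])
    then have "continuous_on (X \<times> Y') (\<lambda>p. blinfun_scaleR_left (partial_y F p))"
      by (rule bounded_linear.continuous_on[OF bounded_linear_blinfun_scaleR_left])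
    then have "continuous (at (x, y) within X \<times> Y') (\<lambda>p. blinfun_scaleR_left (partial_y F p))"
      using XY'(1) continuous_on_eq_continuous_within by blast
    then show "continuous (at (x, y) within X \<times> Y') (\<lambda>(x, y). blinfun_scaleR_left (partial_y F (x, y)))"
      by (simp only: case_prod_unfold prod.collapse)
  next
    show "y \<in> Y'" "convex Y'" using XY' by blast+
  qed
  then have D: "(F has_derivative (\<lambda>(tx, ty). tx *\<^sub>R partial_x F (x, y) + ty *\<^sub>R partial_y F (x, y))) (at (x, y))"
    unfolding at_within_open[OF XY'(1,2)] blinfun_scaleR_left.rep_eq by (simp only: case_prod_unfold prod.collapse)
  have "((\<lambda>z. (Re z, Im z)) has_derivative (\<lambda>v. (Re v, Im v))) (at z)"
    by (intro bounded_linear_imp_has_derivative bounded_linear_Pair bounded_linear_Re bounded_linear_Im)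
  from has_derivative_compose[OF this D[unfolded x_def y_def]] show ?thesis
    by simp
qed

text \<open>
  Induction on the order: \<open>cr_op\<close> of \<open>F\<close> has an expansion \<open>(\<Sum>k<N. cnj z ^ k * h k z)\<close>. Integrating it
  formally in \<open>cnj z\<close> gives \<open>G = (\<Sum>k<N. cnj z ^ (k + 1) * h k z / (2 * (k + 1)))\<close> with the same
  \<open>cr_op\<close>, the \<open>2\<close> because \<open>cr_op\<close> is twice the Wirtinger derivative. So \<open>F - G\<close> is holomorphic.
\<close>

theorem cr_op_zero_imp_polyanalytic_disc:
  fixes F :: "real \<times> real \<Rightarrow> complex"
  assumes "Ck_on N unit_disc F" "\<And>p. p \<in> unit_disc \<Longrightarrow> (cr_op \<i> ^^ N) F p = 0"
  shows "polyanalytic_disc N (\<lambda>z. F (Re z, Im z))"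
  using assms
proof (induction N arbitrary: F)
  case 0
  then show ?case by (simp add: polyanalytic_disc_def Re_Im_unit_disc)
next
  case (Suc N)
  define F1 where "F1 = cr_op \<i> F"
  have "polyanalytic_disc N (\<lambda>z. F1 (Re z, Im z))"
    unfolding F1_def
    by (rule Suc.IH[OF Ck_on_cr_op[OF open_unit_disc Suc.prems(1)]])
       (use Suc.prems(2) in \<open>simp add: funpow_Suc_right del: funpow.simps\<close>)
  then obtain h where h: "\<forall>k<N. h k holomorphic_on ball 0 1"
      "\<forall>z\<in>ball 0 1. F1 (Re z, Im z) = (\<Sum>k<N. cnj z ^ k * h k z)"
    unfolding polyanalytic_disc_def by auto
  \<comment> \<open>The coefficients of \<open>G\<close>; there is no term of degree \<open>0\<close>.\<close>
  define h' where "h' i = (case i of 0 \<Rightarrow> (\<lambda>_. 0) | Suc j \<Rightarrow> (\<lambda>z. h j z / (2 * of_nat (Suc j))))" for i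
  have h': "h' i holomorphic_on ball 0 1" if "i < Suc N" for i
    using that h(1) by (auto simp: h'_def split: nat.split simp del: of_nat_Suc intro!: holomorphic_intros)
  define G where "G z = (\<Sum>i<Suc N. cnj z ^ i * h' i z)" for z
  have Gpa: "polyanalytic_disc (Suc N) G"
    unfolding polyanalytic_disc_def G_def using h' by auto
  define A where "A z = (partial_x F (Re z, Im z) - \<i> * partial_y F (Re z, Im z)) / 2" for z
  define A' where "A' z = (\<Sum>i<Suc N. cnj z ^ i * deriv (h' i) z)" for z
  have der: "((\<lambda>z. F (Re z, Im z) - G z) has_field_derivative A z - A' z) (at z)" if z: "z \<in> ball 0 1" for z
  proof -
    have ex: "partials_exist unit_disc F" "continuous_on unit_disc (partial_y F)"
      using Suc.prems(1) Ck_on_imp_continuous_on unfolding Ck_on_Suc_iff by auto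
    have 1: "((\<lambda>z. F (Re z, Im z)) has_derivative
       (\<lambda>v. Re v *\<^sub>R partial_x F (Re z, Im z) + Im v *\<^sub>R partial_y F (Re z, Im z))) (at z)"
      by (rule has_derivative_from_partials[OF open_unit_disc ex Re_Im_unit_disc[OF z]])
    have "F1 (Re z, Im z) / 2 = (\<Sum>i<N. cnj z ^ i * (of_nat (Suc i) * h' (Suc i) z))"
      using h(2) z by (simp add: h'_def sum_divide_distrib del: of_nat_Suc)
    then have 2: "(G has_derivative (\<lambda>v. A' z * v + F1 (Re z, Im z) / 2 * cnj v)) (at z)"
      using has_derivative_cnj_power_sum[of "Suc N" h', OF h' z] by (simp add: G_def[abs_def] A'_def)
    have "Re v *\<^sub>R partial_x F (Re z, Im z) + Im v *\<^sub>R partial_y F (Re z, Im z)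
        = A z * v + F1 (Re z, Im z) / 2 * cnj v" for v
      by (simp add: A_def F1_def cr_op_def complex_eq_iff algebra_simps add_divide_distrib diff_divide_distrib)
    then have eq: "(\<lambda>v. Re v *\<^sub>R partial_x F (Re z, Im z) + Im v *\<^sub>R partial_y F (Re z, Im z)
        - (A' z * v + F1 (Re z, Im z) / 2 * cnj v)) = (*) (A z - A' z)"
      by (auto simp: fun_eq_iff algebra_simps)
    show ?thesis
      unfolding has_field_derivative_def eq[symmetric] by (rule has_derivative_diff[OF 1 2])
  qed
  have "(\<lambda>z. F (Re z, Im z) - G z) holomorphic_on ball 0 1"
    unfolding holomorphic_on_open[OF open_ball] using der by blast
  then have "polyanalytic_disc (Suc N) (\<lambda>z. F (Re z, Im z) - G z)"
    using polyanalytic_disc_holomorphic polyanalytic_disc_mono by (metis Suc_le_mono le0)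
  from polyanalytic_disc_add[OF this Gpa] show ?case by simp
qed

section \<open>Quaternionic slices\<close>

definition slice_embed :: "quat \<Rightarrow> complex \<Rightarrow> quat" where
  "slice_embed I z = Re z *\<^sub>R 1 + Im z *\<^sub>R I"

definition disc_point :: "real \<times> real \<Rightarrow> complex" where
  "disc_point p = Complex (fst p) (snd p)"

lemma slice_pt_eq_embed: "slice_pt I p = slice_embed I (disc_point p)"
  by (simp add: slice_pt_def slice_embed_def disc_point_def of_real_def)

lemma disc_point_Re_Im [simp]: "disc_point (Re z, Im z) = z"
  by (simp add: disc_point_def)

lemma disc_point_in_ball: "disc_point p \<in> ball 0 1 \<longleftrightarrow> p \<in> unit_disc"
  by (simp add: disc_point_def unit_disc_iff)

lemma slice_embed_uminus_unit: "slice_embed (- I) z = slice_embed I (cnj z)"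
  by (simp add: slice_embed_def)

lemma slice_embed_add: "slice_embed I (z + w) = slice_embed I z + slice_embed I w"
  and slice_embed_diff: "slice_embed I (z - w) = slice_embed I z - slice_embed I w"
  and slice_embed_minus: "slice_embed I (- z) = - slice_embed I z"
  and slice_embed_of_real: "slice_embed I (of_real x) = of_real x"
  and slice_embed_0: "slice_embed I 0 = 0"
  and slice_embed_1: "slice_embed I 1 = 1"
  by (simp_all add: slice_embed_def algebra_simps of_real_def)

lemma slice_embed_sum: "slice_embed I (sum f A) = (\<Sum>x\<in>A. slice_embed I (f x))"
  by (induction A rule: infinite_finite_induct) (simp_all add: slice_embed_add slice_embed_0)

lemma slice_embed_mult:
  assumes "I \<in> imag_units"
  shows "slice_embed I (z * w) = slice_embed I z * slice_embed I w"
  using imag_units_mult_self[OF assms] by (simp add: slice_embed_def algebra_simps)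

lemma slice_embed_power:
  "I \<in> imag_units \<Longrightarrow> slice_embed I (z ^ n) = slice_embed I z ^ n"
  by (induction n) (simp_all add: slice_embed_mult slice_embed_1)

lemma slice_embed_inverse:
  assumes "I \<in> imag_units"
  shows "slice_embed I (inverse z) = inverse (slice_embed I z)"
proof (cases "z = 0")
  case False
  then have "slice_embed I (inverse z) * slice_embed I z = 1"
    by (simp add: slice_embed_1 flip: slice_embed_mult[OF assms])
  then show ?thesis
    by (metis inverse_unique inverse_inverse_eq)
qed (simp add: slice_embed_0)

lemma qcnj_simps:
  "qcnj (a + b) = qcnj a + qcnj b" "qcnj (a - b) = qcnj a - qcnj b" "qcnj (a * b) = qcnj b * qcnj a"
  "qcnj (- a) = - qcnj a" "qcnj (x *\<^sub>R a) = x *\<^sub>R qcnj a" "qcnj 1 = 1" "qcnj 0 = 0" "qcnj (qcnj a) = a"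
  by (simp_all add: quat_eq_iff)

lemma qcnj_imag_unit: "I \<in> imag_units \<Longrightarrow> qcnj I = - I"
  by (simp add: imag_units_iff quat_eq_iff)

lemma qcnj_slice_embed: "I \<in> imag_units \<Longrightarrow> qcnj (slice_embed I z) = slice_embed I (cnj z)"
  by (simp add: slice_embed_def qcnj_simps qcnj_imag_unit)

lemma norm_slice_embed: "I \<in> imag_units \<Longrightarrow> norm (slice_embed I z) = norm z"
  using norm_slice_pt[of I "Re z" "Im z"]
  by (simp add: slice_pt_eq_embed cmod_power2[symmetric])

text \<open>
  For \<open>I\<close> an imaginary unit, these are left \<open>C_I\<close>-linear maps from the quaternions to the complex
  numbers, and a quaternion is determined by their values at it for all \<open>c\<close>. Using every \<open>c\<close>, instead of
  a splitting along a chosen unit orthogonal to \<open>I\<close>, makes the passage between slices a matter of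
  changing \<open>c\<close>.
\<close>

definition slice_coord :: "quat \<Rightarrow> quat \<Rightarrow> quat \<Rightarrow> complex" where
  "slice_coord I c x = Complex (qRe (x * c)) (- qRe (I * x * c))"

lemma qRe_mult_commute: "qRe (x * y) = qRe (y * x)"
  by simp

lemma bounded_linear_slice_coord: "bounded_linear (slice_coord I c)"
proof (rule linear_conv_bounded_linear[THEN iffD1], rule linearI)
  show "slice_coord I c (x + y) = slice_coord I c x + slice_coord I c y" for x y
    unfolding slice_coord_def by (simp add: distrib_left distrib_right complex_eq_iff del: times_quat.simps)
  show "slice_coord I c (r *\<^sub>R x) = r *\<^sub>R slice_coord I c x" for r x
    unfolding slice_coord_def by (simp add: complex_eq_iff del: times_quat.simps)
qed

lemma slice_coord_unit_mult:
  assumes "I \<in> imag_units"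
  shows "slice_coord I c (I * x) = \<i> * slice_coord I c x"
proof -
  have "I * (I * x) * c = - (x * c)"
    by (simp add: imag_units_mult_self[OF assms] flip: mult.assoc)
  then show ?thesis
    by (simp add: slice_coord_def complex_eq_iff del: times_quat.simps)
qed

lemma slice_coord_embed_mult:
  assumes "I \<in> imag_units"
  shows "slice_coord I c (slice_embed I z * x) = z * slice_coord I c x"
proof -
  interpret bounded_linear "slice_coord I c" by (rule bounded_linear_slice_coord)
  have "slice_coord I c (slice_embed I z * x) = Re z *\<^sub>R slice_coord I c x + Im z *\<^sub>R slice_coord I c (I * x)"
    by (simp add: slice_embed_def distrib_right add scaleR)
  also have "\<dots> = (of_real (Re z) + \<i> * of_real (Im z)) * slice_coord I c x"
    by (simp add: slice_coord_unit_mult[OF assms] scaleR_conv_of_real algebra_simps)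
  also have "of_real (Re z) + \<i> * of_real (Im z) = z"
    by (rule complex_eq[symmetric])
  finally show ?thesis .
qed

lemma quat_eq_sum_slice_coord:
  "x = (\<Sum>e\<in>Basis. Re (slice_coord I (qcnj e) x) *\<^sub>R e)"
proof -
  have "Re (slice_coord I (qcnj e) x) = x \<bullet> e" for e
    by (simp add: slice_coord_def inner_quat_def)
  then show ?thesis
    by (simp add: euclidean_representation)
qed

lemma slice_coord_eqI:
  assumes "\<And>c. slice_coord I c x = slice_coord I c y"
  shows "x = y"
  by (subst quat_eq_sum_slice_coord[of x I], subst quat_eq_sum_slice_coord[of y I]) (simp add: assms)

definition polyanalytic_on_slice :: "nat \<Rightarrow> quat \<Rightarrow> (quat \<Rightarrow> quat) \<Rightarrow> bool" where
  "polyanalytic_on_slice N I f \<longleftrightarrow>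
     (\<forall>c. polyanalytic_disc N (\<lambda>z. slice_coord I c (f (slice_embed I z))))"

lemma polyanalytic_on_slice_imp_Ck_on:
  assumes "polyanalytic_on_slice N I f"
  shows "Ck_on k unit_disc (\<lambda>p. f (slice_pt I p))"
proof -
  define G where "G e p = Re (slice_coord I (qcnj e) (f (slice_pt I p))) *\<^sub>R e" for e p
  have G: "Ck_on k unit_disc (G e)" for e
  proof -
    have L: "bounded_linear (\<lambda>z. Re z *\<^sub>R e)"
      by (rule bounded_linear_scaleR_const[OF bounded_linear_Re])
    have "Ck_on k unit_disc (\<lambda>p. slice_coord I (qcnj e) (f (slice_pt I p)))"
      using polyanalytic_disc_imp_Ck_on[of N _ k] assms
      unfolding polyanalytic_on_slice_def slice_pt_eq_embed disc_point_def by blast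
    from Ck_on_linear[OF open_unit_disc L this] show ?thesis
      by (simp add: G_def[abs_def])
  qed
  have "Ck_on k unit_disc (\<lambda>p. G (Quat 1 0 0 0) p + (G (Quat 0 1 0 0) p + (G (Quat 0 0 1 0) p + G (Quat 0 0 0 1) p)))"
    by (intro Ck_on_add open_unit_disc G)
  also have "(\<lambda>p. G (Quat 1 0 0 0) p + (G (Quat 0 1 0 0) p + (G (Quat 0 0 1 0) p + G (Quat 0 0 0 1) p)))
     = (\<lambda>p. f (slice_pt I p))"
    by (subst (5) quat_eq_sum_slice_coord[of _ I]) (simp add: Basis_quat_def G_def)
  finally show ?thesis .
qed

lemma polyanalytic_on_slice_iff:
  assumes I: "I \<in> imag_units"
  shows "polyanalytic_on_slice N I f \<longleftrightarrow>
    Ck_on N unit_disc (\<lambda>p. f (slice_pt I p)) \<and>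
    (\<forall>p\<in>unit_disc. (slice_CR I ^^ N) (\<lambda>p. f (slice_pt I p)) p = 0)"
proof -
  define F where "F p = f (slice_pt I p)" for p
  have coord: "(cr_op \<i> ^^ N) (\<lambda>p. slice_coord I c (F p)) p = slice_coord I c ((slice_CR I ^^ N) F p)"
    if "Ck_on N unit_disc F" "p \<in> unit_disc" for c p
    unfolding slice_CR_eq_cr_op
    by (rule cr_op_funpow_linear[OF open_unit_disc bounded_linear_slice_coord slice_coord_unit_mult[OF I] that])
  have Fz: "F (Re z, Im z) = f (slice_embed I z)" "F p = f (slice_embed I (Complex (fst p) (snd p)))" for z p
    by (simp_all add: F_def slice_pt_eq_embed) (simp add: disc_point_def)
  show ?thesis
    unfolding F_def[symmetric]
  proof
    assume pa: "polyanalytic_on_slice N I f"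
    have Ck: "Ck_on N unit_disc F"
      using polyanalytic_on_slice_imp_Ck_on[OF pa] by (simp add: F_def[abs_def])
    moreover have "(slice_CR I ^^ N) F p = 0" if p: "p \<in> unit_disc" for p
    proof (rule slice_coord_eqI[of I])
      fix c
      have "slice_coord I c ((slice_CR I ^^ N) F p) = (cr_op \<i> ^^ N) (\<lambda>p. slice_coord I c (F p)) p"
        using coord[OF Ck p] by simp
      also have "\<dots> = 0"
        using polyanalytic_disc_imp_cr_op_zero[OF _ p, of N "\<lambda>z. slice_coord I c (f (slice_embed I z))"] pa
        by (simp add: polyanalytic_on_slice_def Fz(2))
      also have "\<dots> = slice_coord I c 0"
        by (simp add: slice_coord_def complex_eq_iff)
      finally show "slice_coord I c ((slice_CR I ^^ N) F p) = slice_coord I c 0" .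
    qed
    ultimately show "Ck_on N unit_disc F \<and> (\<forall>p\<in>unit_disc. (slice_CR I ^^ N) F p = 0)" by blast
  next
    assume *: "Ck_on N unit_disc F \<and> (\<forall>p\<in>unit_disc. (slice_CR I ^^ N) F p = 0)"
    then have Ck: "Ck_on N unit_disc F" by simp
    have "polyanalytic_disc N (\<lambda>z. slice_coord I c (F (Re z, Im z)))" for c
    proof (rule cr_op_zero_imp_polyanalytic_disc)
      show "Ck_on N unit_disc (\<lambda>p. slice_coord I c (F p))"
        by (rule Ck_on_linear[OF open_unit_disc bounded_linear_slice_coord Ck])
      show "(cr_op \<i> ^^ N) (\<lambda>p. slice_coord I c (F p)) p = 0" if "p \<in> unit_disc" for p
        using coord[OF Ck that, of c] * that by (simp add: slice_coord_def complex_eq_iff)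
    qed
    then show "polyanalytic_on_slice N I f"
      by (simp add: polyanalytic_on_slice_def Fz(1))
  qed
qed

text \<open>
  The coefficients of the representation formula are \<open>slice_projection J I\<close> and
  \<open>slice_projection J (- I)\<close>.
\<close>

definition slice_projection :: "quat \<Rightarrow> quat \<Rightarrow> quat" where
  "slice_projection J I = (1 / 2) *\<^sub>R (1 - J * I)"

lemma slice_projection_intertwines:
  assumes "I \<in> imag_units" "J \<in> imag_units"
  shows "J * slice_projection J I = slice_projection J I * I"
proof -
  have "J * (J * I) = - I" "J * I * I = - J"
    using assms by (simp_all add: imag_units_mult_self mult.assoc)
      (simp add: imag_units_mult_self flip: mult.assoc)
  then show ?thesis
    by (simp add: slice_projection_def algebra_simps)
qed

text \<open>
  The coordinates on the slice of \<open>J\<close> of a projected value are coordinates on the slice of \<open>I\<close>, because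
  \<open>J * P = P * I\<close> for the projection \<open>P\<close> and the real part is invariant under cyclic permutation.
\<close>

lemma slice_coord_slice_projection:
  assumes "I \<in> imag_units" "J \<in> imag_units"
  shows "slice_coord J c (slice_projection J I * x) = slice_coord I (c * slice_projection J I) x"
proof -
  define P where "P = slice_projection J I"
  have 1: "qRe (P * x * c) = qRe (x * (c * P))"
    using qRe_mult_commute[of P "x * c"] by (simp only: mult.assoc)
  have "J * (P * x) * c = P * (I * x * c)"
    using slice_projection_intertwines[OF assms] unfolding P_def by (metis mult.assoc)
  then have 2: "qRe (J * (P * x) * c) = qRe (I * x * (c * P))"
    using qRe_mult_commute[of P "I * x * c"] by (simp only: mult.assoc)
  show ?thesis
    unfolding slice_coord_def P_def[symmetric] 1 2 ..
qed

lemma slice_coord_uminus: "slice_coord (- I) c x = cnj (slice_coord I c x)"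
  by (simp add: slice_coord_def complex_eq_iff)

definition slice_representation :: "quat \<Rightarrow> (quat \<Rightarrow> quat) \<Rightarrow> bool" where
  "slice_representation I f \<longleftrightarrow> (\<forall>J\<in>imag_units. \<forall>z\<in>ball 0 1.
     f (slice_embed J z) = slice_projection J I * f (slice_embed I z)
       + slice_projection J (- I) * f (slice_embed I (cnj z)))"

lemma slice_pt_uminus_snd: "slice_pt I (x, - y) = slice_pt (- I) (x, y)"
  by (simp add: slice_pt_def)

lemma slice_representation_imp_induced:
  assumes I: "I \<in> imag_units" and f: "slice_representation I f"
  shows "slice_induced f (\<lambda>p. (1 / 2) *\<^sub>R (f (slice_pt I p) + f (slice_pt (- I) p)))
     (\<lambda>p. (1 / 2) *\<^sub>R (- I * (f (slice_pt I p) - f (slice_pt (- I) p))))"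
  unfolding slice_induced_def
proof (intro conjI allI impI ballI)
  fix J p assume J: "J \<in> imag_units" and p: "p \<in> unit_disc"
  have "f (slice_pt J p) = slice_projection J I * f (slice_pt I p) + slice_projection J (- I) * f (slice_pt (- I) p)"
  proof -
    have "disc_point p \<in> ball 0 1" using p disc_point_in_ball by blast
    with f J show ?thesis
      unfolding slice_representation_def slice_pt_eq_embed slice_embed_uminus_unit by blast
  qed
  then show "f (slice_pt J p) = (1 / 2) *\<^sub>R (f (slice_pt I p) + f (slice_pt (- I) p)) +
      J * (1 / 2) *\<^sub>R (- I * (f (slice_pt I p) - f (slice_pt (- I) p)))"
    by (simp add: slice_projection_def algebra_simps)
qed (simp_all add: slice_pt_uminus_snd add.commute algebra_simps)

lemma slice_induced_imp_representation:
  assumes I: "I \<in> imag_units" and f: "slice_induced f \<alpha> \<beta>"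
  shows "slice_representation I f"
  unfolding slice_representation_def
proof (intro ballI)
  fix J z assume J: "J \<in> imag_units" and z: "z \<in> ball (0::complex) 1"
  define p where "p = (Re z, Im z)"
  have p: "p \<in> unit_disc" using z by (simp add: p_def Re_Im_unit_disc)
  have e: "slice_embed K z = slice_pt K p" "slice_embed K (cnj z) = slice_pt (- K) p" for K
    by (simp_all add: slice_pt_eq_embed p_def slice_embed_uminus_unit)
  have 1: "f (slice_pt K p) = \<alpha> p + K * \<beta> p" if "K \<in> imag_units" for K
    by (rule slice_inducedD[OF f that p])
  have II: "I * (I * x) = - x" for x
    using imag_units_mult_self[OF I] by (simp flip: mult.assoc)
  show "f (slice_embed J z) = slice_projection J I * f (slice_embed I z)
       + slice_projection J (- I) * f (slice_embed I (cnj z))"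
    unfolding e 1[OF J] 1[OF I] 1[OF imag_units_uminus[OF I]]
    by (simp add: slice_projection_def algebra_simps II mult.assoc) (simp flip: scaleR_add_left)
qed

text \<open>
  By the representation formula the coordinates on the slice of \<open>J\<close> are sums of a coordinate on the slice
  of \<open>I\<close> and of a reflected one.
\<close>

lemma polyanalytic_on_slice_change:
  assumes I: "I \<in> imag_units" and J: "J \<in> imag_units"
    and f: "slice_representation I f" and pa: "polyanalytic_on_slice N I f"
  shows "polyanalytic_on_slice N J f"
  unfolding polyanalytic_on_slice_def
proof
  fix c
  define d d' where "d = c * slice_projection J I" and "d' = c * slice_projection J (- I)"
  have "polyanalytic_disc N (\<lambda>z. slice_coord I d (f (slice_embed I z)) + cnj (slice_coord I d' (f (slice_embed I (cnj z)))))"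
    using pa unfolding polyanalytic_on_slice_def
    by (intro polyanalytic_disc_add polyanalytic_disc_reflect) auto
  then show "polyanalytic_disc N (\<lambda>z. slice_coord J c (f (slice_embed J z)))"
  proof (rule polyanalytic_disc_cong)
    fix z :: complex assume z: "z \<in> ball 0 1"
    interpret bounded_linear "slice_coord J c" by (rule bounded_linear_slice_coord)
    have "f (slice_embed J z) = slice_projection J I * f (slice_embed I z)
       + slice_projection J (- I) * f (slice_embed I (cnj z))"
      using f J z by (simp add: slice_representation_def)
    then show "slice_coord I d (f (slice_embed I z)) + cnj (slice_coord I d' (f (slice_embed I (cnj z))))
       = slice_coord J c (f (slice_embed J z))"
      by (simp add: add slice_coord_slice_projection I J imag_units_uminus slice_coord_uminus d_def d'_def)
  qed
qed

text \<open>
  The stem functions are recovered from the restrictions to the slices of \<open>I\<close> and \<open>- I\<close>, so their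
  smoothness follows from that of the restrictions.
\<close>

theorem slice_polyanalytic_iff:
  assumes I: "I \<in> imag_units"
  shows "f \<in> slice_polyanalytic N \<longleftrightarrow>
    (\<forall>q. q \<notin> qball \<longrightarrow> f q = 0) \<and> slice_representation I f \<and> polyanalytic_on_slice N I f"
proof (intro iffI conjI)
  assume "f \<in> slice_polyanalytic N"
  then obtain \<alpha> \<beta> where f0: "\<forall>q. q \<notin> qball \<longrightarrow> f q = 0" and ab: "slice_induced f \<alpha> \<beta>"
     and Ck: "Ck_on N unit_disc \<alpha>" "Ck_on N unit_disc \<beta>"
     and CR: "\<forall>I\<in>imag_units. \<forall>p\<in>unit_disc. (1 / 2 ^ N) *\<^sub>R (slice_CR I ^^ N) (\<lambda>p. \<alpha> p + I * \<beta> p) p = 0"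
    unfolding slice_polyanalytic_def by blast
  show "\<forall>q. q \<notin> qball \<longrightarrow> f q = 0" by (rule f0)
  show "slice_representation I f" by (rule slice_induced_imp_representation[OF I ab])
  have eq: "\<alpha> p + I * \<beta> p = f (slice_pt I p)" if "p \<in> unit_disc" for p
    using slice_inducedD[OF ab I that] by simp
  have "Ck_on N unit_disc (\<lambda>p. \<alpha> p + I * \<beta> p)"
    by (rule Ck_on_add[OF open_unit_disc Ck(1) Ck_on_linear[OF open_unit_disc bounded_linear_mult_right Ck(2)]])
  then have "Ck_on N unit_disc (\<lambda>p. f (slice_pt I p))"
    by (rule Ck_on_cong[OF open_unit_disc]) (rule eq)
  moreover have "(slice_CR I ^^ N) (\<lambda>p. f (slice_pt I p)) p = 0" if "p \<in> unit_disc" for p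
  proof -
    have "(cr_op I ^^ N) (\<lambda>p. \<alpha> p + I * \<beta> p) p = (cr_op I ^^ N) (\<lambda>p. f (slice_pt I p)) p"
      by (rule cr_op_funpow_cong[OF open_unit_disc eq that])
    then show ?thesis
      using CR I that by (simp add: slice_CR_eq_cr_op)
  qed
  ultimately show "polyanalytic_on_slice N I f"
    unfolding polyanalytic_on_slice_iff[OF I] by blast
next
  assume *: "(\<forall>q. q \<notin> qball \<longrightarrow> f q = 0) \<and> slice_representation I f \<and> polyanalytic_on_slice N I f"
  define \<alpha> where "\<alpha> = (\<lambda>p. (1 / 2) *\<^sub>R (f (slice_pt I p) + f (slice_pt (- I) p)))"
  define \<beta> where "\<beta> = (\<lambda>p. (1 / 2) *\<^sub>R (- I * (f (slice_pt I p) - f (slice_pt (- I) p))))"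
  have ab: "slice_induced f \<alpha> \<beta>"
    using slice_representation_imp_induced[OF I] * unfolding \<alpha>_def \<beta>_def by blast
  have pa: "polyanalytic_on_slice N J f" if "J \<in> imag_units" for J
    using polyanalytic_on_slice_change[OF I that] * by blast
  have Ck: "Ck_on N unit_disc (\<lambda>p. f (slice_pt J p))" if "J \<in> imag_units" for J
    using pa[OF that] by (rule polyanalytic_on_slice_imp_Ck_on)
  have "Ck_on N unit_disc \<alpha>"
    unfolding \<alpha>_def
    by (rule Ck_on_linear[OF open_unit_disc bounded_linear_scaleR_right
          Ck_on_add[OF open_unit_disc Ck[OF I] Ck[OF imag_units_uminus[OF I]]]])
  moreover have "Ck_on N unit_disc \<beta>"
  proof -
    have "bounded_linear (\<lambda>x. (1 / 2) *\<^sub>R (- I * x))" "bounded_linear (\<lambda>x. (1 / 2) *\<^sub>R (I * x))"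
      by (intro bounded_linear_intros)+
    from Ck_on_add[OF open_unit_disc Ck_on_linear[OF open_unit_disc this(1) Ck[OF I]]
        Ck_on_linear[OF open_unit_disc this(2) Ck[OF imag_units_uminus[OF I]]]]
    show ?thesis unfolding \<beta>_def by (simp add: algebra_simps)
  qed
  moreover have "(slice_CR J ^^ N) (\<lambda>p. \<alpha> p + J * \<beta> p) p = 0" if J: "J \<in> imag_units" and p: "p \<in> unit_disc" for J p
  proof -
    have eq: "\<alpha> q + J * \<beta> q = f (slice_pt J q)" if "q \<in> unit_disc" for q
      using slice_inducedD[OF ab J that] by simp
    have "(cr_op J ^^ N) (\<lambda>p. \<alpha> p + J * \<beta> p) p = (cr_op J ^^ N) (\<lambda>p. f (slice_pt J p)) p"
      by (rule cr_op_funpow_cong[OF open_unit_disc eq p])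
    then show ?thesis
      using pa[OF J] p unfolding polyanalytic_on_slice_iff[OF J] slice_CR_eq_cr_op by simp
  qed
  ultimately show "f \<in> slice_polyanalytic N"
    unfolding slice_polyanalytic_def using * ab
    by (intro CollectI conjI exI[of _ \<alpha>] exI[of _ \<beta>] ballI) simp_all
qed

section \<open>The kernel as a slice extension of the disc kernel\<close>

text \<open>
  If \<open>g\<close> is the restriction to the slice of \<open>J\<close> of a slice function that maps this slice to itself, then
  \<open>slice_even g\<close> and \<open>slice_odd g\<close> are, via \<open>slice_embed J\<close>, the stem functions \<open>\<alpha>\<close> and \<open>\<beta>\<close>
  of that slice function.
\<close>

definition slice_even :: "(complex \<Rightarrow> complex) \<Rightarrow> complex \<Rightarrow> complex" where
  "slice_even g z = (g z + g (cnj z)) / 2"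

definition slice_odd :: "(complex \<Rightarrow> complex) \<Rightarrow> complex \<Rightarrow> complex" where
  "slice_odd g z = (g z - g (cnj z)) / (2 * \<i>)"

definition slice_extends :: "quat \<Rightarrow> (quat \<Rightarrow> quat) \<Rightarrow> (complex \<Rightarrow> complex) \<Rightarrow> bool" where
  "slice_extends J f g \<longleftrightarrow> (\<forall>I\<in>imag_units. \<forall>z\<in>ball 0 1.
     f (slice_embed I z) = slice_embed J (slice_even g z) + I * slice_embed J (slice_odd g z))"

lemma slice_even_cnj: "slice_even g (cnj z) = slice_even g z"
  by (simp add: slice_even_def add.commute)

lemma slice_odd_cnj: "slice_odd g (cnj z) = - slice_odd g z"
  unfolding slice_odd_def minus_divide_left by simp

lemma slice_embed_scaleR: "slice_embed I (x *\<^sub>R z) = x *\<^sub>R slice_embed I z"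
  by (simp add: slice_embed_def algebra_simps)

lemma slice_extends_cong:
  assumes "slice_extends J f g" "\<And>z. z \<in> ball 0 1 \<Longrightarrow> g z = g' z"
    "\<And>q. q \<in> qball \<Longrightarrow> f q = f' q"
  shows "slice_extends J f' g'"
  unfolding slice_extends_def
proof (intro ballI)
  fix I z assume I: "I \<in> imag_units" and z: "z \<in> ball (0::complex) 1"
  have "slice_embed I z \<in> qball"
    using I z by (simp add: qball_def norm_slice_embed)
  moreover have "slice_even g z = slice_even g' z" "slice_odd g z = slice_odd g' z"
    using assms(2)[of z] assms(2)[of "cnj z"] z by (simp_all add: slice_even_def slice_odd_def)
  ultimately show "f' (slice_embed I z) = slice_embed J (slice_even g' z) + I * slice_embed J (slice_odd g' z)"
    using assms(1,3) I z unfolding slice_extends_def by metis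
qed

lemma slice_extends_induced:
  assumes "slice_extends J f g"
  shows "slice_induced f (\<lambda>p. slice_embed J (slice_even g (disc_point p))) (\<lambda>p. slice_embed J (slice_odd g (disc_point p)))"
  unfolding slice_induced_def
proof (intro conjI allI impI ballI)
  fix x y
  have c: "disc_point (x, - y) = cnj (disc_point (x, y))"
    by (simp add: disc_point_def complex_eq_iff)
  show "slice_embed J (slice_even g (disc_point (x, - y))) = slice_embed J (slice_even g (disc_point (x, y)))"
    by (simp add: c slice_even_cnj)
  show "slice_embed J (slice_odd g (disc_point (x, - y))) = - slice_embed J (slice_odd g (disc_point (x, y)))"
    by (simp add: c slice_odd_cnj slice_embed_minus)
next
  fix I p assume "I \<in> imag_units" "p \<in> unit_disc"
  moreover from this have "disc_point p \<in> ball 0 1" using disc_point_in_ball by blast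
  ultimately show "f (slice_pt I p) = slice_embed J (slice_even g (disc_point p)) + I * slice_embed J (slice_odd g (disc_point p))"
    using assms unfolding slice_extends_def slice_pt_eq_embed by blast
qed

text \<open>
  A quaternion with imaginary part \<open>v\<close> is \<open>x + I y\<close> with \<open>y = \<bar>v\<bar>\<close> and \<open>I = v / \<bar>v\<bar>\<close>, or with the opposite
  signs; the parity of the stem makes the choice irrelevant. For \<open>v = 0\<close> the odd part vanishes, which
  agrees with \<open>inverse 0 = 0\<close>.
\<close>

lemma ex_slice_extension:
  "\<exists>h. (\<forall>q. q \<notin> qball \<longrightarrow> h q = 0) \<and> slice_extends J h g"
proof -
  define im where "im q = q - of_real (qRe q)" for q :: quat
  define h where "h q = (if q \<in> qball then
     slice_embed J (slice_even g (Complex (qRe q) (norm (im q)))) +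
     inverse (norm (im q)) *\<^sub>R im q * slice_embed J (slice_odd g (Complex (qRe q) (norm (im q)))) else 0)" for q
  have "h (slice_embed I z) = slice_embed J (slice_even g z) + I * slice_embed J (slice_odd g z)"
    if I: "I \<in> imag_units" and z: "z \<in> ball 0 1" for I z
  proof -
    have in_ball: "slice_embed I z \<in> qball" using I z by (simp add: qball_def norm_slice_embed)
    have re: "qRe (slice_embed I z) = Re z" using I by (simp add: slice_embed_def imag_units_iff)
    have im: "im (slice_embed I z) = Im z *\<^sub>R I"
      by (simp add: im_def re) (simp add: slice_embed_def of_real_def)
    have nI: "norm I = 1" using norm_slice_embed[OF I, of \<i>] by (simp add: slice_embed_def)
    then have n: "norm (im (slice_embed I z)) = \<bar>Im z\<bar>" by (simp add: im nI)
    consider "Im z > 0" | "Im z = 0" | "Im z < 0" by linarith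
    then show ?thesis
    proof cases
      case 1
      then show ?thesis using in_ball by (simp add: h_def re im n nI)
    next
      case 2
      then have "cnj z = z" by (simp add: complex_eq_iff)
      then have "slice_odd g z = 0" by (simp add: slice_odd_def)
      moreover have "Complex (Re z) 0 = z" using 2 by (simp add: complex_eq_iff)
      ultimately show ?thesis using in_ball 2 by (simp add: h_def re im n nI slice_embed_0)
    next
      case 3
      have c: "Complex (Re z) (- Im z) = cnj z" by (simp add: complex_eq_iff)
      show ?thesis using in_ball 3 by (simp add: h_def re im n nI c slice_even_cnj slice_odd_cnj slice_embed_minus)
    qed
  qed
  then show ?thesis
    unfolding slice_extends_def by (intro exI[of _ h]) (auto simp: h_def)
qed

text \<open>
  With \<open>\<alpha> + \<i> \<beta> = g z\<close> and \<open>\<alpha> - \<i> \<beta> = g (cnj z)\<close>, the \<open>*\<close>-product formula is the multiplication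
  of these pairs componentwise.
\<close>

lemma slice_extends_star:
  assumes J: "J \<in> imag_units" and f: "slice_extends J f1 g1" "slice_extends J f2 g2"
  shows "slice_extends J (f1 \<star> f2) (\<lambda>z. g1 z * g2 z)" and "q \<notin> qball \<Longrightarrow> (f1 \<star> f2) q = 0"
proof -
  obtain h where h0: "\<forall>q. q \<notin> qball \<longrightarrow> h q = 0" and h: "slice_extends J h (\<lambda>z. g1 z * g2 z)"
    using ex_slice_extension by blast
  have "slice_even (\<lambda>z. g1 z * g2 z) z = slice_even g1 z * slice_even g2 z - slice_odd g1 z * slice_odd g2 z" for z
    by (simp add: slice_even_def slice_odd_def field_simps)
  moreover have "slice_odd (\<lambda>z. g1 z * g2 z) z = slice_even g1 z * slice_odd g2 z + slice_odd g1 z * slice_even g2 z" for z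
    by (simp add: slice_even_def slice_odd_def field_simps)
  ultimately have "f1 \<star> f2 = h"
    using slice_extends_induced[OF h] h0
    by (intro slice_star_eqI[OF slice_extends_induced[OF f(1)] slice_extends_induced[OF f(2)]])
       (simp_all add: slice_embed_diff slice_embed_add slice_embed_mult[OF J])
  with h0 h show "slice_extends J (f1 \<star> f2) (\<lambda>z. g1 z * g2 z)" "q \<notin> qball \<Longrightarrow> (f1 \<star> f2) q = 0"
    by auto
qed

text \<open>
  A function \<open>u\<close> that commutes with conjugation is the same on all slices, so multiplying it by a constant
  from the right gives the slice extension of its product with the constant. The building blocks of the
  kernel are sums of such functions.
\<close>

lemma slice_extends_intrinsic:
  assumes J: "J \<in> imag_units" and u: "\<And>z. u (cnj z) = cnj (u z)"
    and f: "\<And>I z. I \<in> imag_units \<Longrightarrow> z \<in> ball 0 1 \<Longrightarrow> f (slice_embed I z) = slice_embed I (u z) * slice_embed J c"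
  shows "slice_extends J f (\<lambda>z. u z * c)"
  unfolding slice_extends_def
proof (intro ballI)
  fix I z assume I: "I \<in> imag_units" and z: "z \<in> ball (0::complex) 1"
  have "slice_even (\<lambda>z. u z * c) z = (u z + cnj (u z)) * c / 2" "slice_odd (\<lambda>z. u z * c) z = (u z - cnj (u z)) * c / (2 * \<i>)"
    by (simp_all add: slice_even_def slice_odd_def u algebra_simps)
  then have "slice_even (\<lambda>z. u z * c) z = of_real (Re (u z)) * c" "slice_odd (\<lambda>z. u z * c) z = of_real (Im (u z)) * c"
    unfolding complex_add_cnj complex_diff_cnj by (simp_all add: field_simps)
  moreover have "slice_embed I (u z) = of_real (Re (u z)) + I * of_real (Im (u z))"
    by (simp add: slice_embed_def of_real_def)
  ultimately show "f (slice_embed I z) = slice_embed J (slice_even (\<lambda>z. u z * c) z) + I * slice_embed J (slice_odd (\<lambda>z. u z * c) z)"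
    using f[OF I z] by (simp add: slice_embed_mult[OF J] slice_embed_of_real distrib_right mult.assoc)
qed

lemma slice_extends_add:
  assumes "slice_extends J f1 g1" "slice_extends J f2 g2"
  shows "slice_extends J (\<lambda>q. f1 q + f2 q) (\<lambda>z. g1 z + g2 z)"
proof -
  have "slice_even (\<lambda>z. g1 z + g2 z) z = slice_even g1 z + slice_even g2 z"
    "slice_odd (\<lambda>z. g1 z + g2 z) z = slice_odd g1 z + slice_odd g2 z" for z
    by (simp_all add: slice_even_def slice_odd_def field_simps)
  with assms show ?thesis
    by (simp add: slice_extends_def slice_embed_add algebra_simps)
qed

lemma slice_extends_of_real_mult:
  assumes J: "J \<in> imag_units" and "slice_extends J f g"
  shows "slice_extends J (\<lambda>q. of_real x * f q) (\<lambda>z. of_real x * g z)"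
proof -
  have "slice_even (\<lambda>z. of_real x * g z) z = of_real x * slice_even g z"
    "slice_odd (\<lambda>z. of_real x * g z) z = of_real x * slice_odd g z" for z
    by (simp_all add: slice_even_def slice_odd_def field_simps)
  with assms show ?thesis
    by (simp add: slice_extends_def slice_embed_scaleR of_real_def algebra_simps)
qed

lemma slice_extends_zero: "slice_extends J (\<lambda>_. 0) (\<lambda>_. 0)"
  by (simp add: slice_extends_def slice_even_def slice_odd_def slice_embed_0)

lemma slice_extends_sum:
  "(\<And>k. k \<in> A \<Longrightarrow> slice_extends J (f k) (g k)) \<Longrightarrow> slice_extends J (\<lambda>q. \<Sum>k\<in>A. f k q) (\<lambda>z. \<Sum>k\<in>A. g k z)"
  by (induction A rule: infinite_finite_induct) (simp_all add: slice_extends_zero slice_extends_add)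

lemma slice_extends_mult_right:
  assumes J: "J \<in> imag_units" and f: "slice_extends J f g" and m: "\<And>z. m (cnj z) = m z"
    and h: "\<And>I z. I \<in> imag_units \<Longrightarrow> z \<in> ball 0 1 \<Longrightarrow> h (slice_embed I z) = slice_embed J (m z)"
  shows "slice_extends J (\<lambda>q. f q * h q) (\<lambda>z. g z * m z)"
proof -
  have "slice_even (\<lambda>z. g z * m z) z = slice_even g z * m z"
    "slice_odd (\<lambda>z. g z * m z) z = slice_odd g z * m z" for z
    by (simp_all add: slice_even_def slice_odd_def m field_simps)
  with f h show ?thesis
    by (simp add: slice_extends_def slice_embed_mult[OF J] distrib_right mult.assoc)
qed

lemma slice_extends_star_power:
  assumes J: "J \<in> imag_units" and f: "slice_extends J f g"
  shows "slice_extends J (slice_star_power f k) (\<lambda>z. g z ^ k)"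
proof (induction k)
  case 0
  have "slice_extends J (\<lambda>q. if q \<in> qball then 1 else 0) (\<lambda>z. 1 * 1)"
    by (rule slice_extends_intrinsic[OF J]) (simp_all add: qball_def norm_slice_embed slice_embed_1)
  then show ?case by simp
next
  case (Suc k)
  from slice_extends_star(1)[OF J f this] show ?case by simp
qed

text \<open>
  The sum in \<open>kernel_P\<close> extends \<open>(1 - cnj z * cnj w) ^ (2 * N)\<close> by the binomial theorem, and the base
  in \<open>kernel_Q\<close> is \<open>(1 - z * cnj w) * (1 - cnj z * cnj w)\<close>, which is unchanged when \<open>z\<close> is conjugated.
  Therefore the pointwise product is still a slice function, and one factor cancels.
\<close>

lemma slice_extends_kernel:
  assumes N: "N \<ge> 1" and J: "J \<in> imag_units" and w: "norm w < 1"
  shows "slice_extends J (\<lambda>q. slice_bergman_kernel N q (slice_embed J w)) (\<lambda>z. disc_kernel N z w)"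
    and "q \<notin> qball \<Longrightarrow> slice_bergman_kernel N q (slice_embed J w) = 0"
proof -
  define r where "r = slice_embed J w"
  have cr: "qcnj r = slice_embed J (cnj w)" by (simp add: r_def qcnj_slice_embed[OF J])
  note hom = slice_embed_add slice_embed_diff slice_embed_of_real slice_embed_1 slice_embed_sum
  define m where "m z = inverse ((1 - of_real (2 * Re z) * cnj w + of_real ((norm z)\<^sup>2) * (cnj w)\<^sup>2) ^ (2 * N))" for z
  have m_eq: "m z = inverse ((1 - z * cnj w) ^ (2 * N)) * inverse ((1 - cnj z * cnj w) ^ (2 * N))" for z
  proof -
    have "(1 - z * cnj w) * (1 - cnj z * cnj w) = 1 - (z + cnj z) * cnj w + (z * cnj z) * (cnj w)\<^sup>2"
      by (simp add: algebra_simps power2_eq_square)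
    also have "\<dots> = 1 - of_real (2 * Re z) * cnj w + of_real ((norm z)\<^sup>2) * (cnj w)\<^sup>2"
      by (simp only: complex_add_cnj complex_norm_square)
    finally have e: "(1 - z * cnj w) * (1 - cnj z * cnj w) = \<dots>" .
    show ?thesis
      unfolding m_def e[symmetric] power_mult_distrib by (rule inverse_mult_distrib)
  qed
  have Q: "kernel_Q N (slice_embed I z) r = slice_embed J (m z)" if I: "I \<in> imag_units" for I z
  proof -
    have re: "qRe (slice_embed I z) = Re z" using I by (simp add: slice_embed_def imag_units_iff)
    have "kernel_Q N (slice_embed I z) r = slice_embed J (1 - of_real (2 * Re z) * cnj w + of_real ((norm z)\<^sup>2) * (cnj w)\<^sup>2) powi - (2 * int N)"
      unfolding kernel_Q_def re cr norm_slice_embed[OF I]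
      by (simp only: hom slice_embed_mult[OF J] slice_embed_power[OF J])
    also have "\<dots> = slice_embed J (m z)"
      using N by (simp add: power_int_def nat_mult_distrib power_inverse m_def slice_embed_inverse[OF J] slice_embed_power[OF J])
    finally show ?thesis .
  qed
  have P: "slice_extends J (\<lambda>q. kernel_P N q r)
     (\<lambda>z. of_real (real N / pi) * (\<Sum>k = 0..2 * N. (of_real ((- 1) ^ k * of_nat ((2 * N) choose k)) * cnj z ^ k) * cnj w ^ k))"
    unfolding kernel_P_def
  proof (intro slice_extends_of_real_mult[OF J] slice_extends_sum)
    fix k
    have "(- 1) ^ k * of_nat ((2 * N) choose k) = (of_real ((- 1) ^ k * of_nat ((2 * N) choose k)) :: quat)"
      by simp
    then show "slice_extends J (\<lambda>q. (- 1) ^ k * of_nat ((2 * N) choose k) * qcnj q ^ k * qcnj r ^ k)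
       (\<lambda>z. (of_real ((- 1) ^ k * of_nat ((2 * N) choose k)) * cnj z ^ k) * cnj w ^ k)"
      by (intro slice_extends_intrinsic[OF J])
         (simp_all only: cr qcnj_slice_embed slice_embed_mult slice_embed_of_real slice_embed_power[OF J] slice_embed_power
           complex_cnj_mult complex_cnj_power complex_cnj_complex_of_real)
  qed
  have PQ: "slice_extends J (\<lambda>q. kernel_P N q r * kernel_Q N q r)
     (\<lambda>z. (of_real (real N / pi) * (\<Sum>k = 0..2 * N. (of_real ((- 1) ^ k * of_nat ((2 * N) choose k)) * cnj z ^ k) * cnj w ^ k)) * m z)"
  proof (rule slice_extends_mult_right[OF J P])
    show "m (cnj z) = m z" for z by (simp add: m_def)
  qed (use Q in auto)
  have one: "slice_extends J (\<lambda>_. 1) (\<lambda>z. 1 * 1)"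
    by (rule slice_extends_intrinsic[OF J]) (simp_all add: slice_embed_1)
  have qc_r: "slice_extends J (\<lambda>q. - (qcnj q * r)) (\<lambda>z. (- cnj z) * w)"
    by (rule slice_extends_intrinsic[OF J]) (simp_all add: r_def qcnj_slice_embed slice_embed_minus)
  have q_rc: "slice_extends J (\<lambda>q. - (q * qcnj r)) (\<lambda>z. (- z) * cnj w)"
    by (rule slice_extends_intrinsic[OF J]) (simp_all add: cr slice_embed_minus)
  have qq_rr: "slice_extends J (\<lambda>q. qcnj q * q * qcnj r * r) (\<lambda>z. (cnj z * z) * (cnj w * w))"
    by (rule slice_extends_intrinsic[OF J])
       (simp_all add: r_def qcnj_slice_embed slice_embed_mult J mult.assoc)
  have qq: "slice_extends J (\<lambda>q. qcnj q * q) (\<lambda>z. (cnj z * z) * 1)"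
    by (rule slice_extends_intrinsic[OF J])
       (simp_all add: qcnj_slice_embed slice_embed_mult slice_embed_1)
  have rr: "slice_extends J (\<lambda>q. qcnj r * r) (\<lambda>z. 1 * (cnj w * w))"
    by (rule slice_extends_intrinsic[OF J]) (simp_all add: r_def qcnj_slice_embed slice_embed_mult J slice_embed_1)
  define A where "A z = (1 - cnj z * w) * (1 - z * cnj w)" for z
  define B where "B z = (z - w) * cnj (z - w)" for z
  have fA: "slice_extends J (\<lambda>q. 1 - qcnj q * r - q * qcnj r + qcnj q * q * qcnj r * r) A"
    by (rule slice_extends_cong[OF slice_extends_add[OF slice_extends_add[OF slice_extends_add[OF one qc_r] q_rc] qq_rr]])
       (simp_all add: A_def algebra_simps)
  have fB: "slice_extends J (\<lambda>q. qcnj q * q - q * qcnj r - qcnj q * r + qcnj r * r) B"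
    by (rule slice_extends_cong[OF slice_extends_add[OF slice_extends_add[OF slice_extends_add[OF qq q_rc] qc_r] rr]])
       (simp_all add: B_def algebra_simps)
  have Psi: "slice_extends J (\<lambda>q. kernel_\<psi> N q r) (\<lambda>z. \<Sum>k = 0..N - 1. of_real (radial_coeff N k) * (A z ^ (N - 1 - k) * B z ^ k))"
    unfolding kernel_\<psi>_def
  proof (rule slice_extends_sum)
    fix k
    have "(- 1) ^ k * of_nat (N choose (k + 1)) * of_nat ((N + k) choose N) = (of_real (radial_coeff N k) :: quat)"
      by (simp add: radial_coeff_def)
    then show "slice_extends J (\<lambda>q. (- 1) ^ k * of_nat (N choose (k + 1)) * of_nat ((N + k) choose N) *
      (slice_star_power (\<lambda>q. 1 - qcnj q * r - q * qcnj r + qcnj q * q * qcnj r * r) (N - 1 - k) \<star>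
       slice_star_power (\<lambda>q. qcnj q * q - q * qcnj r - qcnj q * r + qcnj r * r) k) q)
      (\<lambda>z. of_real (radial_coeff N k) * (A z ^ (N - 1 - k) * B z ^ k))"
      by (simp only:) (intro slice_extends_of_real_mult slice_extends_star(1) slice_extends_star_power J fA fB)
  qed
  have g_eq: "(of_real (real N / pi) * (\<Sum>k = 0..2 * N. (of_real ((- 1) ^ k * of_nat ((2 * N) choose k)) * cnj z ^ k) * cnj w ^ k)) * m z
     * (\<Sum>k = 0..N - 1. of_real (radial_coeff N k) * (A z ^ (N - 1 - k) * B z ^ k)) = disc_kernel N z w"
    if z: "z \<in> ball 0 1" for z
  proof -
    have nz: "(1 - cnj z * cnj w) ^ (2 * N) \<noteq> 0"
      using one_minus_mult_cnj_nonzero(1)[of "cnj z" w] z w by simp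
    have "(\<Sum>k = 0..2 * N. (of_real ((- 1) ^ k * of_nat ((2 * N) choose k)) * cnj z ^ k) * cnj w ^ k)
        = (\<Sum>k\<le>2 * N. of_nat ((2 * N) choose k) * (- (cnj z * cnj w)) ^ k * 1 ^ (2 * N - k))"
      by (intro sum.cong) (auto simp: power_mult_distrib power_minus[of "cnj z * cnj w"])
    also have "\<dots> = (1 - cnj z * cnj w) ^ (2 * N)"
      by (subst binomial_ring[symmetric]) simp
    finally have 1: "(\<Sum>k = 0..2 * N. (of_real ((- 1) ^ k * of_nat ((2 * N) choose k)) * cnj z ^ k) * cnj w ^ k) * m z
        = inverse ((1 - z * cnj w) ^ (2 * N))"
      using nz by (simp add: m_eq)
    have "{0..N - 1} = {..<N}" using N by auto
    then show ?thesis
      using 1 unfolding disc_kernel_def A_def[symmetric] B_def[symmetric]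
      by (simp only: mult.assoc)
  qed
  note star = slice_extends_star[OF J PQ Psi]
  show "slice_extends J (\<lambda>q. slice_bergman_kernel N q (slice_embed J w)) (\<lambda>z. disc_kernel N z w)"
    unfolding slice_bergman_kernel_def r_def[symmetric]
    by (rule slice_extends_cong[OF star(1)]) (use g_eq in auto)
  show "slice_bergman_kernel N q (slice_embed J w) = 0" if "q \<notin> qball"
    unfolding slice_bergman_kernel_def r_def[symmetric] by (rule star(2)[OF that])
qed

text \<open>
  The real coefficients of the kernel make it behave like a right slice function of the conjugated second
  variable, which gives a representation formula in that variable too.
\<close>

lemma kernel_on_slice:
  assumes N: "N \<ge> 1" and I: "I \<in> imag_units" and J: "J \<in> imag_units" and z: "norm z < 1" and w: "norm w < 1"
  shows "slice_bergman_kernel N (slice_embed I z) (slice_embed J w)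
     = slice_embed I (disc_kernel N z w) * qcnj (slice_projection J I)
       + slice_embed I (disc_kernel N z (cnj w)) * qcnj (slice_projection J (- I))"
proof -
  define a where "a = disc_kernel N z w"
  define b where "b = disc_kernel N z (cnj w)"
  have b': "disc_kernel N (cnj z) w = cnj b"
    using disc_kernel_cnj[of N z "cnj w"] by (simp add: b_def)
  have e: "slice_even (\<lambda>z. disc_kernel N z w) z = (a + cnj b) / 2"
     "slice_odd (\<lambda>z. disc_kernel N z w) z = (a - cnj b) / (2 * \<i>)"
    by (simp_all add: slice_even_def slice_odd_def a_def b')
  have "slice_bergman_kernel N (slice_embed I z) (slice_embed J w)
     = slice_embed J (slice_even (\<lambda>z. disc_kernel N z w) z) + I * slice_embed J (slice_odd (\<lambda>z. disc_kernel N z w) z)"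
    using slice_extends_kernel(1)[OF N J w] I z by (simp add: slice_extends_def)
  also have "\<dots> = slice_embed J ((a + cnj b) / 2) + I * slice_embed J ((a - cnj b) / (2 * \<i>))"
    unfolding e ..
  also have "\<dots> = slice_embed I a * ((1 / 2) *\<^sub>R (1 - I * J)) + slice_embed I b * ((1 / 2) *\<^sub>R (1 + I * J))"
  proof -
    have II: "I * (I * x) = - x" for x
      using imag_units_mult_self[OF I] by (simp flip: mult.assoc)
    have r: "Re ((a - cnj b) / (2 * \<i>)) = (Im a + Im b) / 2" "Im ((a - cnj b) / (2 * \<i>)) = (Re b - Re a) / 2"
      by (simp_all add: Re_divide Im_divide power2_eq_square field_simps)
    show ?thesis
      unfolding slice_embed_def r
      by (simp add: algebra_simps II add_divide_distrib diff_divide_distrib)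
  qed
  also have "(1 / 2) *\<^sub>R (1 - I * J) = qcnj (slice_projection J I)"
    using I J by (simp add: slice_projection_def qcnj_simps qcnj_imag_unit)
  also have "(1 / 2) *\<^sub>R (1 + I * J) = qcnj (slice_projection J (- I))"
    using I J by (simp add: slice_projection_def qcnj_simps qcnj_imag_unit)
  finally show ?thesis unfolding a_def b_def .
qed

section \<open>The slice Bergman space\<close>

text \<open>
  Integrals over a slice are taken in real coordinates, those of the disc kernel in the complex plane.
\<close>

lemma lborel_complex_eq_distr_disc_point: "lborel = distr lborel borel disc_point"
proof (rule lborel_eqI)
  have dp [measurable]: "disc_point \<in> borel \<rightarrow>\<^sub>M borel"
    unfolding disc_point_def[abs_def] Complex_eq
    by (intro borel_measurable_continuous_onI continuous_intros)
  fix l u :: complex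
  assume le: "\<And>b. b \<in> Basis \<Longrightarrow> l \<bullet> b \<le> u \<bullet> b"
  have vim: "disc_point -` box l u = box (Re l, Im l) (Re u, Im u)"
  proof -
    have "(a, b) \<in> box (Re l, Im l) (Re u, Im u) \<longleftrightarrow> Re l < a \<and> a < Re u \<and> Im l < b \<and> b < Im u" for a b
      by (auto simp: box_def Basis_prod_def)
    then show ?thesis
      by (auto simp: in_box_complex_iff disc_point_def)
  qed
  have "emeasure (distr lborel borel disc_point) (box l u)
     = emeasure lborel (box (Re l, Im l) (Re u, Im u))"
    by (subst emeasure_distr) (auto simp: vim)
  also have "\<dots> = (\<Prod>b\<in>Basis. ((Re u, Im u) - (Re l, Im l)) \<bullet> b)"
    by (rule emeasure_lborel_box)
       (use le[of 1] le[of \<i>] in \<open>auto simp: Basis_prod_def Basis_complex_def\<close>)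
  also have "(\<Prod>b\<in>Basis. ((Re u, Im u) - (Re l, Im l)) \<bullet> b) = (\<Prod>b\<in>Basis. (u - l) \<bullet> b)"
    by (simp add: Basis_prod_def Basis_complex_def)
  finally show "emeasure (distr lborel borel disc_point) (box l u) = (\<Prod>b\<in>Basis. (u - l) \<bullet> b)" .
qed simp

lemma set_integral_disc_coordinates:
  fixes g :: "complex \<Rightarrow> complex"
  assumes cont: "continuous_on (ball 0 1) g"
  shows "set_integrable lborel (ball 0 1) g \<longleftrightarrow> set_integrable lborel unit_disc (\<lambda>p. g (disc_point p))"
    and "(LINT z:ball 0 1|lborel. g z) = (LINT p:unit_disc|lborel. g (disc_point p))"
proof -
  have dp [measurable]: "disc_point \<in> borel \<rightarrow>\<^sub>M borel"
    unfolding disc_point_def[abs_def] Complex_eq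
    by (intro borel_measurable_continuous_onI continuous_intros)
  define G where "G = (\<lambda>z. indicat_real (ball 0 1) z *\<^sub>R g z)"
  have G [measurable]: "G \<in> borel_measurable borel"
    unfolding G_def by (rule borel_measurable_continuous_on_indicator[OF _ cont]) auto
  have ind: "G (disc_point p) = indicat_real unit_disc p *\<^sub>R g (disc_point p)" for p
    using disc_point_in_ball[of p] by (simp add: G_def indicator_def)
  show "set_integrable lborel (ball 0 1) g \<longleftrightarrow> set_integrable lborel unit_disc (\<lambda>p. g (disc_point p))"
    unfolding set_integrable_def G_def[symmetric] ind[symmetric]
    by (subst lborel_complex_eq_distr_disc_point, subst integrable_distr_eq) auto
  show "(LINT z:ball 0 1|lborel. g z) = (LINT p:unit_disc|lborel. g (disc_point p))"
    unfolding set_lebesgue_integral_def G_def[symmetric] ind[symmetric]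
    by (subst lborel_complex_eq_distr_disc_point, subst integral_distr) auto
qed

lemma borel_unit_disc: "unit_disc \<in> sets borel"
  using open_unit_disc by auto

lemma emeasure_unit_disc_finite: "emeasure lborel unit_disc < \<infinity>"
proof -
  have "bounded unit_disc"
    unfolding bounded_iff
  proof (intro exI[of _ 1] ballI)
    fix p assume "p \<in> unit_disc"
    then show "norm p \<le> 1"
      by (cases p) (simp add: unit_disc_def norm_Pair)
  qed
  then show ?thesis by (rule emeasure_bounded_finite)
qed

abbreviation disc_integrable :: "(real \<times> real \<Rightarrow> 'a::{banach, second_countable_topology}) \<Rightarrow> bool" where
  "disc_integrable \<equiv> set_integrable lborel unit_disc"

lemma set_integrable_const_unit_disc: "disc_integrable (\<lambda>_. c :: 'a::{banach, second_countable_topology})"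
  unfolding set_integrable_def
  by (intro integrable_scaleR_left) (use emeasure_unit_disc_finite borel_unit_disc in \<open>auto simp: integrable_indicator_iff\<close>)

lemma set_integrable_unit_disc_bound:
  fixes f :: "real \<times> real \<Rightarrow> 'a::euclidean_space" and g :: "real \<times> real \<Rightarrow> real"
  assumes "disc_integrable g" "continuous_on unit_disc f"
    and "\<And>p. p \<in> unit_disc \<Longrightarrow> norm (f p) \<le> g p"
  shows "disc_integrable f"
proof (rule set_integrable_bound[OF assms(1)])
  show "set_borel_measurable lborel unit_disc f"
    unfolding set_borel_measurable_def
    using borel_measurable_continuous_on_indicator[OF borel_unit_disc assms(2)] by simp
  show "AE x in lborel. x \<in> unit_disc \<longrightarrow> norm (f x) \<le> norm (g x)"
    using assms(3) by (intro AE_I2) (force intro: order_trans[OF _ abs_ge_self])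
qed

definition slice_sq_norm :: "quat \<Rightarrow> (quat \<Rightarrow> quat) \<Rightarrow> real" where
  "slice_sq_norm I f = (LINT p:unit_disc|lborel. (norm (f (slice_pt I p)))\<^sup>2)"

lemma set_nn_integral_iff_integrable:
  fixes h :: "real \<times> real \<Rightarrow> real"
  assumes cont: "continuous_on unit_disc h" and h: "\<And>p. h p \<ge> 0"
  shows "(\<integral>\<^sup>+ p \<in> unit_disc. ennreal (h p) \<partial>lborel) < \<infinity> \<longleftrightarrow> disc_integrable h"
    and "disc_integrable h \<Longrightarrow>
      (\<integral>\<^sup>+ p \<in> unit_disc. ennreal (h p) \<partial>lborel) = ennreal (LINT p:unit_disc|lborel. h p)"
proof -
  have m: "(\<lambda>p. indicat_real unit_disc p *\<^sub>R h p) \<in> borel_measurable lborel"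
    using borel_measurable_continuous_on_indicator[OF borel_unit_disc cont] by simp
  have e: "ennreal (norm (indicat_real unit_disc p *\<^sub>R h p)) = ennreal (h p) * indicator unit_disc p"
     "ennreal (indicat_real unit_disc p *\<^sub>R h p) = ennreal (h p) * indicator unit_disc p" for p
    using h[of p] by (simp_all split: split_indicator)
  show "(\<integral>\<^sup>+ p \<in> unit_disc. ennreal (h p) \<partial>lborel) < \<infinity> \<longleftrightarrow> disc_integrable h"
    unfolding set_integrable_def integrable_iff_bounded e using m by simp
  show "(\<integral>\<^sup>+ p \<in> unit_disc. ennreal (h p) \<partial>lborel) = ennreal (LINT p:unit_disc|lborel. h p)"
    if "disc_integrable h"
    using nn_integral_eq_integral[OF that[unfolded set_integrable_def]] h
    unfolding e set_lebesgue_integral_def by simp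
qed

lemma slice_bergman_space_iff:
  assumes I: "I \<in> imag_units"
  shows "f \<in> slice_bergman_space N I \<longleftrightarrow>
    (\<forall>q. q \<notin> qball \<longrightarrow> f q = 0) \<and> slice_representation I f \<and> polyanalytic_on_slice N I f \<and>
    disc_integrable (\<lambda>p. (norm (f (slice_pt I p)))\<^sup>2)"
proof -
  have "continuous_on unit_disc (\<lambda>p. (norm (f (slice_pt I p)))\<^sup>2)" if "polyanalytic_on_slice N I f"
    using Ck_on_imp_continuous_on[OF polyanalytic_on_slice_imp_Ck_on[OF that]] by (intro continuous_intros)
  then show ?thesis
    unfolding slice_bergman_space_def slice_polyanalytic_iff[OF I]
    using set_nn_integral_iff_integrable(1)[of "\<lambda>p. (norm (f (slice_pt I p)))\<^sup>2"] by auto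
qed

lemma norm_qcnj: "norm (qcnj x) = norm x"
  by (simp add: norm_quat_def)

lemma slice_representation_add:
  "slice_representation I f \<Longrightarrow> slice_representation I g \<Longrightarrow> slice_representation I (\<lambda>q. f q + g q)"
  by (simp add: slice_representation_def distrib_left)

lemma slice_representation_mult_const:
  "slice_representation I f \<Longrightarrow> slice_representation I (\<lambda>q. f q * a)"
  by (simp add: slice_representation_def distrib_right mult.assoc)

lemma polyanalytic_on_slice_add:
  assumes "polyanalytic_on_slice N I f" "polyanalytic_on_slice N I g"
  shows "polyanalytic_on_slice N I (\<lambda>q. f q + g q)"
proof -
  have "slice_coord I c (x + y) = slice_coord I c x + slice_coord I c y" for c x y
    using linear_add[OF bounded_linear.linear[OF bounded_linear_slice_coord]] .
  with assms show ?thesis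
    by (simp add: polyanalytic_on_slice_def polyanalytic_disc_add)
qed

lemma polyanalytic_on_slice_mult_const:
  assumes "polyanalytic_on_slice N I f"
  shows "polyanalytic_on_slice N I (\<lambda>q. f q * a)"
proof -
  have "slice_coord I c (x * a) = slice_coord I (a * c) x" for c x
    by (simp only: slice_coord_def mult.assoc)
  with assms show ?thesis by (simp add: polyanalytic_on_slice_def)
qed

lemma slice_sq_norm_nonneg: "0 \<le> slice_sq_norm I f"
  unfolding slice_sq_norm_def set_lebesgue_integral_def by (intro integral_nonneg_AE AE_I2) simp

lemma bergman_inner_self: "slice_bergman_inner I f f = of_real (slice_sq_norm I f)"
proof -
  have q: "qcnj q * q = of_real ((norm q)\<^sup>2)" for q
    by (simp add: quat_mult_qcnj(2) norm_quat_def of_real_def)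
  have T: "bounded_linear (of_real :: real \<Rightarrow> quat)"
    by (rule bounded_linear_of_real)
  have T': "bounded_linear qRe"
    by (rule linear_conv_bounded_linear[THEN iffD1], rule linearI) simp_all
  have "(LINT p|lborel. of_real (indicat_real unit_disc p *\<^sub>R (norm (f (slice_pt I p)))\<^sup>2))
      = (of_real (LINT p|lborel. indicat_real unit_disc p *\<^sub>R (norm (f (slice_pt I p)))\<^sup>2) :: quat)"
    by (rule integral_bounded_linear'[OF T T']) simp
  then show ?thesis
    unfolding slice_bergman_inner_def slice_sq_norm_def set_lebesgue_integral_def q
    by (simp only: of_real_def scaleR_scaleR real_scaleR_def)
qed

lemma qcnj_bounded_linear: "bounded_linear qcnj"
  by (rule linear_conv_bounded_linear[THEN iffD1], rule linearI) (simp_all add: qcnj_simps)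

lemma norm_slice_projection:
  assumes "K \<in> imag_units" "J \<in> imag_units"
  shows "norm (slice_projection J K) \<le> 1"
proof -
  have "norm K = 1" if "K \<in> imag_units" for K
    using norm_slice_embed[OF that, of \<i>] by (simp add: slice_embed_def)
  then have "norm (1 - J * K) \<le> 2"
    using norm_triangle_ineq4[of 1 "J * K"] assms by (simp add: norm_mult)
  then show ?thesis by (simp add: slice_projection_def)
qed

lemma slice_embed_cases:
  obtains J w where "J \<in> imag_units" "q = slice_embed J w" "norm w = norm q"
proof -
  obtain J p where "J \<in> imag_units" "q = slice_pt J p" using ex_slice_pt by blast
  then show ?thesis
    using that[of J "disc_point p"] by (simp add: slice_pt_eq_embed norm_slice_embed)
qed

context
  fixes N :: nat and I :: quat
  assumes N: "N \<ge> 1" and I: "I \<in> imag_units"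
begin

abbreviation bergman :: "(quat \<Rightarrow> quat) set" where
  "bergman \<equiv> slice_bergman_space N I"

abbreviation bergman_norm :: "(quat \<Rightarrow> quat) \<Rightarrow> real" where
  "bergman_norm \<equiv> ip_norm (slice_bergman_inner I)"

lemma bergman_continuous:
  "f \<in> bergman \<Longrightarrow> continuous_on unit_disc (\<lambda>p. f (slice_pt I p))"
  unfolding slice_bergman_space_iff[OF I]
  using Ck_on_imp_continuous_on[OF polyanalytic_on_slice_imp_Ck_on] by blast

lemma bergman_sq_integrable:
  "f \<in> bergman \<Longrightarrow> disc_integrable (\<lambda>p. (norm (f (slice_pt I p)))\<^sup>2)"
  by (simp add: slice_bergman_space_iff[OF I])

lemma bergman_combination_sq_integrable:
  assumes "f \<in> bergman" "g \<in> bergman"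
  shows "disc_integrable (\<lambda>p. 2 * (norm (f (slice_pt I p)))\<^sup>2 + 2 * (norm (g (slice_pt I p)))\<^sup>2)"
  using assms[THEN bergman_sq_integrable] by (intro set_integral_add) auto

lemma bergman_mult_integrable:
  assumes f: "f \<in> bergman" and g: "g \<in> bergman"
  shows "disc_integrable (\<lambda>p. qcnj (g (slice_pt I p)) * f (slice_pt I p))"
proof (rule set_integrable_unit_disc_bound[OF bergman_combination_sq_integrable[OF f g]])
  have "continuous_on unit_disc (\<lambda>p. qcnj (g (slice_pt I p)))"
    by (rule bounded_linear.continuous_on[OF qcnj_bounded_linear bergman_continuous[OF g]])
  then show "continuous_on unit_disc (\<lambda>p. qcnj (g (slice_pt I p)) * f (slice_pt I p))"
    by (intro continuous_intros bergman_continuous[OF f])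
next
  fix p
  define a b where "a = norm (f (slice_pt I p))" and "b = norm (g (slice_pt I p))"
  have "norm (qcnj (g (slice_pt I p)) * f (slice_pt I p)) = b * a"
    by (simp add: norm_mult norm_qcnj a_def b_def)
  also have "\<dots> \<le> 2 * a\<^sup>2 + 2 * b\<^sup>2"
  proof -
    have "2 * a * b \<le> a\<^sup>2 + b\<^sup>2" "0 \<le> a * b" "b * a = a * b"
      by (rule sum_squares_bound, simp add: a_def b_def, rule mult.commute)
    then show ?thesis using zero_le_power2[of a] zero_le_power2[of b] by linarith
  qed
  finally show "norm (qcnj (g (slice_pt I p)) * f (slice_pt I p)) \<le> 2 * (norm (f (slice_pt I p)))\<^sup>2 + 2 * (norm (g (slice_pt I p)))\<^sup>2"
    by (simp add: a_def b_def)
qed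

lemma bergman_norm_sq: "(bergman_norm f)\<^sup>2 = slice_sq_norm I f"
  by (simp add: ip_norm_def bergman_inner_self slice_sq_norm_nonneg)

lemma bergman_norm_nonneg: "0 \<le> bergman_norm f"
  by (simp add: ip_norm_def bergman_inner_self slice_sq_norm_nonneg)

lemma bergman_add:
  assumes f: "f \<in> bergman" and g: "g \<in> bergman"
  shows "(\<lambda>q. f q + g q) \<in> bergman"
proof -
  have "disc_integrable (\<lambda>p. (norm (f (slice_pt I p) + g (slice_pt I p)))\<^sup>2)"
  proof (rule set_integrable_unit_disc_bound[OF bergman_combination_sq_integrable[OF f g]])
    show "continuous_on unit_disc (\<lambda>p. (norm (f (slice_pt I p) + g (slice_pt I p)))\<^sup>2)"
      by (intro continuous_intros bergman_continuous f g)
    fix p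
    define a b where "a = norm (f (slice_pt I p))" and "b = norm (g (slice_pt I p))"
    have "(norm (f (slice_pt I p) + g (slice_pt I p)))\<^sup>2 \<le> (a + b)\<^sup>2"
      unfolding a_def b_def by (intro power_mono norm_triangle_ineq) simp
    also have "\<dots> \<le> 2 * a\<^sup>2 + 2 * b\<^sup>2"
      using sum_squares_bound[of a b] by (simp add: power2_sum)
    finally show "norm ((norm (f (slice_pt I p) + g (slice_pt I p)))\<^sup>2) \<le> 2 * (norm (f (slice_pt I p)))\<^sup>2 + 2 * (norm (g (slice_pt I p)))\<^sup>2"
      by (simp add: a_def b_def)
  qed
  with f g show ?thesis
    unfolding slice_bergman_space_iff[OF I]
    using slice_representation_add polyanalytic_on_slice_add by auto
qed

lemma bergman_mult_const:
  assumes f: "f \<in> bergman"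
  shows "(\<lambda>q. f q * a) \<in> bergman"
proof -
  have "disc_integrable (\<lambda>p. (norm (f (slice_pt I p) * a))\<^sup>2)"
    using bergman_sq_integrable[OF f] by (simp add: norm_mult power_mult_distrib)
  with f show ?thesis
    unfolding slice_bergman_space_iff[OF I]
    using slice_representation_mult_const polyanalytic_on_slice_mult_const by auto
qed

lemma bergman_diff:
  assumes f: "f \<in> bergman" and g: "g \<in> bergman"
  shows "(\<lambda>q. f q - g q) \<in> bergman"
  using bergman_add[OF f bergman_mult_const[OF g, of "- 1"]] by simp

lemma bergman_zero: "(\<lambda>_. 0) \<in> bergman"
proof -
  have "slice_coord I c 0 = 0" for c by (simp add: slice_coord_def complex_eq_iff)
  then show ?thesis
    by (simp add: slice_bergman_space_iff[OF I] slice_representation_def polyanalytic_on_slice_def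
        polyanalytic_disc_zero set_integrable_def)
qed

text \<open>
  To compare the two norms, integrate \<open>x \<le> t + x\<^sup>2 / t\<close>
  with \<open>x = \<bar>f\<bar>\<close> and take for \<open>t\<close> the norm of \<open>f\<close>, or let \<open>t\<close> tend to \<open>0\<close> if that norm is \<open>0\<close>.
\<close>

lemma bergman_integrable:
  assumes f: "f \<in> bergman"
  shows "disc_integrable (\<lambda>p. f (slice_pt I p))"
    and "(LINT p:unit_disc|lborel. norm (f (slice_pt I p)))
      \<le> (measure lborel unit_disc + 1) * bergman_norm f"
proof -
  define n where "n = bergman_norm f"
  define m where "m = measure lborel unit_disc"
  define a where "a = (LINT p:unit_disc|lborel. norm (f (slice_pt I p)))"
  have AM_GM: "x \<le> t + x\<^sup>2 / t" if "t > 0" "x \<ge> 0" for x t :: real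
  proof (cases "x \<le> t")
    case False
    then have "x * t \<le> x\<^sup>2" using that by (simp add: power2_eq_square)
    then have "x \<le> x\<^sup>2 / t" using that by (simp add: field_simps)
    then show ?thesis using that by simp
  next
    case True
    have "x\<^sup>2 / t \<ge> 0" using that by simp
    with True show ?thesis by linarith
  qed
  have int: "disc_integrable (\<lambda>p. t + (norm (f (slice_pt I p)))\<^sup>2 / t)" for t
    using bergman_sq_integrable[OF f] by (intro set_integral_add set_integrable_const_unit_disc) auto
  show 1: "disc_integrable (\<lambda>p. f (slice_pt I p))"
    by (rule set_integrable_unit_disc_bound[OF int[of 1] bergman_continuous[OF f]])
       (use AM_GM[of 1] in auto)
  have a_le: "a \<le> t * m + n\<^sup>2 / t" if "t > 0" for t
  proof -
    have "a \<le> (LINT p:unit_disc|lborel. t + (norm (f (slice_pt I p)))\<^sup>2 / t)"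
      unfolding a_def
      by (rule set_integral_mono[OF set_integrable_norm[OF 1] int]) (use AM_GM that in auto)
    also have "\<dots> = (LINT p:unit_disc|lborel. t) + (LINT p:unit_disc|lborel. (norm (f (slice_pt I p)))\<^sup>2 / t)"
      using bergman_sq_integrable[OF f] by (intro set_integral_add set_integrable_const_unit_disc) auto
    also have "(LINT p:unit_disc|lborel. t) = t * m"
      by (simp add: set_lebesgue_integral_def m_def)
    also have "(LINT p:unit_disc|lborel. (norm (f (slice_pt I p)))\<^sup>2 / t) = n\<^sup>2 / t"
      using bergman_norm_sq[of f] by (simp add: n_def slice_sq_norm_def)
    finally show ?thesis .
  qed
  have "n \<ge> 0" by (simp add: n_def bergman_norm_nonneg)
  then consider "n > 0" | "n = 0" by linarith
  then have "a \<le> (m + 1) * n"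
  proof cases
    case 1
    then show ?thesis using a_le[of n] by (simp add: field_simps power2_eq_square)
  next
    case 2
    have "m \<ge> 0" by (simp add: m_def)
    have "a \<le> 0 + e" if "e > 0" for e
    proof -
      have "a \<le> e / (m + 1) * m" using a_le[of "e / (m + 1)"] that \<open>m \<ge> 0\<close> 2 by simp
      also have "\<dots> \<le> e" using that \<open>m \<ge> 0\<close> by (simp add: field_simps)
      finally show ?thesis by simp
    qed
    then have "a \<le> 0" by (rule field_le_epsilon)
    then show ?thesis using 2 by simp
  qed
  then show "(LINT p:unit_disc|lborel. norm (f (slice_pt I p)))
      \<le> (measure lborel unit_disc + 1) * bergman_norm f"
    by (simp add: a_def m_def n_def)
qed

lemma kernel_slice_bound:
  assumes "r < 1"
  shows "\<exists>M\<ge>0. \<forall>J\<in>imag_units. \<forall>w z. norm w \<le> r \<longrightarrow> norm z < 1 \<longrightarrow>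
     norm (slice_bergman_kernel N (slice_embed I z) (slice_embed J w)) \<le> M"
proof -
  define M where "M = real N / pi * (inverse ((1 - r) ^ (2 * N)) * (\<Sum>k<N. \<bar>radial_coeff N k\<bar> * 4 ^ (N - 1 - k) * 4 ^ k))"
  have M: "norm (disc_kernel N z w) \<le> M" if "norm z < 1" "norm w \<le> r" for z w
    unfolding M_def by (rule disc_kernel_bound[OF that assms])
  have M0: "0 \<le> M" unfolding M_def using assms by (intro mult_nonneg_nonneg sum_nonneg) auto
  show ?thesis
  proof (intro exI[of _ "2 * M"] conjI ballI allI impI)
    fix J and w z :: complex
    assume J: "J \<in> imag_units" and w: "norm w \<le> r" and z: "norm z < 1"
    have 1: "norm (slice_embed I (disc_kernel N z v) * qcnj (slice_projection J K)) \<le> M"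
      if "norm v \<le> r" "K \<in> imag_units" for v K
    proof -
      have "norm (disc_kernel N z v) * norm (slice_projection J K) \<le> M * 1"
        by (intro mult_mono M[OF z that(1)] norm_slice_projection[OF that(2) J] M0 norm_ge_zero)
      then show ?thesis by (simp add: norm_mult norm_qcnj norm_slice_embed[OF I])
    qed
    have "norm (slice_bergman_kernel N (slice_embed I z) (slice_embed J w)) \<le> M + M"
      unfolding kernel_on_slice[OF N I J z order_le_less_trans[OF w assms]]
      using 1[OF w I] 1[of "cnj w", OF _ imag_units_uminus[OF I]] w by (intro norm_triangle_le add_mono) simp_all
    then show "norm (slice_bergman_kernel N (slice_embed I z) (slice_embed J w)) \<le> 2 * M" by simp
  qed (use M0 in simp)
qed

lemma kernel_in_bergman_space:
  assumes r: "r \<in> qball"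
  shows "(\<lambda>q. slice_bergman_kernel N q r) \<in> bergman"
proof -
  obtain J w where J: "J \<in> imag_units" and r_eq: "r = slice_embed J w" and "norm w = norm r"
    by (rule slice_embed_cases)
  then have w: "norm w < 1" using r by (simp add: qball_def)
  note ext = slice_extends_kernel[OF N J w, folded r_eq]
  have pa: "polyanalytic_on_slice N I (\<lambda>q. slice_bergman_kernel N q r)"
    unfolding polyanalytic_on_slice_def
  proof
    fix c
    interpret L: bounded_linear "slice_coord I c" by (rule bounded_linear_slice_coord)
    have "polyanalytic_disc N (\<lambda>z. slice_coord I c (qcnj (slice_projection J I)) * disc_kernel N z w
        + slice_coord I c (qcnj (slice_projection J (- I))) * disc_kernel N z (cnj w))"
      by (intro polyanalytic_disc_add polyanalytic_disc_cmult polyanalytic_disc_kernel) (use w in simp_all)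
    then show "polyanalytic_disc N (\<lambda>z. slice_coord I c (slice_bergman_kernel N (slice_embed I z) r))"
      by (rule polyanalytic_disc_cong)
         (simp add: r_eq kernel_on_slice[OF N I J _ w] L.add slice_coord_embed_mult[OF I] mult.commute)
  qed
  have cont: "continuous_on unit_disc (\<lambda>p. (norm (slice_bergman_kernel N (slice_pt I p) r))\<^sup>2)"
    using Ck_on_imp_continuous_on[OF polyanalytic_on_slice_imp_Ck_on[OF pa]] by (intro continuous_intros)
  obtain M where M: "\<And>z. norm z < 1 \<Longrightarrow> norm (slice_bergman_kernel N (slice_embed I z) r) \<le> M"
    using kernel_slice_bound[OF w] J unfolding r_eq by blast
  have "disc_integrable (\<lambda>p. (norm (slice_bergman_kernel N (slice_pt I p) r))\<^sup>2)"
  proof (rule set_integrable_unit_disc_bound[OF set_integrable_const_unit_disc[of "M\<^sup>2"] cont])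
    fix p assume "p \<in> unit_disc"
    then have "norm (disc_point p) < 1" using disc_point_in_ball[of p] by simp
    from M[OF this] show "norm ((norm (slice_bergman_kernel N (slice_pt I p) r))\<^sup>2) \<le> M\<^sup>2"
      by (simp add: slice_pt_eq_embed power_mono)
  qed
  then show ?thesis
    unfolding slice_bergman_space_iff[OF I]
    using ext(2) pa slice_induced_imp_representation[OF I slice_extends_induced[OF ext(1)]] by blast
qed

text \<open>
  All coordinates of both sides agree, by the complex reproducing property.
\<close>

lemma disc_kernel_reproducing_slice:
  assumes f: "f \<in> bergman" and w: "norm w < 1"
  shows "disc_integrable (\<lambda>p. slice_embed I (cnj (disc_kernel N (disc_point p) w)) * f (slice_pt I p))" (is "disc_integrable ?F")
    and "(LINT p:unit_disc|lborel. slice_embed I (cnj (disc_kernel N (disc_point p) w)) * f (slice_pt I p)) = f (slice_embed I w)"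
proof -
  define M where "M = real N / pi * (inverse ((1 - norm w) ^ (2 * N)) * (\<Sum>k<N. \<bar>radial_coeff N k\<bar> * 4 ^ (N - 1 - k) * 4 ^ k))"
  have M: "norm (disc_kernel N z w) \<le> M" if "norm z < 1" for z
    unfolding M_def by (rule disc_kernel_bound[OF that order_refl w])
  have contk: "continuous_on (ball 0 1) (\<lambda>z. cnj (disc_kernel N z w))"
    using polyanalytic_disc_continuous[OF polyanalytic_disc_kernel[OF w]] by (intro continuous_intros)
  have contdp: "continuous_on unit_disc disc_point"
    unfolding disc_point_def[abs_def] Complex_eq by (intro continuous_intros)
  have dp: "disc_point p \<in> ball 0 1" if "p \<in> unit_disc" for p
    using that disc_point_in_ball by blast
  have contkp: "continuous_on unit_disc (\<lambda>p. cnj (disc_kernel N (disc_point p) w))"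
    by (rule continuous_on_compose2[OF contk contdp]) (use dp in blast)
  show int: "disc_integrable ?F"
  proof (rule set_integrable_unit_disc_bound[where g = "\<lambda>p. M * norm (f (slice_pt I p))"])
    show "disc_integrable (\<lambda>p. M * norm (f (slice_pt I p)))"
      using set_integrable_norm[OF bergman_integrable(1)[OF f]] by simp
    show "continuous_on unit_disc ?F"
      unfolding slice_embed_def by (intro continuous_intros contkp bergman_continuous[OF f])
    fix p assume "p \<in> unit_disc"
    then have "norm (disc_point p) < 1" using dp[of p] by simp
    from M[OF this] show "norm (slice_embed I (cnj (disc_kernel N (disc_point p) w)) * f (slice_pt I p)) \<le> M * norm (f (slice_pt I p))"
      by (simp add: norm_mult norm_slice_embed[OF I] mult_right_mono)
  qed
  have pa: "polyanalytic_on_slice N I f" using f by (simp add: slice_bergman_space_iff[OF I])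
  show "(LINT p:unit_disc|lborel. ?F p) = f (slice_embed I w)"
  proof (rule slice_coord_eqI[of I])
    fix c
    define g where "g z = slice_coord I c (f (slice_embed I z))" for z
    interpret L: bounded_linear "slice_coord I c" by (rule bounded_linear_slice_coord)
    have gpa: "polyanalytic_disc N g"
      using pa unfolding polyanalytic_on_slice_def g_def[abs_def] by blast
    have contg: "continuous_on (ball 0 1) g" by (rule polyanalytic_disc_continuous[OF gpa])
    have "disc_integrable (\<lambda>p. g (disc_point p))"
      using integrable_bounded_linear[OF bounded_linear_slice_coord bergman_integrable(1)[OF f, unfolded set_integrable_def], of I c]
      by (simp add: set_integrable_def g_def slice_pt_eq_embed L.scaleR)
    then have gint: "set_integrable lborel (ball 0 1) g"
      using set_integral_disc_coordinates(1)[OF contg] by blast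
    have "slice_coord I c (LINT p:unit_disc|lborel. ?F p)
       = (LINT p:unit_disc|lborel. slice_coord I c (slice_embed I (cnj (disc_kernel N (disc_point p) w)) * f (slice_pt I p)))"
      unfolding set_lebesgue_integral_def
      using integral_bounded_linear[OF bounded_linear_slice_coord int[unfolded set_integrable_def], of I c]
      by (simp add: L.scaleR)
    also have "\<dots> = (LINT p:unit_disc|lborel. cnj (disc_kernel N (disc_point p) w) * g (disc_point p))"
      by (simp add: slice_coord_embed_mult[OF I] g_def slice_pt_eq_embed)
    also have "\<dots> = (LINT z:ball 0 1|lborel. cnj (disc_kernel N z w) * g z)"
      by (rule set_integral_disc_coordinates(2)[symmetric]) (intro continuous_intros contk contg)
    also have "\<dots> = g w"
      by (rule disc_kernel_reproducing[OF gpa gint N w])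
    finally show "slice_coord I c (LINT p:unit_disc|lborel. ?F p)
       = slice_coord I c (f (slice_embed I w))"
      by (simp add: g_def)
  qed
qed

section \<open>Reproducing property and completeness\<close>

text \<open>
  Conjugating the kernel turns its right coefficients \<open>qcnj P\<close> and \<open>qcnj P'\<close> into left coefficients \<open>P\<close> and
  \<open>P'\<close>, which are exactly those of the representation formula for \<open>f r\<close>.
\<close>

theorem bergman_reproducing:
  assumes f: "f \<in> bergman" and r: "r \<in> qball"
  shows "f r = slice_bergman_inner I f (\<lambda>q. slice_bergman_kernel N q r)"
proof -
  obtain J w where J: "J \<in> imag_units" and r_eq: "r = slice_embed J w" and "norm w = norm r"
    by (rule slice_embed_cases)
  then have w: "norm w < 1" "norm (cnj w) < 1" using r by (simp_all add: qball_def)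
  define P P' where "P = slice_projection J I" and "P' = slice_projection J (- I)"
  define F where "F v p = slice_embed I (cnj (disc_kernel N (disc_point p) v)) * f (slice_pt I p)" for v p
  have F: "disc_integrable (F v)" "(LINT p:unit_disc|lborel. F v p) = f (slice_embed I v)"
    if "norm v < 1" for v
    using disc_kernel_reproducing_slice[OF f that] by (simp_all add: F_def[abs_def])
  have pt: "qcnj (slice_bergman_kernel N (slice_pt I p) r) * f (slice_pt I p) = P * F w p + P' * F (cnj w) p"
    if "p \<in> unit_disc" for p
  proof -
    have z: "norm (disc_point p) < 1" using that disc_point_in_ball[of p] by simp
    show ?thesis
      unfolding r_eq slice_pt_eq_embed kernel_on_slice[OF N I J z w(1)] F_def P_def P'_def
      by (simp add: qcnj_simps qcnj_slice_embed[OF I] algebra_simps)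
  qed
  have intP: "disc_integrable (\<lambda>p. a * F v p)"
     "(LINT p:unit_disc|lborel. a * F v p) = a * f (slice_embed I v)" if "norm v < 1" for a v
  proof -
    have bl: "bounded_linear (\<lambda>x. a * x)" by (rule bounded_linear_mult_right)
    show "disc_integrable (\<lambda>p. a * F v p)"
      using integrable_bounded_linear[OF bl F(1)[OF that, unfolded set_integrable_def]]
      by (simp add: set_integrable_def)
    show "(LINT p:unit_disc|lborel. a * F v p) = a * f (slice_embed I v)"
      using integral_bounded_linear[OF bl F(1)[OF that, unfolded set_integrable_def]] F(2)[OF that]
      by (simp add: set_lebesgue_integral_def)
  qed
  have "slice_bergman_inner I f (\<lambda>q. slice_bergman_kernel N q r) = (LINT p:unit_disc|lborel. P * F w p + P' * F (cnj w) p)"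
    unfolding slice_bergman_inner_def
    by (rule set_lebesgue_integral_cong) (use pt borel_unit_disc in auto)
  also have "\<dots> = P * f (slice_embed I w) + P' * f (slice_embed I (cnj w))"
    by (subst set_integral_add(2)[OF intP(1)[OF w(1)] intP(1)[OF w(2)]]) (simp only: intP(2)[OF w(1)] intP(2)[OF w(2)])
  also have "\<dots> = f r"
    using f J w unfolding slice_bergman_space_iff[OF I] slice_representation_def r_eq P_def P'_def by simp
  finally show ?thesis ..
qed

theorem bergman_evaluation_bound:
  assumes "s < 1"
  shows "\<exists>C\<ge>0. \<forall>f\<in>bergman. \<forall>r. norm r \<le> s \<longrightarrow> norm (f r) \<le> C * bergman_norm f"
proof -
  obtain M where M0: "M \<ge> 0" and M: "\<And>J w z. J \<in> imag_units \<Longrightarrow> norm w \<le> s \<Longrightarrow> norm z < 1 \<Longrightarrow>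
     norm (slice_bergman_kernel N (slice_embed I z) (slice_embed J w)) \<le> M"
    using kernel_slice_bound[OF assms] by blast
  show ?thesis
  proof (intro exI[of _ "M * (measure lborel unit_disc + 1)"] conjI ballI allI impI)
    fix f and r :: quat assume f: "f \<in> bergman" and r: "norm r \<le> s"
    have rb: "r \<in> qball" using r assms by (simp add: qball_def)
    obtain J w where J: "J \<in> imag_units" and r_eq: "r = slice_embed J w" and "norm w = norm r"
      by (rule slice_embed_cases)
    then have w: "norm w \<le> s" using r by simp
    have int: "disc_integrable (\<lambda>p. qcnj (slice_bergman_kernel N (slice_pt I p) r) * f (slice_pt I p))"
      by (rule bergman_mult_integrable[OF f kernel_in_bergman_space[OF rb]])
    have "norm (f r) \<le> (LINT p:unit_disc|lborel. norm (qcnj (slice_bergman_kernel N (slice_pt I p) r) * f (slice_pt I p)))"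
      unfolding bergman_reproducing[OF f rb] slice_bergman_inner_def
      by (rule set_integral_norm_bound[OF int])
    also have "\<dots> \<le> (LINT p:unit_disc|lborel. M * norm (f (slice_pt I p)))"
    proof (rule set_integral_mono[OF set_integrable_norm[OF int]])
      show "disc_integrable (\<lambda>p. M * norm (f (slice_pt I p)))"
        using set_integrable_norm[OF bergman_integrable(1)[OF f]] by simp
      fix p assume "p \<in> unit_disc"
      then have "norm (disc_point p) < 1" using disc_point_in_ball[of p] by simp
      from M[OF J w this] show "norm (qcnj (slice_bergman_kernel N (slice_pt I p) r) * f (slice_pt I p)) \<le> M * norm (f (slice_pt I p))"
        by (simp add: norm_mult norm_qcnj slice_pt_eq_embed r_eq mult_right_mono)
    qed
    also have "\<dots> = M * (LINT p:unit_disc|lborel. norm (f (slice_pt I p)))" by simp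
    also have "\<dots> \<le> M * ((measure lborel unit_disc + 1) * bergman_norm f)"
      by (rule mult_left_mono[OF bergman_integrable(2)[OF f] M0])
    finally show "norm (f r) \<le> M * (measure lborel unit_disc + 1) * bergman_norm f"
      by (simp add: mult.assoc)
  qed (use M0 in simp)
qed

text \<open>
  The limit is taken pointwise. Evaluation bounds make the convergence locally uniform, so the limit is
  slice polyanalytic; Fatou's lemma bounds the distance from \<open>X n\<close> to the limit by the distances
  from \<open>X n\<close> to the later terms.
\<close>

theorem bergman_complete:
  assumes X: "\<And>n. X n \<in> bergman"
    and Cauchy: "\<And>e. e > 0 \<Longrightarrow> \<exists>M. \<forall>m\<ge>M. \<forall>n\<ge>M. bergman_norm (\<lambda>q. X m q - X n q) < e"
  obtains L where "L \<in> bergman"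
    "(\<lambda>n::nat. bergman_norm (\<lambda>q. X n q - L q)) \<longlonglongrightarrow> 0"
proof -
  have unifC: "\<exists>M. \<forall>m\<ge>M. \<forall>n\<ge>M. \<forall>r. norm r \<le> s \<longrightarrow> norm (X m r - X n r) < e" if s: "s < 1" and e: "e > 0" for s e
  proof -
    obtain C where C0: "C \<ge> 0" and C: "\<And>f r. f \<in> bergman \<Longrightarrow> norm r \<le> s \<Longrightarrow> norm (f r) \<le> C * bergman_norm f"
      using bergman_evaluation_bound[OF s] by blast
    obtain M where M: "\<forall>m\<ge>M. \<forall>n\<ge>M. bergman_norm (\<lambda>q. X m q - X n q) < e / (C + 1)"
      using Cauchy[of "e / (C + 1)"] C0 e by auto
    show ?thesis
    proof (intro exI[of _ M] allI impI)
      fix m n r assume mn: "m \<ge> M" "n \<ge> M" and r: "norm (r::quat) \<le> s"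
      have "norm (X m r - X n r) \<le> C * bergman_norm (\<lambda>q. X m q - X n q)"
        by (rule C[OF bergman_diff[OF X X] r])
      also have "\<dots> \<le> C * (e / (C + 1))"
        using M mn C0 by (intro mult_left_mono) (auto simp: less_imp_le)
      also have "\<dots> < e" using C0 e by (simp add: field_simps)
      finally show "norm (X m r - X n r) < e" .
    qed
  qed
  define L where "L q = (if q \<in> qball then lim (\<lambda>n. X n q) else 0)" for q
  have lim: "(\<lambda>n. X n q) \<longlonglongrightarrow> L q" for q
  proof (cases "q \<in> qball")
    case True
    then have "norm q < 1" by (simp add: qball_def)
    have "Cauchy (\<lambda>n. X n q)"
    proof (rule CauchyI)
      fix e :: real assume "e > 0"
      from unifC[OF \<open>norm q < 1\<close> this] show "\<exists>M. \<forall>m\<ge>M. \<forall>n\<ge>M. norm (X m q - X n q) < e"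
        by blast
    qed
    then show ?thesis using True by (simp add: L_def Cauchy_convergent_iff convergent_LIMSEQ_iff)
  next
    case False
    then have "X n q = 0" for n using X[of n] by (simp add: slice_bergman_space_iff[OF I])
    then show ?thesis using False by (simp add: L_def)
  qed
  have rep: "slice_representation I L"
    unfolding slice_representation_def
  proof (intro ballI)
    fix J z assume J: "J \<in> imag_units" and z: "z \<in> ball (0::complex) 1"
    have "X n (slice_embed J z) = slice_projection J I * X n (slice_embed I z)
       + slice_projection J (- I) * X n (slice_embed I (cnj z))" for n
      using X[of n] J z unfolding slice_bergman_space_iff[OF I] slice_representation_def by blast
    then have "(\<lambda>n. X n (slice_embed J z)) \<longlonglongrightarrow> slice_projection J I * L (slice_embed I z)
       + slice_projection J (- I) * L (slice_embed I (cnj z))"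
      by (simp only:) (intro tendsto_intros lim)
    then show "L (slice_embed J z) = slice_projection J I * L (slice_embed I z)
       + slice_projection J (- I) * L (slice_embed I (cnj z))"
      by (rule LIMSEQ_unique[OF lim])
  qed
  have pa: "polyanalytic_on_slice N I L"
    unfolding polyanalytic_on_slice_def
  proof
    fix c
    interpret B: bounded_linear "slice_coord I c" by (rule bounded_linear_slice_coord)
    obtain K where K: "K > 0" "\<And>x. norm (slice_coord I c x) \<le> norm x * K"
      using B.pos_bounded by blast
    show "polyanalytic_disc N (\<lambda>z. slice_coord I c (L (slice_embed I z)))"
    proof (rule polyanalytic_disc_uniform_limit)
      show "polyanalytic_disc N (\<lambda>z. slice_coord I c (X n (slice_embed I z)))" for n
        using X[of n] unfolding slice_bergman_space_iff[OF I] polyanalytic_on_slice_def by blast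
      show "(\<lambda>n. slice_coord I c (X n (slice_embed I z))) \<longlonglongrightarrow> slice_coord I c (L (slice_embed I z))" for z
        by (rule B.tendsto[OF lim])
      fix s :: real assume s: "0 < s" "s < 1"
      show "uniformly_Cauchy_on (cball 0 s) (\<lambda>n z. slice_coord I c (X n (slice_embed I z)))"
      proof (rule uniformly_Cauchy_onI)
        fix e :: real assume e: "e > 0"
        obtain M where M: "\<forall>m\<ge>M. \<forall>n\<ge>M. \<forall>r. norm r \<le> s \<longrightarrow> norm (X m r - X n r) < e / K"
          using unifC[OF s(2), of "e / K"] K e by auto
        show "\<exists>M. \<forall>z\<in>cball 0 s. \<forall>m\<ge>M. \<forall>n\<ge>M. dist (slice_coord I c (X m (slice_embed I z))) (slice_coord I c (X n (slice_embed I z))) < e"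
        proof (intro exI[of _ M] ballI allI impI)
          fix z :: complex and m n assume z: "z \<in> cball 0 s" and mn: "m \<ge> M" "n \<ge> M"
          have "dist (slice_coord I c (X m (slice_embed I z))) (slice_coord I c (X n (slice_embed I z)))
             \<le> norm (X m (slice_embed I z) - X n (slice_embed I z)) * K"
            unfolding dist_norm B.diff[symmetric] by (rule K(2))
          also have "\<dots> < e / K * K"
            using M mn z K(1) by (intro mult_strict_right_mono) (simp_all add: norm_slice_embed[OF I])
          finally show "dist (slice_coord I c (X m (slice_embed I z))) (slice_coord I c (X n (slice_embed I z))) < e"
            using K(1) by simp
        qed
      qed
    qed
  qed
  define D where "D n q = X n q - L q" for n q
  have Drep: "slice_representation I (D n)" and Dpa: "polyanalytic_on_slice N I (D n)" for n
  proof -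
    have X': "slice_representation I (X n)" "polyanalytic_on_slice N I (X n)"
      using X[of n] by (simp_all add: slice_bergman_space_iff[OF I])
    show "slice_representation I (D n)"
      using slice_representation_add[OF X'(1) slice_representation_mult_const[OF rep, of "-1"]]
      by (simp add: D_def[abs_def])
    show "polyanalytic_on_slice N I (D n)"
      using polyanalytic_on_slice_add[OF X'(2) polyanalytic_on_slice_mult_const[OF pa, of "-1"]]
      by (simp add: D_def[abs_def])
  qed
  have contD: "continuous_on unit_disc (\<lambda>p. (norm (D n (slice_pt I p)))\<^sup>2)" for n
    using Ck_on_imp_continuous_on[OF polyanalytic_on_slice_imp_Ck_on[OF Dpa]] by (intro continuous_intros)
  define E where "E n = (\<integral>\<^sup>+ p \<in> unit_disc. ennreal ((norm (D n (slice_pt I p)))\<^sup>2) \<partial>lborel)" for n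
  have bound: "\<exists>M. \<forall>n\<ge>M. E n \<le> ennreal (e\<^sup>2)"
    if e: "e > 0" for e
  proof -
    obtain M where M: "\<forall>m\<ge>M. \<forall>n\<ge>M. bergman_norm (\<lambda>q. X m q - X n q) < e" using Cauchy[OF e] by blast
    show ?thesis
    proof (intro exI[of _ M] allI impI)
      fix n assume n: "n \<ge> M"
      define u where "u m p = ennreal ((norm (X n (slice_pt I p) - X m (slice_pt I p)))\<^sup>2) * indicator unit_disc p" for m p
      have contd: "continuous_on unit_disc (\<lambda>p. (norm (X n (slice_pt I p) - X m (slice_pt I p)))\<^sup>2)" for m
        by (intro continuous_intros bergman_continuous X)
      have u_le: "(\<integral>\<^sup>+ p. u m p \<partial>lborel) \<le> ennreal (e\<^sup>2)" if m: "m \<ge> M" for m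
      proof -
        have "(\<integral>\<^sup>+ p. u m p \<partial>lborel) = ennreal (slice_sq_norm I (\<lambda>q. X n q - X m q))"
          unfolding u_def slice_sq_norm_def
          by (rule set_nn_integral_iff_integrable(2)[OF contd])
             (use bergman_sq_integrable[OF bergman_diff[OF X X]] in auto)
        also have "\<dots> = ennreal ((bergman_norm (\<lambda>q. X n q - X m q))\<^sup>2)" by (simp only: bergman_norm_sq)
        also have "\<dots> \<le> ennreal (e\<^sup>2)"
          using M n m by (intro ennreal_leI power_mono bergman_norm_nonneg) (auto simp: less_imp_le)
        finally show ?thesis .
      qed
      have um: "u m \<in> borel_measurable lborel" for m
      proof -
        have "(\<lambda>p. indicat_real unit_disc p *\<^sub>R (norm (X n (slice_pt I p) - X m (slice_pt I p)))\<^sup>2) \<in> borel_measurable borel"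
          by (rule borel_measurable_continuous_on_indicator[OF borel_unit_disc contd])
        then have "(\<lambda>p. ennreal (indicat_real unit_disc p *\<^sub>R (norm (X n (slice_pt I p) - X m (slice_pt I p)))\<^sup>2)) \<in> borel_measurable lborel"
          by simp
        also have "(\<lambda>p. ennreal (indicat_real unit_disc p *\<^sub>R (norm (X n (slice_pt I p) - X m (slice_pt I p)))\<^sup>2)) = u m"
          by (auto simp: u_def fun_eq_iff split: split_indicator)
        finally show ?thesis .
      qed
      have ulim: "liminf (\<lambda>m. u m p) = ennreal ((norm (D n (slice_pt I p)))\<^sup>2) * indicator unit_disc p" for p
      proof (rule lim_imp_Liminf)
        have "(\<lambda>m. ennreal ((norm (X n (slice_pt I p) - X m (slice_pt I p)))\<^sup>2)) \<longlonglongrightarrow> ennreal ((norm (D n (slice_pt I p)))\<^sup>2)"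
          unfolding D_def by (intro tendsto_ennrealI tendsto_intros lim)
        then show "(\<lambda>m. u m p) \<longlonglongrightarrow> ennreal ((norm (D n (slice_pt I p)))\<^sup>2) * indicator unit_disc p"
          by (cases "p \<in> unit_disc") (simp_all add: u_def)
      qed simp
      have "E n = (\<integral>\<^sup>+ p. liminf (\<lambda>m. u m p) \<partial>lborel)"
        by (simp only: ulim E_def)
      also have "\<dots> \<le> liminf (\<lambda>m. \<integral>\<^sup>+ p. u m p \<partial>lborel)"
        by (rule nn_integral_liminf[OF um])
      also have "\<dots> \<le> ennreal (e\<^sup>2)"
        by (rule Liminf_le) (use u_le in \<open>auto simp: eventually_sequentially\<close>)
      finally show "E n \<le> ennreal (e\<^sup>2)" .
    qed
  qed
  have Dint: "disc_integrable (\<lambda>p. (norm (D n (slice_pt I p)))\<^sup>2)"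
    if "E n \<le> ennreal c" for n c
  proof -
    have "E n < \<infinity>"
      using that by (rule order_le_less_trans) simp
    then show ?thesis
      using set_nn_integral_iff_integrable(1)[OF contD] by (simp add: E_def)
  qed
  have D0: "D n q = 0" if "q \<notin> qball" for n q
    using X[of n] that by (simp add: slice_bergman_space_iff[OF I] D_def L_def)
  obtain M1 where M1: "\<forall>n\<ge>M1. E n \<le> ennreal (1\<^sup>2)"
    using bound[of 1] by auto
  have "D M1 \<in> bergman"
    unfolding slice_bergman_space_iff[OF I] using D0 Drep Dpa Dint[of M1 "1\<^sup>2"] M1 by blast
  from bergman_diff[OF X[of M1] this] have "L \<in> bergman"
    by (simp add: D_def[abs_def])
  moreover have "(\<lambda>n. bergman_norm (\<lambda>q. X n q - L q)) \<longlonglongrightarrow> 0"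
  proof (rule LIMSEQ_I)
    fix e :: real assume e: "e > 0"
    obtain M where M: "\<forall>n\<ge>M. E n \<le> ennreal ((e / 2)\<^sup>2)"
      using bound[of "e / 2"] e by auto
    show "\<exists>M. \<forall>n\<ge>M. norm (bergman_norm (\<lambda>q. X n q - L q) - 0) < e"
    proof (intro exI[of _ M] allI impI)
      fix n assume n: "n \<ge> M"
      have "E n = ennreal (slice_sq_norm I (D n))"
        unfolding slice_sq_norm_def E_def
        by (rule set_nn_integral_iff_integrable(2)[OF contD _ Dint]) (use M n in auto)
      then have "ennreal ((bergman_norm (D n))\<^sup>2) \<le> ennreal ((e / 2)\<^sup>2)"
        unfolding bergman_norm_sq using M[rule_format, OF n] by (rule ord_eq_le_trans[OF sym])
      then have "(bergman_norm (D n))\<^sup>2 \<le> (e / 2)\<^sup>2"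
        by (subst (asm) ennreal_le_iff) auto
      then have "bergman_norm (D n) \<le> e / 2"
        by (rule power2_le_imp_le) (use e in simp)
      then show "norm (bergman_norm (\<lambda>q. X n q - L q) - 0) < e"
        using e bergman_norm_nonneg[of "D n"] by (simp add: D_def[abs_def])
    qed
  qed
  ultimately show ?thesis by (rule that)
qed

lemma bergman_rkhs: "right_quat_rkhs qball (bergman) (slice_bergman_inner I)"
  unfolding right_quat_rkhs_def
proof (intro conjI ballI allI impI)
  show "f x = 0" if "f \<in> bergman" "x \<notin> qball" for f x
    using that by (simp add: slice_bergman_space_iff[OF I])
  show "\<exists>C. \<forall>f\<in>bergman. norm (f x) \<le> C * bergman_norm f" if "x \<in> qball" for x
    using bergman_evaluation_bound[of "norm x"] that by (auto simp: qball_def)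
  have int_add: "disc_integrable (\<lambda>p. qcnj (w (slice_pt I p)) * u (slice_pt I p))"
    if "u \<in> bergman" "w \<in> bergman" for u w
    by (rule bergman_mult_integrable[OF that])
  show "right_quat_hilbert_space (bergman) (\<lambda>f a x. f x * a) (slice_bergman_inner I)"
  proof
    show "0 \<in> bergman" using bergman_zero by (simp add: zero_fun_def)
  next
    fix u v assume "u \<in> bergman" "v \<in> bergman"
    then show "u + v \<in> bergman" using bergman_add by (simp add: plus_fun_def)
  next
    fix u a assume "u \<in> bergman"
    then show "(\<lambda>x. u x * a) \<in> bergman" by (rule bergman_mult_const)
  next
    fix u v w assume uvw: "u \<in> bergman" "v \<in> bergman" "w \<in> bergman"
    show "slice_bergman_inner I (u + v) w = slice_bergman_inner I u w + slice_bergman_inner I v w"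
      unfolding slice_bergman_inner_def
      by (simp add: distrib_left set_integral_add(2) int_add uvw)
  next
    fix u w and a :: quat assume uw: "u \<in> bergman" "w \<in> bergman"
    have bl: "bounded_linear (\<lambda>x. x * a)" by (rule bounded_linear_mult_left)
    show "slice_bergman_inner I (\<lambda>x. u x * a) w = slice_bergman_inner I u w * a"
      unfolding slice_bergman_inner_def set_lebesgue_integral_def
      using integral_bounded_linear[OF bl int_add[OF uw, unfolded set_integrable_def]] by (simp add: mult.assoc)
  next
    fix u w assume uw: "u \<in> bergman" "w \<in> bergman"
    show "slice_bergman_inner I w u = qcnj (slice_bergman_inner I u w)"
      unfolding slice_bergman_inner_def set_lebesgue_integral_def
      using integral_bounded_linear[OF qcnj_bounded_linear int_add[OF uw, unfolded set_integrable_def]]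
      by (simp add: qcnj_simps)
  next
    fix u assume u: "u \<in> bergman"
    show "0 \<le> qRe (slice_bergman_inner I u u)" by (simp add: bergman_inner_self slice_sq_norm_nonneg)
    assume "slice_bergman_inner I u u = 0"
    then have n0: "bergman_norm u = 0" by (simp add: ip_norm_def)
    have "u x = 0" for x
    proof (cases "x \<in> qball")
      case True
      then show ?thesis
        using bergman_evaluation_bound[of "norm x"] u n0 by (force simp: qball_def)
    next
      case False
      then show ?thesis using u by (simp add: slice_bergman_space_iff[OF I])
    qed
    then show "u = 0" by (simp add: fun_eq_iff)
  next
    fix X :: "nat \<Rightarrow> quat \<Rightarrow> quat"
    assume X: "range X \<subseteq> bergman"
      and C: "\<And>e. e > 0 \<Longrightarrow> \<exists>M. \<forall>m\<ge>M. \<forall>n\<ge>M. bergman_norm (X m - X n) < e"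
    obtain L where "L \<in> bergman" "(\<lambda>n. bergman_norm (\<lambda>q. X n q - L q)) \<longlonglongrightarrow> 0"
    proof (rule bergman_complete[of X])
      show "X n \<in> bergman" for n using X by blast
      show "\<exists>M. \<forall>m\<ge>M. \<forall>n\<ge>M. bergman_norm (\<lambda>q. X m q - X n q) < e" if "e > 0" for e
        using C[OF that] by (simp add: fun_diff_def)
    qed
    then show "\<exists>L\<in>bergman. (\<lambda>n. bergman_norm (X n - L)) \<longlonglongrightarrow> 0"
      by (auto simp: fun_diff_def)
  qed (simp_all add: fun_eq_iff distrib_left distrib_right mult.assoc)
qed

end

theorem theorem5p2:
  fixes N :: nat and I :: quat
  assumes "N \<ge> 1" and "I \<in> imag_units"
  shows "right_quat_rkhs qball (slice_bergman_space N I) (slice_bergman_inner I) \<and>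
    is_reproducing_kernel qball (slice_bergman_space N I) (slice_bergman_inner I)
      (slice_bergman_kernel N)"
  using bergman_rkhs[OF assms] kernel_in_bergman_space[OF assms] bergman_reproducing[OF assms]
  unfolding is_reproducing_kernel_def by blast

end
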